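(* For $\varepsilon>0$ let $\mathrm{X}^\varepsilon=(X^\varepsilon,Y^\varepsilon,Z^\varepsilon)$ be the $\varepsilon$-dilated Brownian motion on the Heisenberg group, i.e. the solution of $d\mathrm{X}_t^\varepsilon=\sigma_1(\mathrm{X}_t^\varepsilon)\,\varepsilon\,dW_t^1+\sigma_2(\mathrm{X}_t^\varepsilon)\,\varepsilon\,dW_t^2$, started at $(0,\varepsilon\hat y_0,\varepsilon\hat z_0)$ with $\hat y_0,\hat z_0\in\mathbb{R}$ fixed. Then $(X_1^\varepsilon,Z_1^\varepsilon)$ admits a density $f^\varepsilon(x,z;T)|_{T=1}$ on $\mathbb{R}^2$ and, whenever $z>0$ and $|x|<\sqrt{8z/\pi}$, there is some $c_0>0$ such that, as $\varepsilon\to0$, $$f^\varepsilon(x,z;T)|_{T=1}\sim e^{-\pi z/\varepsilon^2}\,e^{\pi(\hat z_0-\hat y_0x/2)/\varepsilon}\,\varepsilon^{-2}\,c_0 .$$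
   Context: The vector fields on $\mathbb{R}^3$ are $\sigma_1(x,y,z)=(1,0,-y/2)^T$ and $\sigma_2(x,y,z)=(0,1,x/2)^T$; $(W^1,W^2)$ is a standard planar Brownian motion. $g\sim h$ means $g/h\to1$ as $\varepsilon\to0$. *)

theory Defs
  imports "HOL-Probability.Probability" "HOL-Library.Landau_Symbols"
begin

definition planar_brownian_motion ::
  "'a measure \<Rightarrow> (real \<Rightarrow> 'a measure) \<Rightarrow> (real \<Rightarrow> 'a \<Rightarrow> real \<times> real) \<Rightarrow> bool" where
  "planar_brownian_motion M F W \<longleftrightarrow>
     prob_space M \<and> filtration (space M) F \<and>
     (\<forall>t\<ge>0. subalgebra M (F t) \<and> W t \<in> borel_measurable (F t)) \<and>
     (AE \<omega> in M. W 0 \<omega> = (0, 0)) \<and>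
     (AE \<omega> in M. continuous_on {0..} (\<lambda>t. W t \<omega>)) \<and>
     (\<forall>s\<ge>0. \<forall>t>s.
        distributed M lborel (\<lambda>\<omega>. W t \<omega> - W s \<omega>)
          (\<lambda>(u, v). ennreal (normal_density 0 (sqrt (t - s)) u * normal_density 0 (sqrt (t - s)) v)) \<and>
        prob_space.indep_set M (sets (F s))
          {(\<lambda>\<omega>. W t \<omega> - W s \<omega>) -` A \<inter> space M | A. A \<in> sets borel})"

text \<open>
  The triple \<open>(n, \<tau>, \<xi>)\<close> encodes the simple process whose value on \<open>(\<tau> i, \<tau> (i + 1)]\<close>
  is \<open>\<xi> i\<close>, for \<open>i < n\<close>, and which vanishes elsewhere.
\<close>

type_synonym ('a, 'e) simple_data = "nat \<times> (nat \<Rightarrow> real) \<times> (nat \<Rightarrow> 'a \<Rightarrow> 'e)"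

definition simple_integrand ::
  "'a measure \<Rightarrow> (real \<Rightarrow> 'a measure) \<Rightarrow> ('a, 'e::euclidean_space) simple_data \<Rightarrow> bool" where
  "simple_integrand M F = (\<lambda>(n, \<tau>, \<xi>).
     0 \<le> \<tau> 0 \<and> (\<forall>i<n. \<tau> i \<le> \<tau> (Suc i)) \<and>
     (\<forall>i<n. \<xi> i \<in> borel_measurable (F (\<tau> i)) \<and> bounded (\<xi> i ` space M)))"

definition simple_process ::
  "('a, 'e::euclidean_space) simple_data \<Rightarrow> real \<Rightarrow> 'a \<Rightarrow> 'e" where
  "simple_process = (\<lambda>(n, \<tau>, \<xi>) s \<omega>. \<Sum>i<n. indicator {\<tau> i<..\<tau> (Suc i)} s *\<^sub>R \<xi> i \<omega>)"

definition simple_integral ::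
  "(real \<Rightarrow> 'a \<Rightarrow> real) \<Rightarrow> ('a, 'e::euclidean_space) simple_data \<Rightarrow> real \<Rightarrow> 'a \<Rightarrow> 'e" where
  "simple_integral B = (\<lambda>(n, \<tau>, \<xi>) t \<omega>.
     \<Sum>i<n. (B (min (\<tau> (Suc i)) t) \<omega> - B (min (\<tau> i) t) \<omega>) *\<^sub>R \<xi> i \<omega>)"

definition tends_to_zero_in_prob ::
  "'a measure \<Rightarrow> (nat \<Rightarrow> 'a \<Rightarrow> ennreal) \<Rightarrow> bool" where
  "tends_to_zero_in_prob M D \<longleftrightarrow>
     (\<forall>n. D n \<in> borel_measurable M) \<and>
     (\<forall>\<delta>>0. (\<lambda>n. emeasure M {\<omega> \<in> space M. D n \<omega> > ennreal \<delta>}) \<longlonglongrightarrow> 0)"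

text \<open>
  \<open>has_ito_integral M F B H t I\<close>: the random variable \<open>I\<close> is (a version of) the It\^o integral
  of \<open>H\<close> with respect to the Brownian motion \<open>B\<close> over \<open>[0, t]\<close>, for a progressively measurable
  integrand \<open>H\<close> that is almost surely square integrable in time. The It\^o integral is the limit in
  probability of the integrals of simple processes that approximate \<open>H\<close> in \<open>L\<^sup>2([0, t])\<close>,
  in probability.
\<close>

definition has_ito_integral ::
  "'a measure \<Rightarrow> (real \<Rightarrow> 'a measure) \<Rightarrow> (real \<Rightarrow> 'a \<Rightarrow> real) \<Rightarrow>
   (real \<Rightarrow> 'a \<Rightarrow> 'e::euclidean_space) \<Rightarrow> real \<Rightarrow> ('a \<Rightarrow> 'e) \<Rightarrow> bool" where
  "has_ito_integral M F B H t I \<longleftrightarrow>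
     (\<forall>r\<in>{0..t}. (\<lambda>(s, \<omega>). H s \<omega>) \<in> borel_measurable (restrict_space borel {0..r} \<Otimes>\<^sub>M F r)) \<and>
     (AE \<omega> in M. (\<integral>\<^sup>+ s\<in>{0..t}. ennreal ((norm (H s \<omega>))\<^sup>2) \<partial>lborel) < \<infinity>) \<and>
     I \<in> borel_measurable M \<and>
     (\<exists>S. (\<forall>n. simple_integrand M F (S n)) \<and>
          tends_to_zero_in_prob M (\<lambda>n \<omega>.
            \<integral>\<^sup>+ s\<in>{0..t}. ennreal ((norm (simple_process (S n) s \<omega> - H s \<omega>))\<^sup>2) \<partial>lborel) \<and>
          tends_to_zero_in_prob M (\<lambda>n \<omega>. ennreal (norm (simple_integral B (S n) t \<omega> - I \<omega>))))"

definition sde_solution ::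
  "'a measure \<Rightarrow> (real \<Rightarrow> 'a measure) \<Rightarrow> (real \<Rightarrow> 'a \<Rightarrow> real \<times> real) \<Rightarrow>
   ('e \<Rightarrow> 'e) \<Rightarrow> ('e \<Rightarrow> 'e) \<Rightarrow> 'e \<Rightarrow> (real \<Rightarrow> 'a \<Rightarrow> 'e::euclidean_space) \<Rightarrow> bool" where
  "sde_solution M F W V1 V2 x0 X \<longleftrightarrow>
     (\<forall>t\<ge>0. X t \<in> borel_measurable (F t)) \<and>
     (AE \<omega> in M. continuous_on {0..} (\<lambda>t. X t \<omega>)) \<and>
     (AE \<omega> in M. X 0 \<omega> = x0) \<and>
     (\<forall>t\<ge>0. \<exists>I1 I2.
        has_ito_integral M F (\<lambda>s \<omega>. fst (W s \<omega>)) (\<lambda>s \<omega>. V1 (X s \<omega>)) t I1 \<and>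
        has_ito_integral M F (\<lambda>s \<omega>. snd (W s \<omega>)) (\<lambda>s \<omega>. V2 (X s \<omega>)) t I2 \<and>
        (AE \<omega> in M. X t \<omega> = x0 + I1 \<omega> + I2 \<omega>))"

text \<open>
  For these two vector fields the Stratonovich correction \<open>1/2 (D\<sigma>\<^sub>1 \<sigma>\<^sub>1 + D\<sigma>\<^sub>2 \<sigma>\<^sub>2)\<close>
  vanishes, so the It\^o and Stratonovich readings of the equation coincide.
\<close>

definition sigma1 :: "real \<times> real \<times> real \<Rightarrow> real \<times> real \<times> real" where
  "sigma1 = (\<lambda>(x, y, z). (1, 0, - y / 2))"

definition sigma2 :: "real \<times> real \<times> real \<Rightarrow> real \<times> real \<times> real" where
  "sigma2 = (\<lambda>(x, y, z). (0, 1, x / 2))"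

definition dilated_heisenberg_bm ::
  "'a measure \<Rightarrow> (real \<Rightarrow> 'a measure) \<Rightarrow> (real \<Rightarrow> 'a \<Rightarrow> real \<times> real) \<Rightarrow>
   real \<Rightarrow> real \<Rightarrow> real \<Rightarrow> (real \<Rightarrow> 'a \<Rightarrow> real \<times> real \<times> real) \<Rightarrow> bool" where
  "dilated_heisenberg_bm M F W y0 z0 \<epsilon> X \<longleftrightarrow>
     sde_solution M F W (\<lambda>p. \<epsilon> *\<^sub>R sigma1 p) (\<lambda>p. \<epsilon> *\<^sub>R sigma2 p) (0, \<epsilon> * y0, \<epsilon> * z0) X"

definition proj_xz :: "real \<times> real \<times> real \<Rightarrow> real \<times> real" where
  "proj_xz = (\<lambda>(x, y, z). (x, z))"

text \<open>
  A density is only determined almost everywhere; continuity singles out the version for which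
  pointwise statements are meaningful.
\<close>

definition continuous_density ::
  "'a measure \<Rightarrow> ('a \<Rightarrow> 'b::euclidean_space) \<Rightarrow> ('b \<Rightarrow> real) \<Rightarrow> bool" where
  "continuous_density M V f \<longleftrightarrow>
     continuous_on UNIV f \<and> (\<forall>p. 0 \<le> f p) \<and> distributed M lborel V (\<lambda>p. ennreal (f p))"

end

theory Submission
  imports Defs "HOL-Complex_Analysis.Complex_Analysis" "HOL-Real_Asymp.Real_Asymp"
begin

text \<open>
  The solution is \<open>X = \<epsilon> W\<^sup>1\<close> and \<open>Z = \<epsilon> z\<^sub>0 - \<epsilon>\<^sup>2 y\<^sub>0 W\<^sup>1 / 2 + \<epsilon>\<^sup>2 A\<close> with the Levy area
  \<open>A\<close>. Riemann sums for \<open>A\<close> form an exactly solvable Gaussian recursion (one step is the addition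
  theorem of \<open>tanh\<close>), which gives the characteristic function of \<open>(W\<^sup>1, A)\<close>. Fourier inversion
  turns the density into an integral over \<open>l > 0\<close> of
  \<open>exp (- \<i> l a) sqrt (l / sinh l) exp (- c l coth (l / 2))\<close> with \<open>a \<approx> z / \<epsilon>\<^sup>2\<close> and
  \<open>c = x\<^sup>2 / (4 \<epsilon>\<^sup>2)\<close>. The real line is shifted to the horizontal line through \<open>- \<i> (\<pi> + b)\<close>,
  across the branch point \<open>- \<i> \<pi>\<close>, where \<open>coth (l / 2)\<close> vanishes. The shifted line is
  exponentially negligible. Of the vertical segment, the part above the branch point contributes
  nothing to the real part, and the part below is a real Laplace integral with exponent
  \<open>- u (z - \<pi> x\<^sup>2 / 8)\<close>, \<open>u = (v - \<pi>) / \<epsilon>\<^sup>2\<close>; the condition on \<open>x\<close> makes this rate positive.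
\<close>

subsection \<open>The Ito integral as a limit of step integrals\<close>

text \<open>The power \<epsilon>^(-2) is a balance: the frequency of X is integrated out by a
  Gaussian integral, at the cost 1/\<epsilon>; the substitution l = \<epsilon>^2 t costs
  1/\<epsilon>^2; and since the kernel grows like (v - pi)^(-1/2) at the branch point, the scaling v
  = pi + \<epsilon>^2 u returns one factor \<epsilon>. The same Gaussian integral merges 1 / cosh
  (l/2) with the rate tanh (l/2) / l into sqrt (l / sinh l). On the vertical segment the kernel is
  real down to - \<i> pi, and dl = - \<i> dv makes that part imaginary; below, the root has gained a
  factor \<i>, so the part becomes real. The singularity is integrable, hence the path may run
  straight through it and dominated convergence replaces an indentation. The probabilistic obstacle
  is that an Ito integral is known only as a limit in probability along some unspecified simple
  processes, while the integrands are unbounded. A Lenglart inequality for step processes permits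
  replacing that sequence by Riemann sums. These are treated exactly at finite n, and the limit is
  taken only in the characteristic function.\<close>

text \<open>The preimages under \<open>D\<close> are closed under intersection, so independence
  passes to the generated sigma-algebra, and the preimages under \<open>Y\<close> lie in
  \<open>G\<close>. This turns the set form of independence in \<open>planar_brownian_motion\<close>
  into one that supports product formulas.\<close>

lemma (in prob_space) indep_var_of_indep_set:
  assumes G: "subalgebra M G"
    and ind: "indep_set (sets G) {D -` A \<inter> space M | A. A \<in> sets borel}"
    and Y: "Y \<in> measurable G N" and D: "D \<in> borel_measurable M"
  shows "indep_var N Y borel D"
proof -
  have sp: "space G = space M" and st: "sets G \<subseteq> sets M"
    using G by (auto simp: subalgebra_def)
  let ?D = "{D -` A \<inter> space M | A. A \<in> sets borel}"
  have "Int_stable ?D"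
  proof (rule Int_stableI)
    fix a b assume "a \<in> ?D" "b \<in> ?D"
    then obtain A B where "A \<in> sets borel" "B \<in> sets borel" "a = D -` A \<inter> space M" "b = D -` B \<inter> space M"
      by auto
    then show "a \<inter> b \<in> ?D" by (intro CollectI exI[of _ "A \<inter> B"]) auto
  qed
  then have *: "indep_set (sigma_sets (space M) (sets G)) (sigma_sets (space M) ?D)"
    by (intro indep_set_sigma_sets[OF ind]) (auto simp: Int_stable_def)
  have eq: "sigma_sets (space M) (sets G) = sets G"
    using sets.sigma_sets_eq[of G] sp by simp
  have sub: "{Y -` A \<inter> space M | A. A \<in> sets N} \<subseteq> sets G"
    using measurable_sets[OF Y] sp by auto
  have "Y \<in> measurable M N" using measurable_from_subalg[OF G Y] .
  moreover have "indep_set (sigma_sets (space M) {Y -` A \<inter> space M | A. A \<in> sets N}) (sigma_sets (space M) ?D)"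
    unfolding indep_set_def
    by (rule indep_sets_mono_sets[OF *[unfolded indep_set_def]])
      (use sigma_sets_mono'[OF sub] in \<open>auto split: bool.split\<close>)
  ultimately show ?thesis
    unfolding indep_var_eq using D by simp
qed

lemma filtration_measurable_mono:
  assumes "filtration \<Omega> F" "s \<le> t" "f \<in> measurable (F s) N"
  shows "f \<in> measurable (F t) N"
proof -
  interpret filtration \<Omega> F by fact
  have "subalgebra (F t) (F s)"
    using sets_F_mono[OF assms(2)] by (auto simp: subalgebra_def space_F)
  then show ?thesis using assms(3) by (rule measurable_from_subalg)
qed

section \<open>Discrete stochastic integrals: isometry and Lenglart inequality\<close>

lemma partition_mono:
  assumes "\<And>j. j < m \<Longrightarrow> p j \<le> p (Suc j)" "i \<le> j" "j \<le> m"
  shows "p i \<le> (p j :: real)"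
  using assms(2,3)
proof (induction j)
  case (Suc j)
  show ?case
  proof (cases "i = Suc j")
    case False
    then have "p i \<le> p j" using Suc by simp
    also have "p j \<le> p (Suc j)" using assms(1)[of j] Suc by simp
    finally show ?thesis by simp
  qed simp
qed simp

lemma partition_nonneg:
  assumes "0 \<le> p 0" "\<And>j. j < m \<Longrightarrow> p j < p (Suc j)" "j \<le> m"
  shows "0 \<le> (p j :: real)"
  using partition_mono[of m p 0 j, OF less_imp_le] assms by auto

text \<open>Collects what the second moment argument uses, relative to a given filtration, so that
  both coordinates of the planar motion become instances over the same \<open>F\<close>.\<close>

locale filtered_brownian_motion = prob_space M for M :: "'a measure" +
  fixes F :: "real \<Rightarrow> 'a measure" and B :: "real \<Rightarrow> 'a \<Rightarrow> real"
  assumes filtration: "filtration (space M) F"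
    and subalg: "t \<ge> 0 \<Longrightarrow> subalgebra M (F t)"
    and adapted: "t \<ge> 0 \<Longrightarrow> B t \<in> borel_measurable (F t)"
    and increment_normal: "0 \<le> s \<Longrightarrow> s < t \<Longrightarrow>
      distributed M lborel (\<lambda>\<omega>. B t \<omega> - B s \<omega>) (normal_density 0 (sqrt (t - s)))"
    and increment_indep: "0 \<le> s \<Longrightarrow> s < t \<Longrightarrow>
      indep_set (sets (F s)) {(\<lambda>\<omega>. B t \<omega> - B s \<omega>) -` A \<inter> space M | A. A \<in> sets borel}"
begin

lemma measurable_M: "t \<ge> 0 \<Longrightarrow> f \<in> measurable (F t) N \<Longrightarrow> f \<in> measurable M N"
  using measurable_from_subalg[OF subalg] by blast

lemma increment_moments:
  assumes "0 \<le> s" "s < t"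
  shows "integrable M (\<lambda>\<omega>. B t \<omega> - B s \<omega>)" "expectation (\<lambda>\<omega>. B t \<omega> - B s \<omega>) = 0"
    "integrable M (\<lambda>\<omega>. (B t \<omega> - B s \<omega>)\<^sup>2)" "expectation (\<lambda>\<omega>. (B t \<omega> - B s \<omega>)\<^sup>2) = t - s"
proof -
  note D = increment_normal[OF assms]
  have pos: "0 < sqrt (t - s)" using assms by simp
  show 0: "expectation (\<lambda>\<omega>. B t \<omega> - B s \<omega>) = 0"
    using normal_distributed_expectation[OF pos D] .
  show "integrable M (\<lambda>\<omega>. B t \<omega> - B s \<omega>)"
    using distributed_integrable[OF D, of "\<lambda>x. x"] integrable_normal_moment[OF pos, of 0 1]
    by simp
  show "integrable M (\<lambda>\<omega>. (B t \<omega> - B s \<omega>)\<^sup>2)"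
    using distributed_integrable[OF D, of "\<lambda>x. x^2"] integrable_normal_moment[OF pos, of 0 2]
    by simp
  show "expectation (\<lambda>\<omega>. (B t \<omega> - B s \<omega>)\<^sup>2) = t - s"
    using normal_distributed_variance[OF pos D] 0 assms by simp
qed

lemma increment_indep_var:
  assumes "0 \<le> s" "s < t" "Y \<in> measurable (F s) N"
  shows "indep_var N Y borel (\<lambda>\<omega>. B t \<omega> - B s \<omega>)"
proof (rule indep_var_of_indep_set[OF subalg[OF assms(1)] increment_indep[OF assms(1,2)] assms(3)])
  have "B t \<in> borel_measurable M" "B s \<in> borel_measurable M"
    using adapted[THEN measurable_M[rotated]] assms by auto
  then show "(\<lambda>\<omega>. B t \<omega> - B s \<omega>) \<in> borel_measurable M" by simp
qed

definition step_sum :: "(nat \<Rightarrow> real) \<Rightarrow> (nat \<Rightarrow> 'a \<Rightarrow> real) \<Rightarrow> nat \<Rightarrow> 'a \<Rightarrow> real" where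
  "step_sum p G m \<omega> = (\<Sum>j<m. (B (p (Suc j)) \<omega> - B (p j) \<omega>) * G j \<omega>)"

text \<open>The squared L2 norm in time of the step integrand, which is the predictable bracket of
  \<open>step_sum\<close>.\<close>

definition step_energy :: "(nat \<Rightarrow> real) \<Rightarrow> (nat \<Rightarrow> 'a \<Rightarrow> real) \<Rightarrow> nat \<Rightarrow> 'a \<Rightarrow> real" where
  "step_energy p G m \<omega> = (\<Sum>j<m. (p (Suc j) - p j) * (G j \<omega>)\<^sup>2)"

context
  fixes p :: "nat \<Rightarrow> real" and G :: "nat \<Rightarrow> 'a \<Rightarrow> real" and m :: nat
  assumes p0: "0 \<le> p 0" and p: "\<And>j. j < m \<Longrightarrow> p j < p (Suc j)"
    and G: "\<And>j. j < m \<Longrightarrow> G j \<in> borel_measurable (F (p j))"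
begin

lemma step_sum_measurable: "k \<le> m \<Longrightarrow> step_sum p G k \<in> borel_measurable (F (p k))"
  unfolding step_sum_def[abs_def]
  apply (intro borel_measurable_sum borel_measurable_times borel_measurable_diff)
  subgoal for j using filtration_measurable_mono[OF filtration _ adapted] 
      partition_mono[of m p "Suc j" k, OF less_imp_le[OF p]] partition_nonneg[OF p0 p] by auto
  subgoal for j using filtration_measurable_mono[OF filtration _ adapted] 
      partition_mono[of m p j k, OF less_imp_le[OF p]] partition_nonneg[OF p0 p] by auto
  subgoal for j using filtration_measurable_mono[OF filtration _ G[of j]] 
      partition_mono[of m p j k, OF less_imp_le[OF p]] by auto
  done

text \<open>The energy through step \<open>k\<close> is already known at its left end
  \<open>p k\<close>. This predictability allows the integrand to be switched off before a threshold
  is crossed rather than after.\<close>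

lemma step_energy_measurable: "k < m \<Longrightarrow> step_energy p G (Suc k) \<in> borel_measurable (F (p k))"
  unfolding step_energy_def[abs_def]
  apply (intro borel_measurable_sum borel_measurable_times borel_measurable_power borel_measurable_const)
  subgoal for j using filtration_measurable_mono[OF filtration _ G[of j]] 
      partition_mono[of m p j k, OF less_imp_le[OF p]] by auto
  done

text \<open>Discrete Ito isometry. When the next partial sum is squared, the cross term has mean
  zero because the new increment is centred and independent of \<open>F (p k)\<close>, and the
  squared increment contributes its variance \<open>p (Suc k) - p k\<close>. The bound on
  \<open>G\<close> gives integrability of the products.\<close>

lemma step_sum_second_moment:
  assumes bd: "\<And>j \<omega>. j < m \<Longrightarrow> \<omega> \<in> space M \<Longrightarrow> \<bar>G j \<omega>\<bar> \<le> C" and "k \<le> m"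
  shows "integrable M (\<lambda>\<omega>. (step_sum p G k \<omega>)\<^sup>2)"
    "expectation (\<lambda>\<omega>. (step_sum p G k \<omega>)\<^sup>2) = expectation (step_energy p G k)"
proof -
  have "integrable M (\<lambda>\<omega>. (step_sum p G k \<omega>)\<^sup>2) \<and> integrable M (step_energy p G k) \<and>
    expectation (\<lambda>\<omega>. (step_sum p G k \<omega>)\<^sup>2) = expectation (step_energy p G k)"
    using \<open>k \<le> m\<close>
  proof (induction k)
    case 0
    then show ?case by (simp add: step_sum_def step_energy_def[abs_def])
  next
    case (Suc k)
    then have k: "k < m" and IH: "integrable M (\<lambda>\<omega>. (step_sum p G k \<omega>)\<^sup>2)"
      "integrable M (step_energy p G k)"
      "expectation (\<lambda>\<omega>. (step_sum p G k \<omega>)\<^sup>2) = expectation (step_energy p G k)" by auto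
    define D where "D = (\<lambda>\<omega>. B (p (Suc k)) \<omega> - B (p k) \<omega>)"
    define S where "S = step_sum p G k"
    have pk: "0 \<le> p k" "p k < p (Suc k)" using partition_nonneg[OF p0 p, of k] p k by auto
    have mom: "integrable M D" "expectation D = 0" "integrable M (\<lambda>\<omega>. (D \<omega>)\<^sup>2)"
      "expectation (\<lambda>\<omega>. (D \<omega>)\<^sup>2) = p (Suc k) - p k"
      using increment_moments[OF pk] by (simp_all add: D_def)
    have SF: "S \<in> borel_measurable (F (p k))" using step_sum_measurable k by (simp add: S_def)
    have GF: "G k \<in> borel_measurable (F (p k))" using G k by simp
    have SM: "S \<in> borel_measurable M" and GM: "G k \<in> borel_measurable M"
      using measurable_M[OF pk(1)] SF GF by auto
    have Sint: "integrable M S"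
      using square_integrable_imp_integrable[OF SM] IH(1) by (simp add: S_def)
    have bd': "\<bar>G k \<omega>\<bar> \<le> \<bar>C\<bar>" if "\<omega> \<in> space M" for \<omega>
      using bd[OF k that] by linarith
    have GSint: "integrable M (\<lambda>\<omega>. S \<omega> * G k \<omega>)"
    proof (rule Bochner_Integration.integrable_bound[OF integrable_mult_right[OF Sint, of C]])
      have "norm (S \<omega> * G k \<omega>) \<le> norm (C * S \<omega>)" if "\<omega> \<in> space M" for \<omega>
        using mult_left_mono[OF bd'[OF that], of "\<bar>S \<omega>\<bar>"] by (simp add: abs_mult mult.commute)
      then show "AE \<omega> in M. norm (S \<omega> * G k \<omega>) \<le> norm (C * S \<omega>)" by (rule AE_I2)
    qed (use SM GM in auto)
    have G2int: "integrable M (\<lambda>\<omega>. (G k \<omega>)\<^sup>2)"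
    proof (rule integrable_const_bound[where B="C\<^sup>2"])
      have "norm ((G k \<omega>)\<^sup>2) \<le> C\<^sup>2" if "\<omega> \<in> space M" for \<omega>
        using power_mono[OF bd'[OF that], of 2] by simp
      then show "AE \<omega> in M. norm ((G k \<omega>)\<^sup>2) \<le> C\<^sup>2" by (rule AE_I2)
    qed (use GM in auto)
    have i1: "indep_var borel (\<lambda>\<omega>. S \<omega> * G k \<omega>) borel D"
      unfolding D_def using SF GF by (intro increment_indep_var pk) auto
    have "indep_var borel (\<lambda>\<omega>. (G k \<omega>)\<^sup>2) borel D"
      unfolding D_def using GF by (intro increment_indep_var pk) auto
    from indep_var_compose[OF this, of "\<lambda>x. x" borel "\<lambda>x. x\<^sup>2" borel]
    have i2: "indep_var borel (\<lambda>\<omega>. (G k \<omega>)\<^sup>2) borel (\<lambda>\<omega>. (D \<omega>)\<^sup>2)"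
      by (auto simp: comp_def)
    note I1 = indep_var_integrable[OF i1 GSint mom(1)] indep_var_lebesgue_integral[OF i1 GSint mom(1)]
    note I2 = indep_var_integrable[OF i2 G2int mom(3)] indep_var_lebesgue_integral[OF i2 G2int mom(3)]
    have eq: "(\<lambda>\<omega>. (step_sum p G (Suc k) \<omega>)\<^sup>2) =
       (\<lambda>\<omega>. (S \<omega>)\<^sup>2 + 2 * (S \<omega> * G k \<omega> * D \<omega>) + (G k \<omega>)\<^sup>2 * (D \<omega>)\<^sup>2)"
      by (auto simp: step_sum_def S_def D_def power2_eq_square algebra_simps)
    have eq2: "step_energy p G (Suc k) = (\<lambda>\<omega>. step_energy p G k \<omega> + (p (Suc k) - p k) * (G k \<omega>)\<^sup>2)"
      by (auto simp: step_energy_def)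
    show ?case
      unfolding eq eq2 using I1 I2 IH G2int mom by (simp add: S_def)
  qed
  then show "integrable M (\<lambda>\<omega>. (step_sum p G k \<omega>)\<^sup>2)"
    "expectation (\<lambda>\<omega>. (step_sum p G k \<omega>)\<^sup>2) = expectation (step_energy p G k)" by auto
qed

end

text \<open>
  Stopping the integrand when its energy exceeds \<open>\<eta>\<close> changes the sum only on the event that the
  total energy exceeds \<open>\<eta>\<close>; it also makes the integrand bounded, so no bound on \<open>G\<close> is needed.
\<close>

lemma step_sum_Lenglart:
  fixes \<delta> \<eta> :: real
  assumes p0: "0 \<le> p 0" and p: "\<And>j. j < m \<Longrightarrow> p j < p (Suc j)"
    and G: "\<And>j. j < m \<Longrightarrow> G j \<in> borel_measurable (F (p j))" and "\<delta> > 0" "\<eta> > 0"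
  shows "prob {\<omega> \<in> space M. \<bar>step_sum p G m \<omega>\<bar> > \<delta>} \<le>
    prob {\<omega> \<in> space M. step_energy p G m \<omega> > \<eta>} + \<eta> / \<delta>\<^sup>2"
proof -
  \<comment> \<open>The test includes the current step (\<open>Suc j\<close>), so the energy of
    \<open>H\<close> never exceeds \<eta>, while \<open>H j\<close> stays measurable at time
    \<open>p j\<close>.\<close>
  define H where "H = (\<lambda>j \<omega>. if step_energy p G (Suc j) \<omega> \<le> \<eta> then G j \<omega> else 0)"
  have H: "H j \<in> borel_measurable (F (p j))" if "j < m" for j
    unfolding H_def using G[OF that] step_energy_measurable[of p m G j] p0 p G that
    by measurable
  have mono: "step_energy p G j \<omega> \<le> step_energy p G k \<omega>" if "j \<le> k" "k \<le> m" for j k \<omega>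
    unfolding step_energy_def using that p
    by (intro sum_mono2 mult_nonneg_nonneg) (auto simp: less_imp_le)
  have enH: "step_energy p H k \<omega> \<le> \<eta>" if "k \<le> m" for k \<omega>
    using that
  proof (induction k)
    case 0
    then show ?case using \<open>\<eta> > 0\<close> by (simp add: step_energy_def)
  next
    case (Suc k)
    show ?case
    proof (cases "step_energy p G (Suc k) \<omega> \<le> \<eta>")
      case True
      then have "H j \<omega> = G j \<omega>" if "j < Suc k" for j
        using order.trans[OF mono[of "Suc j" "Suc k" \<omega>]] Suc that by (auto simp: H_def)
      then have "step_energy p H (Suc k) \<omega> = step_energy p G (Suc k) \<omega>"
        by (simp add: step_energy_def)
      then show ?thesis using True by simp
    next
      case False
      then show ?thesis using Suc by (simp add: step_energy_def H_def)
    qed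
  qed
  \<comment> \<open>A lower bound for the cell lengths; the 1 keeps the set nonempty when
    \<open>m = 0\<close>. Since one term of the energy is at most \<eta>, \<open>H\<close> is
    bounded by \<open>sqrt (\<eta> / d)\<close>, as the isometry demands.\<close>
  define d where "d = Min (insert 1 ((\<lambda>j. p (Suc j) - p j) ` {..<m}))"
  have dpos: "d > 0" unfolding d_def using p by (subst Min_gr_iff) auto
  have dle: "d \<le> p (Suc j) - p j" if "j < m" for j
    unfolding d_def using that by (intro Min_le) auto
  have bd: "\<bar>H j \<omega>\<bar> \<le> sqrt (\<eta> / d)" if "j < m" for j \<omega>
  proof -
    have "d * (H j \<omega>)\<^sup>2 \<le> (p (Suc j) - p j) * (H j \<omega>)\<^sup>2" using dle[OF that] by (intro mult_right_mono) auto
    also have "\<dots> \<le> step_energy p H (Suc j) \<omega>"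
      unfolding step_energy_def using p that 
      by (auto intro!: sum_nonneg mult_nonneg_nonneg simp: less_imp_le)
    also have "\<dots> \<le> \<eta>" using enH[of "Suc j"] that by simp
    finally have "(H j \<omega>)\<^sup>2 \<le> \<eta> / d" using dpos by (simp add: field_simps)
    then show ?thesis using real_le_rsqrt[of "\<bar>H j \<omega>\<bar>" "\<eta>/d"] by simp
  qed
  note sm = step_sum_second_moment[of p m H, OF p0 p H bd order.refl]
  have meas: "step_sum p H m \<in> borel_measurable M" "step_sum p G m \<in> borel_measurable M"
    using step_sum_measurable[OF p0 p H order.refl, of m] step_sum_measurable[OF p0 p G order.refl, of m]
      measurable_M partition_nonneg[OF p0 p order.refl] by auto
  have meas2: "step_energy p G m \<in> borel_measurable M"
    unfolding step_energy_def[abs_def]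
    using measurable_M[OF partition_nonneg[OF p0 p] G] by (auto intro!: borel_measurable_sum borel_measurable_times)
  have [measurable]: "(\<lambda>\<omega>. step_sum p H m \<omega>) \<in> borel_measurable M" "(\<lambda>\<omega>. step_energy p G m \<omega>) \<in> borel_measurable M"
    using meas meas2 by simp_all
  have events: "{\<omega> \<in> space M. step_energy p G m \<omega> > \<eta>} \<in> events" "{\<omega> \<in> space M. \<delta>\<^sup>2 \<le> (step_sum p H m \<omega>)\<^sup>2} \<in> events"
    by measurable
  have "expectation (step_energy p H m) \<le> \<eta>"
  \<comment> \<open>In the other case the Bochner integral is 0 by convention, so the bound holds as
    well.\<close>
  proof (cases "integrable M (step_energy p H m)")
    case True
    then show ?thesis using enH[OF order.refl] by (intro integral_le_const) auto
  qed (use \<open>\<eta> > 0\<close> in \<open>simp add: not_integrable_integral_eq\<close>)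
  then have E: "expectation (\<lambda>\<omega>. (step_sum p H m \<omega>)\<^sup>2) \<le> \<eta>" using sm(2) by simp
  have "prob {\<omega> \<in> space M. \<delta>\<^sup>2 \<le> (step_sum p H m \<omega>)\<^sup>2} \<le> expectation (\<lambda>\<omega>. (step_sum p H m \<omega>)\<^sup>2) / \<delta>\<^sup>2"
    using sm(1) \<open>\<delta> > 0\<close> by (intro integral_Markov_inequality_measure[where A="{}"]) auto
  also have "\<dots> \<le> \<eta> / \<delta>\<^sup>2" using E by (intro divide_right_mono) auto
  finally have M: "prob {\<omega> \<in> space M. \<delta>\<^sup>2 \<le> (step_sum p H m \<omega>)\<^sup>2} \<le> \<eta> / \<delta>\<^sup>2" .
  have "prob {\<omega> \<in> space M. \<bar>step_sum p G m \<omega>\<bar> > \<delta>} \<le>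
    prob ({\<omega> \<in> space M. step_energy p G m \<omega> > \<eta>} \<union> {\<omega> \<in> space M. \<delta>\<^sup>2 \<le> (step_sum p H m \<omega>)\<^sup>2})"
  proof (intro finite_measure_mono subsetI)
    fix \<omega> assume w: "\<omega> \<in> {\<omega> \<in> space M. \<delta> < \<bar>step_sum p G m \<omega>\<bar>}"
    show "\<omega> \<in> {\<omega> \<in> space M. step_energy p G m \<omega> > \<eta>} \<union> {\<omega> \<in> space M. \<delta>\<^sup>2 \<le> (step_sum p H m \<omega>)\<^sup>2}"
    proof (cases "step_energy p G m \<omega> > \<eta>")
      case False
      then have "step_sum p H m \<omega> = step_sum p G m \<omega>"
        unfolding step_sum_def H_def using order.trans[OF mono[of _ m]] by (intro sum.cong) auto
      moreover have "\<delta>\<^sup>2 \<le> \<bar>step_sum p G m \<omega>\<bar>\<^sup>2" using w \<open>\<delta> > 0\<close> by (intro power_mono) auto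
      ultimately show ?thesis using w by auto
    qed (use w in auto)
  qed (use events in simp)
  also have "\<dots> \<le> prob {\<omega> \<in> space M. step_energy p G m \<omega> > \<eta>} + prob {\<omega> \<in> space M. \<delta>\<^sup>2 \<le> (step_sum p H m \<omega>)\<^sup>2}"
    using events by (intro measure_Un_le)
  finally show ?thesis using M by simp
qed

end

section \<open>Common refinements of simple processes\<close>

lemma finite_set_partition:
  fixes P :: "real set"
  assumes "finite P" "0 \<in> P" "T \<in> P" "P \<subseteq> {0..T}"
  obtains p m where "p 0 = 0" "p m = T" "\<And>j. j < m \<Longrightarrow> p j < p (Suc j)" "p ` {..m} = P"
proof -
  define xs where "xs = sorted_list_of_set P"
  have set: "set xs = P" and srt: "sorted_wrt (<) xs" using assms by (auto simp: xs_def)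
  have ne: "xs \<noteq> []" using set assms by auto
  define m where "m = length xs - 1"
  have len: "length xs = Suc m" using ne by (simp add: m_def)
  have step: "xs ! j < xs ! k" if "j < k" "k \<le> m" for j k
    using sorted_wrt_nth_less[OF srt that(1)] that(2) len by simp
  have img: "(!) xs ` {..m} = P"
    using set len by (auto simp: set_conv_nth less_Suc_eq_le)
  then obtain i k where i: "i \<le> m" "xs ! i = 0" and k: "k \<le> m" "xs ! k = T"
    using assms by (metis (no_types, lifting) atMost_iff imageE)
  have "xs ! 0 \<in> P" "xs ! m \<in> P" using set len by auto
  then have "0 \<le> xs ! 0" "xs ! m \<le> T" using assms by auto
  then have "i = 0" "k = m" using step[of 0 i] step[of k m] i k by (auto intro: ccontr)
  then show ?thesis using that[of "(!) xs" m] i k step[of _ "Suc _"] img by auto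
qed

lemma sum_telescope_indicator:
  fixes f :: "nat \<Rightarrow> real"
  assumes "k \<le> l" "l \<le> m"
  shows "(\<Sum>j<m. (f (Suc j) - f j) * of_bool (k \<le> j \<and> j < l)) = f l - f k"
proof -
  have "(\<Sum>j<m. (f (Suc j) - f j) * of_bool (k \<le> j \<and> j < l)) = (\<Sum>j\<in>{k..<l}. f (Suc j) - f j)"
    using assms by (intro sum.mono_neutral_cong_right) auto
  also have "\<dots> = f l - f k" using assms(1) by (rule sum_Suc_diff')
  finally show ?thesis .
qed

lemma nn_integral_step:
  fixes f :: "real \<Rightarrow> real"
  assumes p: "\<And>j. j < m \<Longrightarrow> p j < p (Suc j)"
    and f: "\<And>j s. j < m \<Longrightarrow> s \<in> {p j<..p (Suc j)} \<Longrightarrow> f s = g j"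
  shows "(\<integral>\<^sup>+ s\<in>{p 0..p m}. ennreal ((f s)\<^sup>2) \<partial>lborel) = ennreal (\<Sum>j<m. (p (Suc j) - p j) * (g j)\<^sup>2)"
proof -
  have "ennreal ((f s)\<^sup>2) * indicator {p 0<..p k} s = (\<Sum>j<k. ennreal ((g j)\<^sup>2) * indicator {p j<..p (Suc j)} s)"
    if "k \<le> m" for k s
    using that
  proof (induction k)
    case (Suc k)
    then have "k \<le> m" by simp
    then have "p 0 \<le> p k" using partition_mono[of m p 0 k] p by (auto simp: less_imp_le)
    then have "ennreal ((f s)\<^sup>2) * indicator {p 0<..p (Suc k)} s =
      ennreal ((f s)\<^sup>2) * indicator {p 0<..p k} s + ennreal ((f s)\<^sup>2) * indicator {p k<..p (Suc k)} s"
      using p[of k] Suc.prems by (auto simp: indicator_def)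
    also have "ennreal ((f s)\<^sup>2) * indicator {p k<..p (Suc k)} s = ennreal ((g k)\<^sup>2) * indicator {p k<..p (Suc k)} s"
      using f[of k s] Suc.prems by (auto simp: indicator_def)
    finally show ?case using Suc by simp
  qed simp
  note * = this[OF order.refl]
  \<comment> \<open>The left-open cells miss the point \<open>p 0\<close>, a null set.\<close>
  have "(\<integral>\<^sup>+ s\<in>{p 0..p m}. ennreal ((f s)\<^sup>2) \<partial>lborel) = (\<integral>\<^sup>+ s. ennreal ((f s)\<^sup>2) * indicator {p 0<..p m} s \<partial>lborel)"
    by (rule nn_integral_cong_AE, rule AE_mp[OF AE_lborel_singleton[of "p 0"]]) (auto simp: indicator_def)
  also have "\<dots> = (\<Sum>j<m. ennreal ((g j)\<^sup>2) * ennreal (p (Suc j) - p j))"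
    unfolding * using p by (subst nn_integral_sum) (auto simp: nn_integral_cmult less_imp_le intro!: sum.cong)
  also have "\<dots> = (\<Sum>j<m. ennreal ((p (Suc j) - p j) * (g j)\<^sup>2))"
    using p by (intro sum.cong) (auto simp: ennreal_mult'' mult.commute)
  also have "\<dots> = ennreal (\<Sum>j<m. (p (Suc j) - p j) * (g j)\<^sup>2)"
    using p by (intro sum_ennreal) (auto simp: less_imp_le)
  finally show ?thesis .
qed

context filtered_brownian_motion
begin

text \<open>The coefficients may be unbounded, because the Riemann sums for the area use Brownian
  values as coefficients.\<close>

definition adapted_step :: "('a, real) simple_data \<Rightarrow> bool" where
  "adapted_step = (\<lambda>(n, \<tau>, \<xi>). 0 \<le> \<tau> 0 \<and> (\<forall>i<n. \<tau> i \<le> \<tau> (Suc i)) \<and>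
     (\<forall>i<n. \<xi> i \<in> borel_measurable (F (\<tau> i))))"

lemma adapted_step_nonneg:
  assumes "adapted_step (n, \<tau>, \<xi>)" "i \<le> n"
  shows "0 \<le> \<tau> i"
  using partition_mono[of n \<tau> 0 i] assms by (fastforce simp: adapted_step_def)

lemma simple_integral_measurable:
  assumes "adapted_step S" "T \<ge> 0"
  shows "simple_integral B S T \<in> borel_measurable M"
proof -
  obtain n \<tau> \<xi> where S: "S = (n, \<tau>, \<xi>)" by (cases S) auto
  have "B (min (\<tau> i) T) \<in> borel_measurable M" if "i \<le> n" for i
    using adapted_step_nonneg[OF assms(1)[unfolded S] that] assms(2) measurable_M[OF _ adapted] by simp
  moreover have "\<xi> i \<in> borel_measurable M" if "i < n" for i
    using adapted_step_nonneg[OF assms(1)[unfolded S], of i] that assms(1) measurable_M[of "\<tau> i"]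
    by (auto simp: adapted_step_def S)
  ultimately show ?thesis
    unfolding simple_integral_def S prod.case real_scaleR_def
    by (intro borel_measurable_sum borel_measurable_times borel_measurable_diff) auto
qed

context
  fixes n :: nat and \<tau> :: "nat \<Rightarrow> real" and \<xi> :: "nat \<Rightarrow> 'a \<Rightarrow> real"
    and p :: "nat \<Rightarrow> real" and m :: nat and T :: real
  assumes S: "adapted_step (n, \<tau>, \<xi>)"
    and p: "\<And>j. j < m \<Longrightarrow> p j < p (Suc j)" and p0: "p 0 = 0" and pm: "p m = T"
    and ref: "\<And>i. i \<le> n \<Longrightarrow> min (\<tau> i) T \<in> p ` {..m}"
begin

lemma refinement_less_iff: "j \<le> m \<Longrightarrow> k \<le> m \<Longrightarrow> p j < p k \<longleftrightarrow> j < k"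
proof -
  have *: "p j < p k" if "j < k" "k \<le> m" for j k
    using partition_mono[of m p "Suc j" k, OF less_imp_le[OF p]] p[of j] that by simp
  assume "j \<le> m" "k \<le> m"
  then show ?thesis using *[of j k] *[of k j] by (cases j k rule: linorder_cases) auto
qed

text \<open>Every breakpoint truncated at \<open>T\<close> is a point of \<open>p\<close>, so none
  can lie strictly inside a cell.\<close>

lemma refinement_cut: "i \<le> n \<Longrightarrow> j < m \<Longrightarrow> \<tau> i < p (Suc j) \<Longrightarrow> \<tau> i \<le> p j"
proof -
  assume a: "i \<le> n" "j < m" "\<tau> i < p (Suc j)"
  obtain k where k: "k \<le> m" "min (\<tau> i) T = p k" using ref[OF a(1)] by auto
  have "p (Suc j) \<le> T" using partition_mono[of m p "Suc j" m, OF less_imp_le[OF p]] a pm by simp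
  then have "\<tau> i = p k" using a k by (simp add: min_def split: if_splits)
  then show ?thesis using a k refinement_less_iff[of k "Suc j"] partition_mono[of m p k j, OF less_imp_le[OF p]] by simp
qed

text \<open>The process is left-open and right-closed, so its value on the cell is sampled at the
  right end \<open>p (Suc j)\<close>; the coefficient active there was nevertheless fixed at a
  breakpoint no later than \<open>p j\<close>, which yields measurability at the left end.\<close>

lemma refinement_value_measurable:
  assumes "j < m"
  shows "simple_process (n, \<tau>, \<xi>) (p (Suc j)) \<in> borel_measurable (F (p j))"
  unfolding simple_process_def prod.case
proof (intro borel_measurable_sum)
  fix i assume i: "i \<in> {..<n}"
  show "(\<lambda>\<omega>. indicat_real {\<tau> i<..\<tau> (Suc i)} (p (Suc j)) *\<^sub>R \<xi> i \<omega>) \<in> borel_measurable (F (p j))"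
  proof (cases "\<tau> i < p (Suc j)")
    case True
    then have "\<tau> i \<le> p j" using refinement_cut i assms by simp
    then have "\<xi> i \<in> borel_measurable (F (p j))"
      using S i filtration_measurable_mono[OF filtration, of "\<tau> i" "p j" "\<xi> i"] by (auto simp: adapted_step_def)
    then show ?thesis by simp
  qed (simp add: indicator_def)
qed

lemma refinement_value:
  assumes "j < m" "s \<in> {p j<..p (Suc j)}"
  shows "simple_process (n, \<tau>, \<xi>) s \<omega> = simple_process (n, \<tau>, \<xi>) (p (Suc j)) \<omega>"
proof -
  have *: "\<tau> i < s \<longleftrightarrow> \<tau> i < p (Suc j)" if "i \<le> n" for i
    using refinement_cut[OF that assms(1)] assms(2) by auto
  have "indicat_real {\<tau> i<..\<tau> (Suc i)} s = indicat_real {\<tau> i<..\<tau> (Suc i)} (p (Suc j))" if "i < n" for i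
    using *[of i] *[of "Suc i"] that by (auto simp: indicator_def not_less[symmetric])
  then show ?thesis unfolding simple_process_def prod.case by (intro sum.cong) auto
qed

lemma refinement_integral:
  "simple_integral B (n, \<tau>, \<xi>) T \<omega> = step_sum p (\<lambda>j. simple_process (n, \<tau>, \<xi>) (p (Suc j))) m \<omega>"
proof -
  \<comment> \<open>Each truncated interval is a block of consecutive cells, so its increment
    telescopes over the cells from \<open>k\<close> to \<open>l\<close>.\<close>
  have *: "B (min (\<tau> (Suc i)) T) \<omega> - B (min (\<tau> i) T) \<omega> =
     (\<Sum>j<m. (B (p (Suc j)) \<omega> - B (p j) \<omega>) * indicat_real {\<tau> i<..\<tau> (Suc i)} (p (Suc j)))"
    if i: "i < n" for i
  proof -
    obtain k where k: "k \<le> m" "min (\<tau> i) T = p k" using ref[of i] i by auto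
    obtain l where l: "l \<le> m" "min (\<tau> (Suc i)) T = p l" using ref[of "Suc i"] i by auto
    have "\<tau> i \<le> \<tau> (Suc i)" using S i by (auto simp: adapted_step_def)
    then have "p k \<le> p l" using k l by (simp add: min_def split: if_splits)
    then have kl: "k \<le> l" using refinement_less_iff[of l k] k l by (simp add: not_less[symmetric])
    have pT: "p (Suc j) \<le> T" if "j < m" for j
      using partition_mono[of m p "Suc j" m, OF less_imp_le[OF p]] that pm by simp
    have 1: "\<tau> i < p (Suc j) \<longleftrightarrow> k \<le> j" if "j < m" for j
    proof -
      have "\<tau> i < p (Suc j) \<longleftrightarrow> p k < p (Suc j)"
        using pT[OF that] k(2) by (auto simp: min_def split: if_splits)
      then show ?thesis using refinement_less_iff[of k "Suc j"] k that by (simp add: less_Suc_eq_le)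
    qed
    have 2: "\<tau> (Suc i) < p (Suc j) \<longleftrightarrow> l \<le> j" if "j < m" for j
    proof -
      have "\<tau> (Suc i) < p (Suc j) \<longleftrightarrow> p l < p (Suc j)"
        using pT[OF that] l(2) by (auto simp: min_def split: if_splits)
      then show ?thesis using refinement_less_iff[of l "Suc j"] l that by (simp add: less_Suc_eq_le)
    qed
    have "(\<Sum>j<m. (B (p (Suc j)) \<omega> - B (p j) \<omega>) * indicat_real {\<tau> i<..\<tau> (Suc i)} (p (Suc j))) =
      (\<Sum>j<m. (B (p (Suc j)) \<omega> - B (p j) \<omega>) * of_bool (k \<le> j \<and> j < l))"
      using 1 2 by (intro sum.cong refl arg_cong2[where f="(*)"]) (auto simp: indicator_def not_less[symmetric])
    also have "\<dots> = B (p l) \<omega> - B (p k) \<omega>"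
      by (rule sum_telescope_indicator[OF kl l(1), of "\<lambda>j. B (p j) \<omega>"])
    finally show ?thesis using k l by simp
  qed
  have "simple_integral B (n, \<tau>, \<xi>) T \<omega> = (\<Sum>i<n. (\<Sum>j<m. (B (p (Suc j)) \<omega> - B (p j) \<omega>) * indicat_real {\<tau> i<..\<tau> (Suc i)} (p (Suc j))) * \<xi> i \<omega>)"
    unfolding simple_integral_def prod.case using * by (intro sum.cong) auto
  also have "\<dots> = (\<Sum>j<m. \<Sum>i<n. (B (p (Suc j)) \<omega> - B (p j) \<omega>) * (indicat_real {\<tau> i<..\<tau> (Suc i)} (p (Suc j)) * \<xi> i \<omega>))"
    by (simp only: sum_distrib_right mult.assoc) (rule sum.swap)
  also have "\<dots> = step_sum p (\<lambda>j. simple_process (n, \<tau>, \<xi>) (p (Suc j))) m \<omega>"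
    by (simp only: step_sum_def simple_process_def sum_distrib_left prod.case real_scaleR_def)
  finally show ?thesis .
qed

end

text \<open>On a partition that contains all truncated breakpoints of both processes, the difference
  of the integrals is one \<open>step_sum\<close> and the L2 distance is its
  \<open>step_energy\<close>; the discrete inequality then applies. Sorting the breakpoints as a set
  removes the degenerate intervals that are permitted in \<open>simple_integrand\<close>.\<close>

lemma simple_integral_diff_Lenglart:
  fixes \<delta> \<eta> :: real
  assumes S: "adapted_step S" and S': "adapted_step S'" and T: "T > 0" and "\<delta> > 0" "\<eta> > 0"
  defines "E \<equiv> \<lambda>\<omega>. \<integral>\<^sup>+ s\<in>{0..T}. ennreal ((simple_process S s \<omega> - simple_process S' s \<omega>)\<^sup>2) \<partial>lborel"
  shows "E \<in> borel_measurable M"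
    "prob {\<omega> \<in> space M. \<bar>simple_integral B S T \<omega> - simple_integral B S' T \<omega>\<bar> > \<delta>} \<le>
     prob {\<omega> \<in> space M. E \<omega> > ennreal \<eta>} + \<eta> / \<delta>\<^sup>2"
proof -
  obtain n \<tau> \<xi> n' \<tau>' \<xi>' where eq: "S = (n, \<tau>, \<xi>)" "S' = (n', \<tau>', \<xi>')" by (cases S; cases S') auto
  note S = S[unfolded eq] and S' = S'[unfolded eq]
  define P where "P = {0, T} \<union> (\<lambda>i. min (\<tau> i) T) ` {..n} \<union> (\<lambda>i. min (\<tau>' i) T) ` {..n'}"
  have "P \<subseteq> {0..T}" using T adapted_step_nonneg[OF S] adapted_step_nonneg[OF S'] by (auto simp: P_def)
  then obtain p m where p: "p 0 = 0" "p m = T" "\<And>j. j < m \<Longrightarrow> p j < p (Suc j)" "p ` {..m} = P"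
    using finite_set_partition[of P T] by (auto simp: P_def)
  have r: "\<And>i. i \<le> n \<Longrightarrow> min (\<tau> i) T \<in> p ` {..m}" "\<And>i. i \<le> n' \<Longrightarrow> min (\<tau>' i) T \<in> p ` {..m}"
    unfolding p(4) by (auto simp: P_def)
  define G where "G = (\<lambda>j \<omega>. simple_process S (p (Suc j)) \<omega> - simple_process S' (p (Suc j)) \<omega>)"
  have G: "G j \<in> borel_measurable (F (p j))" if "j < m" for j
    unfolding G_def eq
    using refinement_value_measurable[OF S p(3,1,2) r(1) that] refinement_value_measurable[OF S' p(3,1,2) r(2) that]
    by simp
  have I: "simple_integral B S T \<omega> - simple_integral B S' T \<omega> = step_sum p G m \<omega>" for \<omega>
  proof -
    have "simple_integral B S T \<omega> = step_sum p (\<lambda>j. simple_process S (p (Suc j))) m \<omega>"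
      unfolding eq by (rule refinement_integral[OF S p(3,1,2) r(1)])
    moreover have "simple_integral B S' T \<omega> = step_sum p (\<lambda>j. simple_process S' (p (Suc j))) m \<omega>"
      unfolding eq by (rule refinement_integral[OF S' p(3,1,2) r(2)])
    ultimately show ?thesis
      unfolding step_sum_def G_def right_diff_distrib sum_subtractf by simp
  qed
  have E: "E \<omega> = ennreal (step_energy p G m \<omega>)" for \<omega>
  proof -
    have "E \<omega> = (\<integral>\<^sup>+ s\<in>{p 0..p m}. ennreal ((simple_process S s \<omega> - simple_process S' s \<omega>)\<^sup>2) \<partial>lborel)"
      by (simp add: E_def p(1,2))
    also have "\<dots> = ennreal (\<Sum>j<m. (p (Suc j) - p j) * (G j \<omega>)\<^sup>2)"
  proof (rule nn_integral_step)
    show "p j < p (Suc j)" if "j < m" for j using p(3) that by simp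
  next
    fix j s assume j: "j < m" "s \<in> {p j<..p (Suc j)}"
    have "simple_process S s \<omega> = simple_process S (p (Suc j)) \<omega>"
      unfolding eq by (rule refinement_value[OF S p(3,1,2) r(1) j])
    moreover have "simple_process S' s \<omega> = simple_process S' (p (Suc j)) \<omega>"
      unfolding eq by (rule refinement_value[OF S' p(3,1,2) r(2) j])
    ultimately show "simple_process S s \<omega> - simple_process S' s \<omega> = G j \<omega>"
      by (simp add: G_def)
    qed
    finally show ?thesis by (simp add: step_energy_def)
  qed
  have "step_energy p G m \<in> borel_measurable M"
    unfolding step_energy_def[abs_def]
    using measurable_M[OF partition_nonneg[of p m] G] p
    by (auto intro!: borel_measurable_sum borel_measurable_times)
  then show "E \<in> borel_measurable M" using E by (simp add: E[abs_def])
  show "prob {\<omega> \<in> space M. \<bar>simple_integral B S T \<omega> - simple_integral B S' T \<omega>\<bar> > \<delta>} \<le>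
     prob {\<omega> \<in> space M. E \<omega> > ennreal \<eta>} + \<eta> / \<delta>\<^sup>2"
    using step_sum_Lenglart[of p m G \<delta> \<eta>] p G \<open>\<delta> > 0\<close> \<open>\<eta> > 0\<close> by (simp add: I E ennreal_less_iff)
qed

end

section \<open>Convergence in probability and independence of the approximating sequence\<close>

lemma tendsto_zero_sandwich:
  fixes f g :: "nat \<Rightarrow> real"
  assumes "\<And>n. 0 \<le> f n" "\<And>n. f n \<le> g n" "g \<longlonglongrightarrow> 0"
  shows "f \<longlonglongrightarrow> 0"
  using assms by (intro tendsto_sandwich[of "\<lambda>_. 0" f sequentially g 0] always_eventually allI) simp_all

lemma ito_measurable_aux:
  fixes g :: "real \<Rightarrow> 'a \<Rightarrow> real"
  assumes "(\<lambda>(s, \<omega>). g s \<omega>) \<in> borel_measurable (restrict_space borel {0..T} \<Otimes>\<^sub>M M)"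
  shows "(\<lambda>\<omega>. \<integral>\<^sup>+ s\<in>{0..T}. ennreal ((g s \<omega>)\<^sup>2) \<partial>lborel) \<in> borel_measurable M"
proof -
  let ?R = "restrict_space lborel {0..T}"
  interpret R: sigma_finite_measure ?R
    by (rule sigma_finite_measure_restrict_space[OF sigma_finite_lborel]) auto
  have sets: "sets (restrict_space borel {0..T} \<Otimes>\<^sub>M M) = sets (?R \<Otimes>\<^sub>M M)"
    by (intro sets_pair_measure_cong sets_restrict_space_cong) auto
  have "(\<lambda>x. ennreal ((case x of (s, \<omega>) \<Rightarrow> g s \<omega>)\<^sup>2)) \<in> borel_measurable (?R \<Otimes>\<^sub>M M)"
    using assms unfolding measurable_cong_sets[OF sets refl] by measurable
  then have "(\<lambda>(\<omega>, s). ennreal ((g s \<omega>)\<^sup>2)) \<in> borel_measurable (M \<Otimes>\<^sub>M ?R)"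
    using measurable_pair_swap_iff[of "\<lambda>x. ennreal ((case x of (s, \<omega>) \<Rightarrow> g s \<omega>)\<^sup>2)" ?R M borel]
    by (auto simp: case_prod_unfold)
  then have "(\<lambda>\<omega>. \<integral>\<^sup>+ s. ennreal ((g s \<omega>)\<^sup>2) \<partial>?R) \<in> borel_measurable M"
    by (rule R.borel_measurable_nn_integral)
  then show ?thesis
    by (subst (asm) nn_integral_restrict_space) auto
qed

context prob_space
begin

definition conv_prob :: "(nat \<Rightarrow> 'a \<Rightarrow> real) \<Rightarrow> ('a \<Rightarrow> real) \<Rightarrow> bool" where
  "conv_prob U V \<longleftrightarrow> (\<forall>n. U n \<in> borel_measurable M) \<and> V \<in> borel_measurable M \<and>
     (\<forall>\<delta>>0. (\<lambda>n. prob {\<omega> \<in> space M. \<bar>U n \<omega> - V \<omega>\<bar> > \<delta>}) \<longlonglongrightarrow> 0)"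

lemma conv_probD:
  "conv_prob U V \<Longrightarrow> \<delta> > 0 \<Longrightarrow> (\<lambda>n. prob {\<omega> \<in> space M. \<bar>U n \<omega> - V \<omega>\<bar> > \<delta>}) \<longlonglongrightarrow> 0"
  by (simp add: conv_prob_def)

lemma conv_prob_cong_AE:
  assumes "conv_prob U V" "\<And>n. AE \<omega> in M. U n \<omega> = U' n \<omega>" "AE \<omega> in M. V \<omega> = V' \<omega>"
    "\<And>n. U' n \<in> borel_measurable M" "V' \<in> borel_measurable M"
  shows "conv_prob U' V'"
proof -
  have [measurable]: "U n \<in> borel_measurable M" "U' n \<in> borel_measurable M" "V \<in> borel_measurable M" "V' \<in> borel_measurable M" for n
    using assms(1,4,5) by (auto simp: conv_prob_def)
  have "prob {\<omega> \<in> space M. \<bar>U' n \<omega> - V' \<omega>\<bar> > \<delta>} = prob {\<omega> \<in> space M. \<bar>U n \<omega> - V \<omega>\<bar> > \<delta>}" for n \<delta>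
  proof (rule finite_measure_eq_AE)
    show "AE \<omega> in M. (\<omega> \<in> {\<omega> \<in> space M. \<bar>U' n \<omega> - V' \<omega>\<bar> > \<delta>}) = (\<omega> \<in> {\<omega> \<in> space M. \<bar>U n \<omega> - V \<omega>\<bar> > \<delta>})"
      using assms(2)[of n] assms(3) by eventually_elim auto
  qed measurable
  then show ?thesis using assms(1,4,5) unfolding conv_prob_def by simp
qed

lemma conv_prob_add:
  assumes "conv_prob U V" "conv_prob U' V'"
  shows "conv_prob (\<lambda>n \<omega>. U n \<omega> + U' n \<omega>) (\<lambda>\<omega>. V \<omega> + V' \<omega>)"
  unfolding conv_prob_def
proof (intro conjI allI impI)
  have m[measurable]: "U n \<in> borel_measurable M" "U' n \<in> borel_measurable M" "V \<in> borel_measurable M" "V' \<in> borel_measurable M" for n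
    using assms by (auto simp: conv_prob_def)
  show "(\<lambda>\<omega>. U n \<omega> + U' n \<omega>) \<in> borel_measurable M" "(\<lambda>\<omega>. V \<omega> + V' \<omega>) \<in> borel_measurable M" for n
    by measurable
  fix \<delta> :: real assume "\<delta> > 0"
  let ?A = "\<lambda>n. {\<omega> \<in> space M. \<bar>U n \<omega> - V \<omega>\<bar> > \<delta> / 2}" and ?B = "\<lambda>n. {\<omega> \<in> space M. \<bar>U' n \<omega> - V' \<omega>\<bar> > \<delta> / 2}"
  have le: "prob {\<omega> \<in> space M. \<bar>U n \<omega> + U' n \<omega> - (V \<omega> + V' \<omega>)\<bar> > \<delta>} \<le> prob (?A n) + prob (?B n)" for n
  proof -
    have "prob {\<omega> \<in> space M. \<bar>U n \<omega> + U' n \<omega> - (V \<omega> + V' \<omega>)\<bar> > \<delta>} \<le> prob (?A n \<union> ?B n)"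
    proof (intro finite_measure_mono subsetI)
      fix \<omega> assume w: "\<omega> \<in> {\<omega> \<in> space M. \<bar>U n \<omega> + U' n \<omega> - (V \<omega> + V' \<omega>)\<bar> > \<delta>}"
      then have "\<bar>U n \<omega> - V \<omega>\<bar> > \<delta> / 2 \<or> \<bar>U' n \<omega> - V' \<omega>\<bar> > \<delta> / 2"
        unfolding mem_Collect_eq by linarith
      then show "\<omega> \<in> ?A n \<union> ?B n" using w by blast
    qed measurable
    also have "\<dots> \<le> prob (?A n) + prob (?B n)" by (intro measure_Un_le) measurable
    finally show ?thesis .
  qed
  have "(\<lambda>n. prob (?A n) + prob (?B n)) \<longlonglongrightarrow> 0 + 0"
    using \<open>\<delta> > 0\<close> by (intro tendsto_add conv_probD assms) auto
  then show "(\<lambda>n. prob {\<omega> \<in> space M. \<bar>U n \<omega> + U' n \<omega> - (V \<omega> + V' \<omega>)\<bar> > \<delta>}) \<longlonglongrightarrow> 0"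
    using tendsto_zero_sandwich[OF measure_nonneg le] by simp
qed

lemma conv_prob_const: "V \<in> borel_measurable M \<Longrightarrow> conv_prob (\<lambda>n. V) V"
  by (simp add: conv_prob_def)

lemma conv_prob_unique_const:
  assumes "conv_prob (\<lambda>n. U) V"
  shows "AE \<omega> in M. U \<omega> = V \<omega>"
proof -
  have [measurable]: "U \<in> borel_measurable M" "V \<in> borel_measurable M" 
    using assms by (auto simp: conv_prob_def)
  have *: "prob {\<omega> \<in> space M. \<bar>U \<omega> - V \<omega>\<bar> > \<delta>} = 0" if "\<delta> > 0" for \<delta>
    using assms that by (auto simp: conv_prob_def LIMSEQ_const_iff)
  then have "AE \<omega> in M. \<not> \<bar>U \<omega> - V \<omega>\<bar> > 1 / Suc n" for n
    using *[of "1 / Suc n"] by (subst (asm) prob_eq_0) auto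
  then have "AE \<omega> in M. \<forall>n. \<not> \<bar>U \<omega> - V \<omega>\<bar> > 1 / Suc n" by (simp add: AE_all_countable)
  then show ?thesis
  proof eventually_elim
    case (elim \<omega>)
    show ?case
    proof (rule ccontr)
      assume "U \<omega> \<noteq> V \<omega>"
      then obtain n where "1 / Suc n < \<bar>U \<omega> - V \<omega>\<bar>" using reals_Archimedean[of "\<bar>U \<omega> - V \<omega>\<bar>"] by (auto simp: inverse_eq_divide)
      then show False using elim by auto
    qed
  qed
qed

lemma AE_tendsto_zero_imp_prob:
  fixes D :: "nat \<Rightarrow> 'a \<Rightarrow> ennreal"
  assumes [measurable]: "\<And>n. D n \<in> borel_measurable M" and ae: "AE \<omega> in M. (\<lambda>n. D n \<omega>) \<longlonglongrightarrow> 0" and "\<delta> > 0"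
  shows "(\<lambda>n. prob {\<omega> \<in> space M. D n \<omega> > ennreal \<delta>}) \<longlonglongrightarrow> 0"
proof -
  have "(\<lambda>n. expectation (indicator {\<omega> \<in> space M. D n \<omega> > ennreal \<delta>} :: 'a \<Rightarrow> real)) \<longlonglongrightarrow> expectation (\<lambda>_. 0)"
  proof (rule integral_dominated_convergence[where w="\<lambda>_. 1"])
    show "AE \<omega> in M. (\<lambda>n. indicator {\<omega> \<in> space M. D n \<omega> > ennreal \<delta>} \<omega> :: real) \<longlonglongrightarrow> 0"
      using ae
    proof eventually_elim
      case (elim \<omega>)
      have "eventually (\<lambda>n. D n \<omega> < ennreal \<delta>) sequentially"
        using order_tendstoD(2)[OF elim, of "ennreal \<delta>"] \<open>\<delta> > 0\<close> by (simp add: ennreal_less_zero_iff)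
      then show ?case
        by (intro tendsto_eventually) (auto elim!: eventually_mono simp: indicator_def)
    qed
  qed (auto simp: indicator_def)
  then show ?thesis by simp
qed

text \<open>The map \<open>iexp\<close> is 1-Lipschitz with values of modulus 1: where
  \<open>U n\<close> and \<open>V\<close> differ by at most \<open>e / 4\<close> the error is at
  most \<open>e / 4\<close>, and the exceptional event costs at most twice its probability.\<close>

lemma conv_prob_char:
  assumes "conv_prob U V"
  shows "(\<lambda>n. expectation (\<lambda>\<omega>. iexp (U n \<omega>))) \<longlonglongrightarrow> expectation (\<lambda>\<omega>. iexp (V \<omega>))"
proof (rule LIMSEQ_I)
  fix e :: real assume "e > 0"
  have m[measurable]: "U n \<in> borel_measurable M" "V \<in> borel_measurable M" for n
    using assms by (auto simp: conv_prob_def)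
  have int: "integrable M (\<lambda>\<omega>. iexp (U n \<omega>))" "integrable M (\<lambda>\<omega>. iexp (V \<omega>))" for n
    by (rule integrable_const_bound[where B=1]; simp)+
  let ?A = "\<lambda>n. {\<omega> \<in> space M. \<bar>U n \<omega> - V \<omega>\<bar> > e / 4}"
  have "(\<lambda>n. prob (?A n)) \<longlonglongrightarrow> 0" using \<open>e > 0\<close> by (intro conv_probD[OF assms]) simp
  then have "eventually (\<lambda>n. prob (?A n) < e / 8) sequentially"
    using \<open>e > 0\<close> by (intro order_tendstoD) auto
  then obtain N where N: "\<And>n. n \<ge> N \<Longrightarrow> prob (?A n) < e / 8" by (auto simp: eventually_sequentially)
  have "norm (expectation (\<lambda>\<omega>. iexp (U n \<omega>)) - expectation (\<lambda>\<omega>. iexp (V \<omega>))) < e" if "n \<ge> N" for n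
  proof -
    have pt: "norm (iexp (U n \<omega>) - iexp (V \<omega>)) \<le> e / 4 + 2 * indicator (?A n) \<omega>" if "\<omega> \<in> space M" for \<omega>
    proof (cases "\<bar>U n \<omega> - V \<omega>\<bar> > e / 4")
      case True
      have "norm (iexp (U n \<omega>) - iexp (V \<omega>)) \<le> norm (iexp (U n \<omega>)) + norm (iexp (V \<omega>))"
        by (rule norm_triangle_ineq4)
      then show ?thesis using True that \<open>e > 0\<close> by simp
    next
      case False
      have "norm (iexp (U n \<omega>) - iexp (V \<omega>)) = norm (iexp (V \<omega>) * (iexp (U n \<omega> - V \<omega>) - 1))"
        by (simp add: ring_distribs exp_add[symmetric])
      also have "\<dots> \<le> \<bar>U n \<omega> - V \<omega>\<bar>"
        using iexp_approx1[of "U n \<omega> - V \<omega>" 0] by (simp add: norm_mult)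
      finally show ?thesis using False that by simp
    qed
    have ind: "integrable M (indicator (?A n) :: 'a \<Rightarrow> real)" by (rule integrable_const_bound[where B=1]) (auto simp: indicator_def)
    have "norm (expectation (\<lambda>\<omega>. iexp (U n \<omega>)) - expectation (\<lambda>\<omega>. iexp (V \<omega>)))
      = norm (expectation (\<lambda>\<omega>. iexp (U n \<omega>) - iexp (V \<omega>)))" using int by simp
    also have "\<dots> \<le> expectation (\<lambda>\<omega>. norm (iexp (U n \<omega>) - iexp (V \<omega>)))" by (rule integral_norm_bound)
    also have "\<dots> \<le> expectation (\<lambda>\<omega>. e / 4 + 2 * indicator (?A n) \<omega>)"
    proof (rule integral_mono)
      show "integrable M (\<lambda>\<omega>. norm (iexp (U n \<omega>) - iexp (V \<omega>)))" using int by (intro integrable_norm) simp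
      show "integrable M (\<lambda>\<omega>. e / 4 + 2 * indicator (?A n) \<omega> :: real)"
        by (intro Bochner_Integration.integrable_add integrable_mult_right ind integrable_const)
    qed (rule pt)
    also have "\<dots> = e / 4 + 2 * prob (?A n)"
      by (subst Bochner_Integration.integral_add[OF integrable_const integrable_mult_right[OF ind]]) (simp add: prob_space)
    finally show ?thesis using N[OF that] \<open>e > 0\<close> by simp
  qed
  then show "\<exists>N. \<forall>n\<ge>N. norm (expectation (\<lambda>\<omega>. iexp (U n \<omega>)) - expectation (\<lambda>\<omega>. iexp (V \<omega>))) < e" by blast
qed

end

context filtered_brownian_motion
begin

lemma adapted_step_of_simple:
  assumes "simple_integrand M F (n, \<tau>, \<xi>)" "l \<in> borel_measurable borel"
  shows "adapted_step (n, \<tau>, \<lambda>i \<omega>. l (\<xi> i \<omega>))"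
  using assms by (auto simp: simple_integrand_def adapted_step_def)

lemma simple_process_measurable:
  assumes "adapted_step S"
  shows "(\<lambda>(s, \<omega>). simple_process S s \<omega>) \<in> borel_measurable (restrict_space borel A \<Otimes>\<^sub>M M)"
proof -
  obtain n \<tau> \<xi> where S: "S = (n, \<tau>, \<xi>)" by (cases S) auto
  have [measurable]: "\<xi> i \<in> borel_measurable M" if "i < n" for i
    using adapted_step_nonneg[OF assms[unfolded S], of i] that assms measurable_M[of "\<tau> i"]
    by (auto simp: adapted_step_def S)
  have [measurable]: "(\<lambda>s. indicat_real {\<tau> i<..\<tau> (Suc i)} s) \<in> borel_measurable (restrict_space borel A)" for i
    by (intro measurable_restrict_space1) auto
  show ?thesis
    unfolding simple_process_def S prod.case case_prod_unfold real_scaleR_def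
    by (intro borel_measurable_sum borel_measurable_times) auto
qed

text \<open>The definition of the Ito integral provides only some approximating sequence
  \<open>S\<close>; this result makes the integral computable along any adapted \<open>S'\<close>
  converging to the integrand. Both \<open>S'\<close> and the image of \<open>S\<close> under
  \<open>l\<close> are close in energy to \<open>l (H s)\<close>, so by the Lenglart bound their
  integrals are close in probability. The functional \<open>l\<close> stands for reading off one
  coordinate; its norm bound 1 transfers the approximation of \<open>H\<close> to
  \<open>l (H s)\<close>.\<close>

theorem ito_integral_conv_prob:
  fixes H :: "real \<Rightarrow> 'a \<Rightarrow> 'e::euclidean_space"
  assumes ito: "has_ito_integral M F B H T I" and T: "T > 0"
    and l: "bounded_linear l" "\<And>v. \<bar>l v\<bar> \<le> norm v"
    and S': "\<And>n. adapted_step (S' n)"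
    and conv: "AE \<omega> in M. (\<lambda>n. \<integral>\<^sup>+ s\<in>{0..T}. ennreal ((simple_process (S' n) s \<omega> - l (H s \<omega>))\<^sup>2) \<partial>lborel) \<longlonglongrightarrow> 0"
  shows "conv_prob (\<lambda>n. simple_integral B (S' n) T) (\<lambda>\<omega>. l (I \<omega>))"
proof -
  interpret l: bounded_linear l by fact
  have lm[measurable]: "l \<in> borel_measurable borel"
    using l(1) by (intro borel_measurable_continuous_onI linear_continuous_on)
  obtain S where S: "\<And>n. simple_integrand M F (S n)"
    and a: "tends_to_zero_in_prob M (\<lambda>n \<omega>.
            \<integral>\<^sup>+ s\<in>{0..T}. ennreal ((norm (simple_process (S n) s \<omega> - H s \<omega>))\<^sup>2) \<partial>lborel)"
    and i: "tends_to_zero_in_prob M (\<lambda>n \<omega>. ennreal (norm (simple_integral B (S n) T \<omega> - I \<omega>)))"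
    using ito by (auto simp: has_ito_integral_def)
  have I[measurable]: "I \<in> borel_measurable M" using ito by (auto simp: has_ito_integral_def)
  \<comment> \<open>By linearity, applying \<open>l\<close> to the coefficients commutes with
    forming both the process and its integral (\<open>Lp\<close>, \<open>Li\<close>).\<close>
  define L where "L = (\<lambda>n. case S n of (k, \<tau>, \<xi>) \<Rightarrow> (k, \<tau>, \<lambda>i \<omega>. l (\<xi> i \<omega>)))"
  have L: "adapted_step (L n)" for n
    using S[of n] adapted_step_of_simple[OF _ lm] by (cases "S n") (auto simp: L_def)
  have Lp: "simple_process (L n) s \<omega> = l (simple_process (S n) s \<omega>)" for n s \<omega>
    by (cases "S n") (simp only: L_def simple_process_def prod.case l.sum l.scaleR)
  have Li: "simple_integral B (L n) T \<omega> = l (simple_integral B (S n) T \<omega>)" for n \<omega>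
    by (cases "S n") (simp only: L_def simple_integral_def prod.case l.sum l.scaleR)
  have Hm: "(\<lambda>(s, \<omega>). H s \<omega>) \<in> borel_measurable (restrict_space borel {0..T} \<Otimes>\<^sub>M M)"
  proof -
    have H: "(\<lambda>(s, \<omega>). H s \<omega>) \<in> borel_measurable (restrict_space borel {0..T} \<Otimes>\<^sub>M F T)"
      using ito T by (auto simp: has_ito_integral_def)
    have "(\<lambda>\<omega>. \<omega>) \<in> measurable M (F T)"
      using measurable_M[of T "\<lambda>\<omega>. \<omega>" "F T"] T by simp
    then have "(\<lambda>x. (fst x, snd x)) \<in> measurable (restrict_space borel {0..T} \<Otimes>\<^sub>M M) (restrict_space borel {0..T} \<Otimes>\<^sub>M F T)"
      by (intro measurable_Pair) (auto intro: measurable_compose[OF measurable_snd])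
    from measurable_compose[OF this H] show ?thesis by (simp add: case_prod_unfold)
  qed
  define a where "a = (\<lambda>n \<omega>. \<integral>\<^sup>+ s\<in>{0..T}. ennreal ((norm (simple_process (S n) s \<omega> - H s \<omega>))\<^sup>2) \<partial>lborel)"
  define b where "b = (\<lambda>n \<omega>. \<integral>\<^sup>+ s\<in>{0..T}. ennreal ((simple_process (S' n) s \<omega> - l (H s \<omega>))\<^sup>2) \<partial>lborel)"
  define D where "D = (\<lambda>n \<omega>. \<integral>\<^sup>+ s\<in>{0..T}. ennreal ((simple_process (S' n) s \<omega> - simple_process (L n) s \<omega>)\<^sup>2) \<partial>lborel)"
  have am[measurable]: "a n \<in> borel_measurable M" for n
    using a unfolding a_def tends_to_zero_in_prob_def by auto
  have bm[measurable]: "b n \<in> borel_measurable M" for n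
    unfolding b_def
  proof (rule ito_measurable_aux)
    have "(\<lambda>x. l (case x of (s, \<omega>) \<Rightarrow> H s \<omega>)) \<in> borel_measurable (restrict_space borel {0..T} \<Otimes>\<^sub>M M)"
      using Hm by measurable
    from borel_measurable_diff[OF simple_process_measurable[OF S'] this]
    show "(\<lambda>(s, \<omega>). simple_process (S' n) s \<omega> - l (H s \<omega>)) \<in> borel_measurable (restrict_space borel {0..T} \<Otimes>\<^sub>M M)"
      by (simp add: case_prod_unfold)
  qed
  have Dm[measurable]: "D n \<in> borel_measurable M" for n
    unfolding D_def using simple_integral_diff_Lenglart(1)[OF S' L T, of 1 1] by simp
  have D_le: "D n \<omega> \<le> 2 * a n \<omega> + 2 * b n \<omega>" if "\<omega> \<in> space M" for n \<omega>
  proof -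
    have Hw: "(\<lambda>s. H s \<omega>) \<in> borel_measurable (restrict_space borel {0..T})"
      using measurable_compose[OF measurable_Pair2'[OF that] Hm] by simp
    have Sw: "simple_process (S n) s \<omega> = (\<Sum>i<fst (S n). indicator {fst (snd (S n)) i<..fst (snd (S n)) (Suc i)} s *\<^sub>R snd (snd (S n)) i \<omega>)" for s
      by (simp add: simple_process_def case_prod_unfold)
    have S'w: "simple_process (S' n) s \<omega> = (\<Sum>i<fst (S' n). indicator {fst (snd (S' n)) i<..fst (snd (S' n)) (Suc i)} s *\<^sub>R snd (snd (S' n)) i \<omega>)" for s
      by (simp add: simple_process_def case_prod_unfold)
    have ind: "(\<lambda>s. indicat_real {u<..v} s) \<in> borel_measurable (restrict_space borel {0..T})" for u v
      by (intro measurable_restrict_space1) auto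
    have m1: "(\<lambda>s. (simple_process (S n) s \<omega> - H s \<omega>)) \<in> borel_measurable (restrict_space lborel {0..T})"
      unfolding Sw using Hw ind by (intro borel_measurable_diff borel_measurable_sum borel_measurable_scaleR) (auto cong: measurable_cong_sets simp: sets_restrict_space_cong[OF sets_lborel])
    have m2: "(\<lambda>s. (simple_process (S' n) s \<omega> - l (H s \<omega>))) \<in> borel_measurable (restrict_space lborel {0..T})"
      unfolding S'w using Hw ind by (intro borel_measurable_diff borel_measurable_sum borel_measurable_scaleR measurable_compose[OF _ lm]) (auto cong: measurable_cong_sets simp: sets_restrict_space_cong[OF sets_lborel])
    have rs: "(\<integral>\<^sup>+ s\<in>{0..T}. f s \<partial>lborel) = (\<integral>\<^sup>+ s. f s \<partial>restrict_space lborel {0..T})" for f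
      by (subst nn_integral_restrict_space) auto
    have "ennreal ((simple_process (S' n) s \<omega> - simple_process (L n) s \<omega>)\<^sup>2) \<le>
      2 * ennreal ((norm (simple_process (S n) s \<omega> - H s \<omega>))\<^sup>2) + 2 * ennreal ((simple_process (S' n) s \<omega> - l (H s \<omega>))\<^sup>2)" for s
    proof -
      let ?u = "simple_process (S' n) s \<omega> - l (H s \<omega>)" and ?v = "simple_process (S n) s \<omega> - H s \<omega>"
      have eq: "simple_process (S' n) s \<omega> - simple_process (L n) s \<omega> = ?u - l ?v"
        by (simp add: Lp l.diff)
      have "(u - v)\<^sup>2 \<le> 2 * v\<^sup>2 + 2 * u\<^sup>2" for u v :: real
        using zero_le_power2[of "u + v"] by (simp add: power2_sum power2_diff)
      then have "(?u - l ?v)\<^sup>2 \<le> 2 * (l ?v)\<^sup>2 + 2 * ?u\<^sup>2" .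
      moreover have "(l ?v)\<^sup>2 \<le> (norm ?v)\<^sup>2" using power_mono[OF l(2)[of ?v], of 2] by simp
      ultimately have "(simple_process (S' n) s \<omega> - simple_process (L n) s \<omega>)\<^sup>2 \<le> 2 * (norm ?v)\<^sup>2 + 2 * ?u\<^sup>2"
        unfolding eq by linarith
      from ennreal_leI[OF this] show ?thesis by (simp add: ennreal_mult)
    qed
    then have "D n \<omega> \<le> (\<integral>\<^sup>+ s. 2 * ennreal ((norm (simple_process (S n) s \<omega> - H s \<omega>))\<^sup>2) + 2 * ennreal ((simple_process (S' n) s \<omega> - l (H s \<omega>))\<^sup>2) \<partial>restrict_space lborel {0..T})"
      unfolding D_def rs by (intro nn_integral_mono)
    also have "\<dots> = 2 * a n \<omega> + 2 * b n \<omega>"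
      unfolding a_def b_def rs using m1 m2 by (subst nn_integral_add) (auto simp: nn_integral_cmult)
    finally show ?thesis .
  qed
  have a0: "(\<lambda>n. prob {\<omega> \<in> space M. a n \<omega> > ennreal \<eta>}) \<longlonglongrightarrow> 0" if "\<eta> > 0" for \<eta>
  proof -
    have "(\<lambda>n. emeasure M {\<omega> \<in> space M. a n \<omega> > ennreal \<eta>}) \<longlonglongrightarrow> 0"
      using a that unfolding a_def tends_to_zero_in_prob_def by blast
    then show ?thesis by (simp add: emeasure_eq_measure tendsto_ennreal_iff[of _ _ 0, simplified])
  qed
  have b0: "(\<lambda>n. prob {\<omega> \<in> space M. b n \<omega> > ennreal \<eta>}) \<longlonglongrightarrow> 0" if "\<eta> > 0" for \<eta>
    using conv that by (intro AE_tendsto_zero_imp_prob bm) (simp_all only: b_def)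
  have D0: "(\<lambda>n. prob {\<omega> \<in> space M. D n \<omega> > ennreal \<eta>}) \<longlonglongrightarrow> 0" if "\<eta> > 0" for \<eta>
  proof -
    let ?A = "\<lambda>n. {\<omega> \<in> space M. a n \<omega> > ennreal (\<eta> / 4)}" and ?B = "\<lambda>n. {\<omega> \<in> space M. b n \<omega> > ennreal (\<eta> / 4)}"
    have le: "prob {\<omega> \<in> space M. D n \<omega> > ennreal \<eta>} \<le> prob (?A n) + prob (?B n)" for n
    proof -
      have "prob {\<omega> \<in> space M. D n \<omega> > ennreal \<eta>} \<le> prob (?A n \<union> ?B n)"
      proof (intro finite_measure_mono subsetI)
        fix \<omega> assume w: "\<omega> \<in> {\<omega> \<in> space M. D n \<omega> > ennreal \<eta>}"
        show "\<omega> \<in> ?A n \<union> ?B n"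
        proof (rule ccontr)
          assume "\<omega> \<notin> ?A n \<union> ?B n"
          then have "a n \<omega> \<le> ennreal (\<eta> / 4)" "b n \<omega> \<le> ennreal (\<eta> / 4)" using w by (auto simp: not_less)
          then have "2 * a n \<omega> + 2 * b n \<omega> \<le> 2 * ennreal (\<eta> / 4) + 2 * ennreal (\<eta> / 4)"
            by (intro add_mono mult_left_mono) auto
          also have "\<dots> = ennreal (2 * (\<eta> / 4) + 2 * (\<eta> / 4))"
            using \<open>\<eta> > 0\<close> by (simp only: ennreal_plus ennreal_mult ennreal_numeral)
          also have "\<dots> = ennreal \<eta>" by simp
          finally show False using D_le[of \<omega> n] w by auto
        qed
      qed measurable
      also have "\<dots> \<le> prob (?A n) + prob (?B n)" by (intro measure_Un_le) measurable
      finally show ?thesis .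
    qed
    have "(\<lambda>n. prob (?A n) + prob (?B n)) \<longlonglongrightarrow> 0 + 0"
      using a0[of "\<eta>/4"] b0[of "\<eta>/4"] that by (intro tendsto_add) auto
    then show ?thesis
      using tendsto_zero_sandwich[OF measure_nonneg le] by simp
  qed
  have sm: "simple_integral B (S' n) T \<in> borel_measurable M" "simple_integral B (L n) T \<in> borel_measurable M" for n
    using simple_integral_measurable S' L T by auto
  have c1: "conv_prob (\<lambda>n \<omega>. simple_integral B (S' n) T \<omega> - simple_integral B (L n) T \<omega>) (\<lambda>_. 0)"
    unfolding conv_prob_def
  proof (intro conjI allI impI)
    fix \<delta> :: real assume d: "\<delta> > 0"
    show "(\<lambda>n. prob {\<omega> \<in> space M. \<bar>simple_integral B (S' n) T \<omega> - simple_integral B (L n) T \<omega> - 0\<bar> > \<delta>}) \<longlonglongrightarrow> 0"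
    proof (rule LIMSEQ_I)
      fix e :: real assume e: "e > 0"
      \<comment> \<open>Chosen so that the Lenglart term \<eta> / \<delta>^2 equals e / 2.\<close>
      define \<eta> where "\<eta> = e * \<delta>\<^sup>2 / 2"
      have \<eta>: "\<eta> > 0" using e d by (simp add: \<eta>_def)
      have "eventually (\<lambda>n. prob {\<omega> \<in> space M. D n \<omega> > ennreal \<eta>} < e / 2) sequentially"
        using D0[OF \<eta>] e by (intro order_tendstoD) auto
      then obtain N where N: "\<And>n. n \<ge> N \<Longrightarrow> prob {\<omega> \<in> space M. D n \<omega> > ennreal \<eta>} < e / 2"
        by (auto simp: eventually_sequentially)
      have "prob {\<omega> \<in> space M. \<bar>simple_integral B (S' n) T \<omega> - simple_integral B (L n) T \<omega>\<bar> > \<delta>} < e" if "n \<ge> N" for n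
        using simple_integral_diff_Lenglart(2)[OF S' L T d \<eta>, of n n] N[OF that] d
        by (simp add: D_def \<eta>_def)
      then show "\<exists>N. \<forall>n\<ge>N. norm (prob {\<omega> \<in> space M. \<bar>simple_integral B (S' n) T \<omega> - simple_integral B (L n) T \<omega> - 0\<bar> > \<delta>} - 0) < e"
        by auto
    qed
  qed (use sm in auto)
  have c2: "conv_prob (\<lambda>n. simple_integral B (L n) T) (\<lambda>\<omega>. l (I \<omega>))"
    unfolding conv_prob_def
  proof (intro conjI allI impI)
    fix \<delta> :: real assume d: "\<delta> > 0"
    define c where "c = (\<lambda>n \<omega>. ennreal (norm (simple_integral B (S n) T \<omega> - I \<omega>)))"
    have cm[measurable]: "c n \<in> borel_measurable M" for n using i by (auto simp: tends_to_zero_in_prob_def c_def)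
    have "(\<lambda>n. emeasure M {\<omega> \<in> space M. c n \<omega> > ennreal \<delta>}) \<longlonglongrightarrow> 0"
      using i d unfolding c_def tends_to_zero_in_prob_def by blast
    then have c0: "(\<lambda>n. prob {\<omega> \<in> space M. c n \<omega> > ennreal \<delta>}) \<longlonglongrightarrow> 0"
      by (simp add: emeasure_eq_measure tendsto_ennreal_iff[of _ _ 0, simplified])
    have le: "prob {\<omega> \<in> space M. \<bar>simple_integral B (L n) T \<omega> - l (I \<omega>)\<bar> > \<delta>} \<le> prob {\<omega> \<in> space M. c n \<omega> > ennreal \<delta>}" for n
    proof (intro finite_measure_mono subsetI)
      fix \<omega> assume w: "\<omega> \<in> {\<omega> \<in> space M. \<bar>simple_integral B (L n) T \<omega> - l (I \<omega>)\<bar> > \<delta>}"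
      have "\<bar>simple_integral B (L n) T \<omega> - l (I \<omega>)\<bar> \<le> norm (simple_integral B (S n) T \<omega> - I \<omega>)"
        using l(2)[of "simple_integral B (S n) T \<omega> - I \<omega>"] l(1) by (simp add: Li linear_simps)
      then show "\<omega> \<in> {\<omega> \<in> space M. c n \<omega> > ennreal \<delta>}" using w d by (auto simp: c_def ennreal_less_iff)
    qed measurable
    show "(\<lambda>n. prob {\<omega> \<in> space M. \<bar>simple_integral B (L n) T \<omega> - l (I \<omega>)\<bar> > \<delta>}) \<longlonglongrightarrow> 0"
      using tendsto_zero_sandwich[OF measure_nonneg le c0] .
  qed (use sm in auto)
  from conv_prob_add[OF c1 c2] show ?thesis by simp
qed

end

subsection \<open>Components of the solution\<close>

lemma riemann_step_value:
  fixes f :: "real \<Rightarrow> real"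
  assumes s: "s \<in> {0<..1}"
  obtains i where "i < Suc n" "real i / Suc n < s" "s \<le> real (Suc i) / Suc n"
    "(\<Sum>i<Suc n. indicator {real i / Suc n<..real (Suc i) / Suc n} s *\<^sub>R f (real i / Suc n)) = f (real i / Suc n)"
proof -
  \<comment> \<open>The ceiling, not the floor, fits the left-open, right-closed cells: a grid point
    belongs to the cell that ends there.\<close>
  define k where "k = nat \<lceil>s * Suc n\<rceil> - 1"
  have c: "\<lceil>s * Suc n\<rceil> \<ge> 1" "\<lceil>s * Suc n\<rceil> \<le> int (Suc n)"
    using s by (auto simp: ceiling_le_iff one_le_ceiling mult_le_cancel_right1)
  have k: "real (Suc k) = of_int \<lceil>s * Suc n\<rceil>" using c by (simp add: k_def)
  have b: "real k < s * Suc n" "s * Suc n \<le> real (Suc k)"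
    using k ceiling_correct[of "s * Suc n"] by auto
  have kn: "k < Suc n" using c k by linarith
  have uniq: "(real i / Suc n < s \<and> s \<le> real (Suc i) / Suc n) \<longleftrightarrow> i = k" for i
  proof -
    have "(real i / Suc n < s \<and> s \<le> real (Suc i) / Suc n) \<longleftrightarrow> real i < s * Suc n \<and> s * Suc n \<le> real (Suc i)"
      by (simp add: divide_less_eq le_divide_eq)
    also have "\<dots> \<longleftrightarrow> i = k"
    proof
      assume a: "real i < s * Suc n \<and> s * Suc n \<le> real (Suc i)"
      then have "real i < real (Suc k)" "real k < real (Suc i)" using b by linarith+
      then show "i = k" by linarith
    qed (use b in auto)
    finally show ?thesis .
  qed
  have "(\<Sum>i<Suc n. indicator {real i / Suc n<..real (Suc i) / Suc n} s *\<^sub>R f (real i / Suc n)) =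
    (\<Sum>i<Suc n. if i = k then f (real i / Suc n) else 0)"
  proof (rule sum.cong[OF refl])
    fix i
    show "indicator {real i / Suc n<..real (Suc i) / Suc n} s *\<^sub>R f (real i / Suc n) = (if i = k then f (real i / Suc n) else 0)"
      using uniq[of i] by (simp only: indicator_def greaterThanAtMost_iff) simp
  qed
  also have "\<dots> = f (real k / Suc n)" using kn by (simp only: sum.delta finite_lessThan lessThan_iff) simp
  finally show ?thesis using that[of k] kn uniq[of k] by blast
qed

text \<open>On a compact interval the path is uniformly continuous, so sampling it at the left end
  of a short cell is a uniformly small error away from time 0.\<close>

lemma riemann_step_energy:
  fixes f :: "real \<Rightarrow> real"
  assumes f: "continuous_on {0..1} f"
  shows "(\<lambda>n. \<integral>\<^sup>+ s\<in>{0..1}. ennreal (((\<Sum>i<Suc n. indicator {real i / Suc n<..real (Suc i) / Suc n} s *\<^sub>R f (real i / Suc n)) - f s)\<^sup>2) \<partial>lborel) \<longlonglongrightarrow> 0"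
    (is "?I \<longlonglongrightarrow> 0")
proof -
  have "uniformly_continuous_on {0..1} f" using f by (intro compact_uniformly_continuous) auto
  note uc = this[unfolded uniformly_continuous_on_def, rule_format]
  have ev: "eventually (\<lambda>n. ?I n \<le> ennreal (e\<^sup>2)) sequentially" if e: "e > 0" for e
  proof -
    obtain d where d: "d > 0" "\<And>x y. x \<in> {0..1} \<Longrightarrow> y \<in> {0..1} \<Longrightarrow> dist y x < d \<Longrightarrow> dist (f y) (f x) < e"
      using uc[OF e] by blast
    obtain N where N: "inverse (real (Suc N)) < d" using reals_Archimedean[OF d(1)] by auto
    have "?I n \<le> ennreal (e\<^sup>2)" if n: "n \<ge> N" for n
    proof -
      have "?I n \<le> (\<integral>\<^sup>+ s. ennreal (e\<^sup>2) * indicator {0..1} s \<partial>(lborel :: real measure))"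
      \<comment> \<open>At \<open>s = 0\<close> no cell is active and the step function is 0 instead
        of \<open>f 0\<close>; that single point is discarded.\<close>
      proof (rule nn_integral_mono_AE, rule AE_mp[OF AE_lborel_singleton[of 0]], intro AE_I2 impI)
        fix s :: real assume s0: "s \<noteq> 0"
        show "ennreal (((\<Sum>i<Suc n. indicator {real i / Suc n<..real (Suc i) / Suc n} s *\<^sub>R f (real i / Suc n)) - f s)\<^sup>2) * indicator {0..1} s \<le> ennreal (e\<^sup>2) * indicator {0..1} s"
        proof (cases "s \<in> {0..1}")
          case True
          then have s: "s \<in> {0<..1}" using s0 by auto
          obtain i where i: "i < Suc n" "real i / Suc n < s" "s \<le> real (Suc i) / Suc n"
            "(\<Sum>i<Suc n. indicator {real i / Suc n<..real (Suc i) / Suc n} s *\<^sub>R f (real i / Suc n)) = f (real i / Suc n)"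
            using riemann_step_value[OF s, where f=f] by blast
          have "s - real i / Suc n \<le> 1 / Suc n" using i(3) by (simp add: add_divide_distrib)
          also have "\<dots> \<le> inverse (real (Suc N))" using n by (simp add: inverse_eq_divide frac_le)
          finally have "dist (real i / Suc n) s < d" using i(2) N by (simp add: dist_real_def)
          moreover have "real i / Suc n \<in> {0..1}" using i(1) by auto
          ultimately have "\<bar>f (real i / Suc n) - f s\<bar> < e" using d(2)[of s "real i / Suc n"] True by (simp add: dist_real_def)
          then have "(f (real i / Suc n) - f s)\<^sup>2 \<le> e\<^sup>2"
            using power_mono[of "\<bar>f (real i / Suc n) - f s\<bar>" e 2] by simp
          then show ?thesis unfolding i(4) using True by (simp add: ennreal_leI)
        qed simp
      qed
      also have "\<dots> = ennreal (e\<^sup>2)" by (simp add: nn_integral_cmult)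
      finally show ?thesis .
    qed
    then show ?thesis by (auto simp: eventually_sequentially)
  qed
  show ?thesis
  proof (rule order_tendstoI)
    fix a :: ennreal assume a: "0 < a"
    then obtain b where b: "0 < b" "b < min a 1" using dense[of 0 "min a 1"] by auto
    then have "b < a" "b < top" using less_trans[OF _ ennreal_one_less_top] by auto
    note b = b(1) this
    then obtain r where r: "b = ennreal r" "r > 0" by (cases b) (auto simp: ennreal_less_zero_iff)
    show "eventually (\<lambda>n. ?I n < a) sequentially"
      using ev[of "sqrt r"] r b by (auto elim!: eventually_mono)
  qed simp
qed

section \<open>From the planar motion to its coordinates\<close>

lemma measurable_fst_borel: "fst \<in> borel_measurable (borel :: ('a::euclidean_space \<times> 'b::euclidean_space) measure)"
  and measurable_snd_borel: "snd \<in> borel_measurable (borel :: ('a::euclidean_space \<times> 'b::euclidean_space) measure)"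
  by (intro borel_measurable_continuous_onI continuous_intros)+

lemma bounded_linear_coordinates:
  "bounded_linear (fst :: real \<times> real \<times> real \<Rightarrow> real)"
  "bounded_linear (\<lambda>v :: real \<times> real \<times> real. fst (snd v))"
  "bounded_linear (\<lambda>v :: real \<times> real \<times> real. snd (snd v))"
  by (rule bounded_linear_fst, (rule bounded_linear_compose[OF _ bounded_linear_snd, of fst] bounded_linear_compose[OF _ bounded_linear_snd, of snd], rule bounded_linear_fst bounded_linear_snd)+)

lemma abs_coordinates_le:
  fixes v :: "real \<times> real \<times> real"
  shows "\<bar>fst v\<bar> \<le> norm v" "\<bar>fst (snd v)\<bar> \<le> norm v" "\<bar>snd (snd v)\<bar> \<le> norm v"
  using norm_fst_le[of "fst v" "snd v"] norm_snd_le[of "snd v" "fst v"]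
    norm_fst_le[of "fst (snd v)" "snd (snd v)"] norm_snd_le[of "snd (snd v)" "fst (snd v)"]
  unfolding prod.collapse real_norm_def by linarith+

lemma planar_brownian_motionD:
  assumes "planar_brownian_motion M F W"
  shows "prob_space M" "filtration (space M) F" "\<And>t. t \<ge> 0 \<Longrightarrow> subalgebra M (F t)"
    "\<And>t. t \<ge> 0 \<Longrightarrow> W t \<in> borel_measurable (F t)" "AE \<omega> in M. W 0 \<omega> = (0, 0)"
    "AE \<omega> in M. continuous_on {0..} (\<lambda>t. W t \<omega>)"
    "\<And>s t. 0 \<le> s \<Longrightarrow> s < t \<Longrightarrow> distributed M lborel (\<lambda>\<omega>. W t \<omega> - W s \<omega>)
          (\<lambda>(u, v). ennreal (normal_density 0 (sqrt (t - s)) u * normal_density 0 (sqrt (t - s)) v))"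
    "\<And>s t. 0 \<le> s \<Longrightarrow> s < t \<Longrightarrow> prob_space.indep_set M (sets (F s))
          {(\<lambda>\<omega>. W t \<omega> - W s \<omega>) -` A \<inter> space M | A. A \<in> sets borel}"
  using assms unfolding planar_brownian_motion_def by auto

text \<open>Each marginal of the product density is normal because the other factor integrates to 1,
  and an event about a coordinate increment is also an event about the planar increment, so
  independence from the past is inherited.\<close>

lemma planar_brownian_motion_components:
  assumes W: "planar_brownian_motion M F W"
  shows "filtered_brownian_motion M F (\<lambda>t \<omega>. fst (W t \<omega>))" (is ?A)
    and "filtered_brownian_motion M F (\<lambda>t \<omega>. snd (W t \<omega>))" (is ?B)
proof -
  note D = planar_brownian_motionD[OF W]
  interpret prob_space M by (rule D(1))
  have nn: "(\<integral>\<^sup>+ v. ennreal (normal_density 0 r v) \<partial>lborel) = 1" if "r > 0" for r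
    using integral_normal_density[of r 0] integrable_normal_density[of r 0] that
    by (subst nn_integral_eq_integral) auto
  have dist: "distributed M lborel (\<lambda>\<omega>. fst (W t \<omega>) - fst (W s \<omega>)) (normal_density 0 (sqrt (t - s)))"
    "distributed M lborel (\<lambda>\<omega>. snd (W t \<omega>) - snd (W s \<omega>)) (normal_density 0 (sqrt (t - s)))"
    if st: "0 \<le> s" "s < t" for s t
  proof -
    let ?r = "sqrt (t - s)"
    have r: "?r > 0" using st by simp
    have J: "distributed M (lborel \<Otimes>\<^sub>M lborel) (\<lambda>\<omega>. (fst (W t \<omega>) - fst (W s \<omega>), snd (W t \<omega>) - snd (W s \<omega>)))
       (\<lambda>(u, v). ennreal (normal_density 0 ?r u * normal_density 0 ?r v))"
      using D(7)[OF st] by (simp add: lborel_prod minus_prod_def)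
    have m1: "(\<lambda>x. \<integral>\<^sup>+ v. (case (x, v) of (u, v) \<Rightarrow> ennreal (normal_density 0 ?r u * normal_density 0 ?r v)) \<partial>lborel) = (\<lambda>x. ennreal (normal_density 0 ?r x))"
      using nn[OF r] by (auto simp: ennreal_mult nn_integral_cmult)
    have m2: "(\<lambda>x. \<integral>\<^sup>+ v. (case (v, x) of (u, v) \<Rightarrow> ennreal (normal_density 0 ?r u * normal_density 0 ?r v)) \<partial>lborel) = (\<lambda>x. ennreal (normal_density 0 ?r x))"
      using nn[OF r] by (auto simp: ennreal_mult nn_integral_multc)
    show "distributed M lborel (\<lambda>\<omega>. fst (W t \<omega>) - fst (W s \<omega>)) (normal_density 0 ?r)"
      using distr_marginal1[OF sigma_finite_lborel sigma_finite_lborel J, unfolded m1] by simp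
    show "distributed M lborel (\<lambda>\<omega>. snd (W t \<omega>) - snd (W s \<omega>)) (normal_density 0 ?r)"
      using distr_marginal2[OF sigma_finite_lborel sigma_finite_lborel J, unfolded m2] by simp
  qed
  have ind: "indep_set (sets (F s)) {(\<lambda>\<omega>. g (W t \<omega>) - g (W s \<omega>)) -` A \<inter> space M | A. A \<in> sets borel}"
    if st: "0 \<le> s" "s < t" and g: "g \<in> borel_measurable borel" "\<And>x y. g x - g y = g (x - y)" for s t and g :: "real \<times> real \<Rightarrow> real"
  proof -
    have "{(\<lambda>\<omega>. g (W t \<omega>) - g (W s \<omega>)) -` A \<inter> space M | A. A \<in> sets borel} \<subseteq>
      {(\<lambda>\<omega>. W t \<omega> - W s \<omega>) -` A \<inter> space M | A. A \<in> sets borel}"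
    proof clarify
      fix A :: "real set" assume "A \<in> sets borel"
      then have "g -` A \<in> sets borel" using measurable_sets[OF g(1), of A] by simp
      then show "\<exists>A'. (\<lambda>\<omega>. g (W t \<omega>) - g (W s \<omega>)) -` A \<inter> space M = (\<lambda>\<omega>. W t \<omega> - W s \<omega>) -` A' \<inter> space M \<and> A' \<in> sets borel"
        by (intro exI[of _ "g -` A"]) (auto simp: g(2))
    qed
    then show ?thesis
      unfolding indep_set_def
      by (intro indep_sets_mono_sets[OF D(8)[OF st, unfolded indep_set_def]]) (auto split: bool.split)
  qed
  have ad: "(\<lambda>\<omega>. fst (W t \<omega>)) \<in> borel_measurable (F t)" "(\<lambda>\<omega>. snd (W t \<omega>)) \<in> borel_measurable (F t)" if "t \<ge> 0" for t
    using measurable_compose[OF D(4)[OF that] measurable_fst_borel] measurable_compose[OF D(4)[OF that] measurable_snd_borel] by simp_all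
  show ?A
    by (intro filtered_brownian_motion.intro filtered_brownian_motion_axioms.intro D(1,2,3) ad(1) dist(1)
      ind[OF _ _ measurable_fst_borel fst_diff[symmetric]])
  show ?B
    by (intro filtered_brownian_motion.intro filtered_brownian_motion_axioms.intro D(1,2,3) ad(2) dist(2)
      ind[OF _ _ measurable_snd_borel snd_diff[symmetric]])
qed

context filtered_brownian_motion
begin

text \<open>The one-step process with value \<open>c\<close> on (0, T] differs from the constant
  only at time 0, so it approximates with error zero. The resulting constant sequence of integrals
  converges in probability, which forces almost sure equality with the limit.\<close>

lemma ito_integral_constant:
  fixes H :: "real \<Rightarrow> 'a \<Rightarrow> 'e::euclidean_space"
  assumes ito: "has_ito_integral M F B H T I" and T: "T > 0"
    and l: "bounded_linear l" "\<And>v. \<bar>l v\<bar> \<le> norm v" and c: "\<And>s \<omega>. l (H s \<omega>) = c"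
  shows "AE \<omega> in M. l (I \<omega>) = c * (B T \<omega> - B 0 \<omega>)"
proof -
  define S where "S = (1 :: nat, \<lambda>i. real i * T, \<lambda>(i::nat) (\<omega>::'a). c)"
  have S: "adapted_step S" using T by (auto simp: adapted_step_def S_def)
  have sp: "simple_process S s \<omega> = indicator {0<..T} s * c" for s \<omega>
    unfolding S_def simple_process_def prod.case One_nat_def sum.lessThan_Suc by simp
  have "(\<integral>\<^sup>+ s\<in>{0..T}. ennreal ((simple_process S s \<omega> - l (H s \<omega>))\<^sup>2) \<partial>lborel) = 0" for \<omega>
  proof -
    have "(\<integral>\<^sup>+ s\<in>{0..T}. ennreal ((simple_process S s \<omega> - l (H s \<omega>))\<^sup>2) \<partial>lborel) = (\<integral>\<^sup>+ s. 0 \<partial>(lborel :: real measure))"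
      by (rule nn_integral_cong_AE, rule AE_mp[OF AE_lborel_singleton[of 0]])
        (auto simp: sp c indicator_def)
    then show ?thesis by simp
  qed
  then have "conv_prob (\<lambda>n. simple_integral B S T) (\<lambda>\<omega>. l (I \<omega>))"
    using S by (intro ito_integral_conv_prob[OF ito T l]) auto
  from conv_prob_unique_const[OF this] show ?thesis
    using T by (auto simp: S_def simple_integral_def mult.commute)
qed

end

text \<open>The mesh \<open>1 / n\<close> and the number \<open>k\<close> of summands are separate
  arguments, so that summands can be peeled off from the end one at a time.\<close>

definition levy_sum :: "(real \<Rightarrow> 'a \<Rightarrow> real \<times> real) \<Rightarrow> nat \<Rightarrow> nat \<Rightarrow> 'a \<Rightarrow> real" where
  "levy_sum W n k \<omega> = (\<Sum>i<k. (fst (W (real i / n) \<omega>) * (snd (W (real (Suc i) / n) \<omega>) - snd (W (real i / n) \<omega>))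
     - snd (W (real i / n) \<omega>) * (fst (W (real (Suc i) / n) \<omega>) - fst (W (real i / n) \<omega>))) / 2)"

text \<open>The first two components of both vector fields are constant, so their Ito integrals are
  multiples of Brownian increments. Time 0 is treated apart because the integral lemma asks for a
  positive horizon.\<close>

lemma heisenberg_horizontal:
  fixes X :: "real \<Rightarrow> 'a \<Rightarrow> real \<times> real \<times> real"
  assumes W: "planar_brownian_motion M F W" and X: "dilated_heisenberg_bm M F W y0 z0 \<epsilon> X" and t: "t \<ge> 0"
  shows "AE \<omega> in M. fst (X t \<omega>) = \<epsilon> * fst (W t \<omega>) \<and> fst (snd (X t \<omega>)) = \<epsilon> * y0 + \<epsilon> * snd (W t \<omega>)"
proof -
  interpret B1: filtered_brownian_motion M F "\<lambda>t \<omega>. fst (W t \<omega>)" by (rule planar_brownian_motion_components(1)[OF W])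
  interpret B2: filtered_brownian_motion M F "\<lambda>t \<omega>. snd (W t \<omega>)" by (rule planar_brownian_motion_components(2)[OF W])
  note sol = X[unfolded dilated_heisenberg_bm_def sde_solution_def]
  have X0: "AE \<omega> in M. X 0 \<omega> = (0, \<epsilon> * y0, \<epsilon> * z0)" using sol by blast
  note W0 = planar_brownian_motionD(5)[OF W]
  show ?thesis
  proof (cases "t = 0")
    case True
    have "AE \<omega> in M. fst (X 0 \<omega>) = \<epsilon> * fst (W 0 \<omega>) \<and> fst (snd (X 0 \<omega>)) = \<epsilon> * y0 + \<epsilon> * snd (W 0 \<omega>)"
      using X0 W0 by eventually_elim simp
    then show ?thesis using True by simp
  next
    case False
    then have t: "t > 0" using t by simp
    obtain I1 I2 where I: "has_ito_integral M F (\<lambda>s \<omega>. fst (W s \<omega>)) (\<lambda>s \<omega>. \<epsilon> *\<^sub>R sigma1 (X s \<omega>)) t I1"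
      "has_ito_integral M F (\<lambda>s \<omega>. snd (W s \<omega>)) (\<lambda>s \<omega>. \<epsilon> *\<^sub>R sigma2 (X s \<omega>)) t I2"
      "AE \<omega> in M. X t \<omega> = (0, \<epsilon> * y0, \<epsilon> * z0) + I1 \<omega> + I2 \<omega>"
      using sol t by (meson less_imp_le)
    note l1 = bounded_linear_coordinates(1) abs_coordinates_le(1)
    note l2 = bounded_linear_coordinates(2) abs_coordinates_le(2)
    have "AE \<omega> in M. fst (I1 \<omega>) = \<epsilon> * (fst (W t \<omega>) - fst (W 0 \<omega>))"
      by (rule B1.ito_integral_constant[OF I(1) t l1]) (auto simp: sigma1_def case_prod_unfold)
    moreover have "AE \<omega> in M. fst (I2 \<omega>) = 0 * (snd (W t \<omega>) - snd (W 0 \<omega>))"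
      by (rule B2.ito_integral_constant[OF I(2) t l1]) (auto simp: sigma2_def case_prod_unfold)
    moreover have "AE \<omega> in M. fst (snd (I1 \<omega>)) = 0 * (fst (W t \<omega>) - fst (W 0 \<omega>))"
      by (rule B1.ito_integral_constant[OF I(1) t l2]) (auto simp: sigma1_def case_prod_unfold)
    moreover have "AE \<omega> in M. fst (snd (I2 \<omega>)) = \<epsilon> * (snd (W t \<omega>) - snd (W 0 \<omega>))"
      by (rule B2.ito_integral_constant[OF I(2) t l2]) (auto simp: sigma2_def case_prod_unfold)
    ultimately show ?thesis using I(3) W0 by eventually_elim auto
  qed
qed

text \<open>The exceptional sets of the countably many rational times combine to a null set;
  rationals approaching from the right then carry the equality to every time by continuity of the
  paths.\<close>

lemma AE_all_time_eq:
  fixes f g :: "real \<Rightarrow> 'a \<Rightarrow> real"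
  assumes eq: "\<And>t. t \<ge> 0 \<Longrightarrow> AE \<omega> in M. f t \<omega> = g t \<omega>"
    and f: "AE \<omega> in M. continuous_on {0..} (\<lambda>t. f t \<omega>)" and g: "AE \<omega> in M. continuous_on {0..} (\<lambda>t. g t \<omega>)"
  shows "AE \<omega> in M. \<forall>t\<ge>0. f t \<omega> = g t \<omega>"
proof -
  have "AE \<omega> in M. \<forall>q::rat. of_rat q \<ge> (0::real) \<longrightarrow> f (of_rat q) \<omega> = g (of_rat q) \<omega>"
    unfolding AE_all_countable using eq by (auto intro: AE_impI)
  then show ?thesis using f g
  proof eventually_elim
    case (elim \<omega>)
    show ?case
    proof (intro allI impI)
      fix t :: real assume t: "t \<ge> 0"
      have "\<exists>q::rat. t < of_rat q \<and> of_rat q < t + inverse (Suc n)" for n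
        by (rule of_rat_dense) simp
      then obtain q where q: "\<And>n. t < of_rat (q n)" "\<And>n. of_rat (q n) < t + inverse (Suc n)" by metis
      have lim: "(\<lambda>n. of_rat (q n) :: real) \<longlonglongrightarrow> t"
      proof (rule tendsto_sandwich[of "\<lambda>_. t" _ _ "\<lambda>n. t + inverse (Suc n)"])
        show "(\<lambda>n. t + inverse (real (Suc n))) \<longlonglongrightarrow> t"
          using tendsto_add[OF tendsto_const LIMSEQ_inverse_real_of_nat, of t] by simp
      qed (use q in \<open>auto intro!: always_eventually less_imp_le\<close>)
      have q0: "of_rat (q n) \<in> {0::real..}" for n using q(1)[of n] t unfolding atLeast_iff by linarith
      have "(\<lambda>n. f (of_rat (q n)) \<omega>) \<longlonglongrightarrow> f t \<omega>"
        using continuous_on_tendsto_compose[OF elim(2) lim] t q0 by simp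
      moreover have "(\<lambda>n. g (of_rat (q n)) \<omega>) \<longlonglongrightarrow> g t \<omega>"
        using continuous_on_tendsto_compose[OF elim(3) lim] t q0 by simp
      moreover have "f (of_rat (q n)) \<omega> = g (of_rat (q n)) \<omega>" for n using elim(1) q0[of n] by auto
      ultimately show "f t \<omega> = g t \<omega>" using LIMSEQ_unique by simp
    qed
  qed
qed

text \<open>Sampling at left endpoints keeps the coefficients adapted, and path continuity gives the
  required almost sure convergence in energy.\<close>

lemma (in filtered_brownian_motion) ito_integral_riemann_sums:
  fixes H :: "real \<Rightarrow> 'a \<Rightarrow> 'e::euclidean_space"
  assumes ito: "has_ito_integral M F B H 1 I"
    and l: "bounded_linear l" "\<And>v. \<bar>l v\<bar> \<le> norm v"
    and Y: "\<And>t. t \<ge> 0 \<Longrightarrow> Y t \<in> borel_measurable (F t)" "AE \<omega> in M. continuous_on {0..} (\<lambda>t. Y t \<omega>)"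
    and H: "AE \<omega> in M. \<forall>t\<ge>0. l (H t \<omega>) = Y t \<omega>"
  shows "conv_prob (\<lambda>n \<omega>. \<Sum>i<Suc n. (B (real (Suc i) / Suc n) \<omega> - B (real i / Suc n) \<omega>) * Y (real i / Suc n) \<omega>)
    (\<lambda>\<omega>. l (I \<omega>))"
proof -
  define S where "S = (\<lambda>n. (Suc n, \<lambda>i. real i / real (Suc n), \<lambda>i. Y (real i / Suc n)))"
  have S: "adapted_step (S n)" for n using Y(1) by (auto simp: adapted_step_def S_def divide_right_mono)
  have int: "simple_integral B (S n) 1 = (\<lambda>\<omega>. \<Sum>i<Suc n. (B (real (Suc i) / Suc n) \<omega> - B (real i / Suc n) \<omega>) * Y (real i / Suc n) \<omega>)" for n
  proof
    fix \<omega>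
    have "min (real i / Suc n) 1 = real i / Suc n" if "i \<le> Suc n" for i
      using that by (auto simp: min_def)
    then show "simple_integral B (S n) 1 \<omega> = (\<Sum>i<Suc n. (B (real (Suc i) / Suc n) \<omega> - B (real i / Suc n) \<omega>) * Y (real i / Suc n) \<omega>)"
      unfolding S_def simple_integral_def prod.case real_scaleR_def by (intro sum.cong) auto
  qed
  have "AE \<omega> in M. (\<lambda>n. \<integral>\<^sup>+ s\<in>{0..1}. ennreal ((simple_process (S n) s \<omega> - l (H s \<omega>))\<^sup>2) \<partial>lborel) \<longlonglongrightarrow> 0"
    using Y(2) H
  proof eventually_elim
    case (elim \<omega>)
    have "continuous_on {0..1} (\<lambda>t. Y t \<omega>)" using elim(1) by (rule continuous_on_subset) auto
    note R = riemann_step_energy[OF this]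
    have "(\<integral>\<^sup>+ s\<in>{0..1}. ennreal ((simple_process (S n) s \<omega> - l (H s \<omega>))\<^sup>2) \<partial>lborel) = 
      (\<integral>\<^sup>+ s\<in>{0..1}. ennreal (((\<Sum>i<Suc n. indicator {real i / Suc n<..real (Suc i) / Suc n} s *\<^sub>R Y (real i / Suc n) \<omega>) - Y s \<omega>)\<^sup>2) \<partial>lborel)" for n
    proof (rule nn_integral_cong)
      fix s :: real
      have "l (H s \<omega>) = Y s \<omega>" if "s \<in> {0..1}" using elim(2) that by simp
      then show "ennreal ((simple_process (S n) s \<omega> - l (H s \<omega>))\<^sup>2) * indicator {0..1} s =
        ennreal (((\<Sum>i<Suc n. indicator {real i / Suc n<..real (Suc i) / Suc n} s *\<^sub>R Y (real i / Suc n) \<omega>) - Y s \<omega>)\<^sup>2) * indicator {0..1} s"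
        unfolding simple_process_def S_def prod.case by (cases "s \<in> {0..1}") (simp only:, simp)
    qed
    then show ?case using R by (simp only:)
  qed
  from ito_integral_conv_prob[OF ito zero_less_one l S this] show ?thesis unfolding int .
qed

text \<open>The third component has integrands - \<epsilon> Y / 2 and \<epsilon> X / 2 with X and Y
  already explicit. The initial value \<epsilon> y0 inside Y is constant in time, so its Riemann sum
  telescopes to the term in \<open>fst (W 1 \<omega>)\<close>; the rest is \<epsilon>^2 times the
  discrete area.\<close>

theorem heisenberg_vertical:
  fixes X :: "real \<Rightarrow> 'a \<Rightarrow> real \<times> real \<times> real"
  assumes W: "planar_brownian_motion M F W" and X: "dilated_heisenberg_bm M F W y0 z0 \<epsilon> X"
  shows "prob_space.conv_prob M (\<lambda>n \<omega>. \<epsilon> * z0 - \<epsilon>\<^sup>2 * y0 / 2 * fst (W 1 \<omega>) + \<epsilon>\<^sup>2 * levy_sum W (Suc n) (Suc n) \<omega>)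
    (\<lambda>\<omega>. snd (snd (X 1 \<omega>)))"
proof -
  interpret B1: filtered_brownian_motion M F "\<lambda>t \<omega>. fst (W t \<omega>)" by (rule planar_brownian_motion_components(1)[OF W])
  interpret B2: filtered_brownian_motion M F "\<lambda>t \<omega>. snd (W t \<omega>)" by (rule planar_brownian_motion_components(2)[OF W])
  note D = planar_brownian_motionD[OF W]
  note sol = X[unfolded dilated_heisenberg_bm_def sde_solution_def]
  obtain I1 I2 where I: "has_ito_integral M F (\<lambda>s \<omega>. fst (W s \<omega>)) (\<lambda>s \<omega>. \<epsilon> *\<^sub>R sigma1 (X s \<omega>)) 1 I1"
    "has_ito_integral M F (\<lambda>s \<omega>. snd (W s \<omega>)) (\<lambda>s \<omega>. \<epsilon> *\<^sub>R sigma2 (X s \<omega>)) 1 I2"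
    "AE \<omega> in M. X 1 \<omega> = (0, \<epsilon> * y0, \<epsilon> * z0) + I1 \<omega> + I2 \<omega>"
    using sol by (meson zero_le_one)
  note l = bounded_linear_coordinates(3) abs_coordinates_le(3)
  have cX: "AE \<omega> in M. continuous_on {0..} (\<lambda>t. X t \<omega>)" using sol by blast
  have cW: "AE \<omega> in M. continuous_on {0..} (\<lambda>t. W t \<omega>)" by (rule D(6))
  \<comment> \<open>The integrand must be identified along whole paths, not just at one fixed
    time.\<close>
  have all1: "AE \<omega> in M. \<forall>t\<ge>0. fst (X t \<omega>) = \<epsilon> * fst (W t \<omega>)"
  proof (rule AE_all_time_eq)
    show "AE \<omega> in M. fst (X t \<omega>) = \<epsilon> * fst (W t \<omega>)" if "t \<ge> 0" for t
      using heisenberg_horizontal[OF W X that] by eventually_elim simp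
    show "AE \<omega> in M. continuous_on {0..} (\<lambda>t. fst (X t \<omega>))" using cX by eventually_elim (intro continuous_intros)
    show "AE \<omega> in M. continuous_on {0..} (\<lambda>t. \<epsilon> * fst (W t \<omega>))" using cW by eventually_elim (intro continuous_intros)
  qed
  have all2: "AE \<omega> in M. \<forall>t\<ge>0. fst (snd (X t \<omega>)) = \<epsilon> * y0 + \<epsilon> * snd (W t \<omega>)"
  proof (rule AE_all_time_eq)
    show "AE \<omega> in M. fst (snd (X t \<omega>)) = \<epsilon> * y0 + \<epsilon> * snd (W t \<omega>)" if "t \<ge> 0" for t
      using heisenberg_horizontal[OF W X that] by eventually_elim simp
    show "AE \<omega> in M. continuous_on {0..} (\<lambda>t. fst (snd (X t \<omega>)))" using cX by eventually_elim (intro continuous_intros)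
    show "AE \<omega> in M. continuous_on {0..} (\<lambda>t. \<epsilon> * y0 + \<epsilon> * snd (W t \<omega>))" using cW by eventually_elim (intro continuous_intros)
  qed
  have c1: "B1.conv_prob (\<lambda>n \<omega>. \<Sum>i<Suc n. (fst (W (real (Suc i) / Suc n) \<omega>) - fst (W (real i / Suc n) \<omega>)) * (- \<epsilon> / 2 * (\<epsilon> * y0 + \<epsilon> * snd (W (real i / Suc n) \<omega>)))) (\<lambda>\<omega>. snd (snd (I1 \<omega>)))"
  proof (rule B1.ito_integral_riemann_sums[OF I(1) l])
    show "(\<lambda>\<omega>. - \<epsilon> / 2 * (\<epsilon> * y0 + \<epsilon> * snd (W t \<omega>))) \<in> borel_measurable (F t)" if "t \<ge> 0" for t
      using B2.adapted[OF that] by simp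
    show "AE \<omega> in M. continuous_on {0..} (\<lambda>t. - \<epsilon> / 2 * (\<epsilon> * y0 + \<epsilon> * snd (W t \<omega>)))"
      using cW by eventually_elim (intro continuous_intros)
    show "AE \<omega> in M. \<forall>t\<ge>0. snd (snd (\<epsilon> *\<^sub>R sigma1 (X t \<omega>))) = - \<epsilon> / 2 * (\<epsilon> * y0 + \<epsilon> * snd (W t \<omega>))"
      using all2 by eventually_elim (auto simp: sigma1_def case_prod_unfold)
  qed
  have c2: "B1.conv_prob (\<lambda>n \<omega>. \<Sum>i<Suc n. (snd (W (real (Suc i) / Suc n) \<omega>) - snd (W (real i / Suc n) \<omega>)) * (\<epsilon> / 2 * (\<epsilon> * fst (W (real i / Suc n) \<omega>)))) (\<lambda>\<omega>. snd (snd (I2 \<omega>)))"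
  proof (rule B2.ito_integral_riemann_sums[OF I(2) l])
    show "(\<lambda>\<omega>. \<epsilon> / 2 * (\<epsilon> * fst (W t \<omega>))) \<in> borel_measurable (F t)" if "t \<ge> 0" for t
      using B1.adapted[OF that] by simp
    show "AE \<omega> in M. continuous_on {0..} (\<lambda>t. \<epsilon> / 2 * (\<epsilon> * fst (W t \<omega>)))"
      using cW by eventually_elim (intro continuous_intros)
    show "AE \<omega> in M. \<forall>t\<ge>0. snd (snd (\<epsilon> *\<^sub>R sigma2 (X t \<omega>))) = \<epsilon> / 2 * (\<epsilon> * fst (W t \<omega>))"
      using all1 by eventually_elim (auto simp: sigma2_def case_prod_unfold)
  qed
  note c = B1.conv_prob_add[OF B1.conv_prob_const[of "\<lambda>_. \<epsilon> * z0"] B1.conv_prob_add[OF c1 c2]]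
  have WM: "(\<lambda>\<omega>. fst (W t \<omega>)) \<in> borel_measurable M" "(\<lambda>\<omega>. snd (W t \<omega>)) \<in> borel_measurable M" if "t \<ge> 0" for t
    using B1.measurable_M[OF that B1.adapted[OF that]] B2.measurable_M[OF that B2.adapted[OF that]] by auto
  show ?thesis
  proof (rule B1.conv_prob_cong_AE[OF c])
    show "(\<lambda>\<omega>. \<epsilon> * z0) \<in> borel_measurable M" by simp
    show "(\<lambda>\<omega>. snd (snd (X 1 \<omega>))) \<in> borel_measurable M"
    proof -
      have "X 1 \<in> borel_measurable M" using sol B1.measurable_M[of 1 "X 1"] by auto
      from measurable_compose[OF measurable_compose[OF this measurable_snd_borel] measurable_snd_borel]
      show ?thesis .
    qed
    show "AE \<omega> in M. \<epsilon> * z0 + (snd (snd (I1 \<omega>)) + snd (snd (I2 \<omega>))) = snd (snd (X 1 \<omega>))"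
      using I(3) by eventually_elim simp
    fix n
    show "(\<lambda>\<omega>. \<epsilon> * z0 - \<epsilon>\<^sup>2 * y0 / 2 * fst (W 1 \<omega>) + \<epsilon>\<^sup>2 * levy_sum W (Suc n) (Suc n) \<omega>) \<in> borel_measurable M"
      unfolding levy_sum_def using WM
      by (intro borel_measurable_add borel_measurable_diff borel_measurable_times borel_measurable_sum borel_measurable_divide borel_measurable_const) auto
    show "AE \<omega> in M. \<epsilon> * z0 + ((\<Sum>i<Suc n. (fst (W (real (Suc i) / Suc n) \<omega>) - fst (W (real i / Suc n) \<omega>)) * (- \<epsilon> / 2 * (\<epsilon> * y0 + \<epsilon> * snd (W (real i / Suc n) \<omega>)))) +
       (\<Sum>i<Suc n. (snd (W (real (Suc i) / Suc n) \<omega>) - snd (W (real i / Suc n) \<omega>)) * (\<epsilon> / 2 * (\<epsilon> * fst (W (real i / Suc n) \<omega>))))) =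
       \<epsilon> * z0 - \<epsilon>\<^sup>2 * y0 / 2 * fst (W 1 \<omega>) + \<epsilon>\<^sup>2 * levy_sum W (Suc n) (Suc n) \<omega>"
      using D(5)
    proof eventually_elim
      case (elim \<omega>)
      define a where "a = (\<lambda>i. fst (W (real i / Suc n) \<omega>))"
      define b where "b = (\<lambda>i. snd (W (real i / Suc n) \<omega>))"
      have "(\<Sum>i<Suc n. a (Suc i) - a i) = a (Suc n) - a 0" by (rule sum_lessThan_telescope)
      then have tel: "(\<Sum>i<Suc n. a (Suc i) - a i) = fst (W 1 \<omega>)" using elim by (simp add: a_def)
      have "(\<Sum>i<Suc n. (a (Suc i) - a i) * (- \<epsilon> / 2 * (\<epsilon> * y0 + \<epsilon> * b i))) + (\<Sum>i<Suc n. (b (Suc i) - b i) * (\<epsilon> / 2 * (\<epsilon> * a i))) =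
        (\<Sum>i<Suc n. (- \<epsilon>\<^sup>2 * y0 / 2) * (a (Suc i) - a i) + \<epsilon>\<^sup>2 * ((a i * (b (Suc i) - b i) - b i * (a (Suc i) - a i)) / 2))"
        unfolding sum.distrib[symmetric] by (intro sum.cong refl) (simp add: field_simps power2_eq_square)
      also have "\<dots> = - \<epsilon>\<^sup>2 * y0 / 2 * fst (W 1 \<omega>) + \<epsilon>\<^sup>2 * levy_sum W (Suc n) (Suc n) \<omega>"
        unfolding sum.distrib sum_distrib_left[symmetric] tel levy_sum_def by (simp only: a_def b_def)
      finally show ?case unfolding a_def b_def by simp
    qed
  qed
qed

subsection \<open>Characteristic function of the Levy area\<close>

lemma std_normal_iexp:
  "integrable lborel (\<lambda>x. std_normal_density x *\<^sub>R iexp (t * x))"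
  "(LINT x|lborel. std_normal_density x *\<^sub>R iexp (t * x)) = complex_of_real (exp (- t\<^sup>2 / 2))"
proof -
  show "integrable lborel (\<lambda>x. std_normal_density x *\<^sub>R iexp (t * x))"
    by (rule Bochner_Integration.integrable_bound[OF integrable_normal_density[of 1 0]]) auto
  have "(LINT x|lborel. std_normal_density x *\<^sub>R iexp (t * x)) = char std_normal_distribution t"
    unfolding char_def by (subst integral_density) auto
  then show "(LINT x|lborel. std_normal_density x *\<^sub>R iexp (t * x)) = complex_of_real (exp (- t\<^sup>2 / 2))"
    by (simp add: char_std_normal_distribution)
qed

text \<open>The real part of \<open>c\<close> is absorbed by completing the square, a real
  substitution centred at a \<sigma>^2; what remains is the characteristic function of the standard
  normal law at b \<sigma>.\<close>

lemma normal_density_cexp_linear: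
  fixes c :: complex
  assumes "\<sigma> > 0"
  shows "integrable lborel (\<lambda>u. normal_density 0 \<sigma> u *\<^sub>R exp (c * of_real u))"
    "(LINT u|lborel. normal_density 0 \<sigma> u *\<^sub>R exp (c * of_real u)) = exp (c\<^sup>2 * of_real (\<sigma>\<^sup>2) / 2)"
proof -
  define a where "a = Re c" define b where "b = Im c"
  have c: "c = of_real a + \<i> * of_real b" by (simp add: a_def b_def complex_eq)
  let ?f = "\<lambda>u. normal_density 0 \<sigma> u *\<^sub>R exp (c * of_real u)"
  have nd: "normal_density 0 \<sigma> (a * \<sigma>\<^sup>2 + \<sigma> * x) * exp (a * (a * \<sigma>\<^sup>2 + \<sigma> * x)) = exp (a\<^sup>2 * \<sigma>\<^sup>2 / 2) / \<sigma> * std_normal_density x" for x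
  proof -
    have "- (a * \<sigma>\<^sup>2 + \<sigma> * x)\<^sup>2 / (2 * \<sigma>\<^sup>2) + a * (a * \<sigma>\<^sup>2 + \<sigma> * x) = a\<^sup>2 * \<sigma>\<^sup>2 / 2 + - x\<^sup>2 / 2"
      using assms by (simp add: field_simps power2_eq_square)
    then have "exp (- (a * \<sigma>\<^sup>2 + \<sigma> * x)\<^sup>2 / (2 * \<sigma>\<^sup>2)) * exp (a * (a * \<sigma>\<^sup>2 + \<sigma> * x)) = exp (a\<^sup>2 * \<sigma>\<^sup>2 / 2) * exp (- x\<^sup>2 / 2)"
      by (simp only: exp_add[symmetric])
    then show ?thesis
      using assms by (simp add: normal_density_def real_sqrt_mult field_simps)
  qed
  have eq: "?f (a * \<sigma>\<^sup>2 + \<sigma> * x) = (exp (a\<^sup>2 * \<sigma>\<^sup>2 / 2) / \<sigma> * iexp (b * (a * \<sigma>\<^sup>2))) * (std_normal_density x *\<^sub>R iexp (b * \<sigma> * x))" for x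
  proof -
    have "exp (c * of_real (a * \<sigma>\<^sup>2 + \<sigma> * x)) = of_real (exp (a * (a * \<sigma>\<^sup>2 + \<sigma> * x))) * (iexp (b * (a * \<sigma>\<^sup>2)) * iexp (b * \<sigma> * x))"
      unfolding exp_of_real[symmetric] exp_add[symmetric] c by (simp add: algebra_simps)
    then have "?f (a * \<sigma>\<^sup>2 + \<sigma> * x) = of_real (normal_density 0 \<sigma> (a * \<sigma>\<^sup>2 + \<sigma> * x) * exp (a * (a * \<sigma>\<^sup>2 + \<sigma> * x))) * (iexp (b * (a * \<sigma>\<^sup>2)) * iexp (b * \<sigma> * x))"
      by (simp only: scaleR_conv_of_real of_real_mult mult.assoc)
    then show ?thesis unfolding nd by (simp add: scaleR_conv_of_real)
  qed
  have "integrable lborel (\<lambda>x. ?f (a * \<sigma>\<^sup>2 + \<sigma> * x))"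
    unfolding eq by (intro integrable_mult_right std_normal_iexp)
  then show "integrable lborel ?f"
    using lborel_integrable_real_affine_iff[of \<sigma> ?f "a * \<sigma>\<^sup>2"] assms by simp
  have "integral\<^sup>L lborel ?f = \<bar>\<sigma>\<bar> *\<^sub>R (LINT x|lborel. ?f (a * \<sigma>\<^sup>2 + \<sigma> * x))"
    using assms by (intro lborel_integral_real_affine) simp
  also have "\<dots> = \<sigma> *\<^sub>R ((exp (a\<^sup>2 * \<sigma>\<^sup>2 / 2) / \<sigma> * iexp (b * (a * \<sigma>\<^sup>2))) * of_real (exp (- (b * \<sigma>)\<^sup>2 / 2)))"
    unfolding eq using assms by (subst integral_mult_right_zero) (simp only: std_normal_iexp(2) abs_of_pos)
  also have "\<dots> = exp (of_real (a\<^sup>2 * \<sigma>\<^sup>2 / 2)) * iexp (b * (a * \<sigma>\<^sup>2)) * exp (of_real (- (b * \<sigma>)\<^sup>2 / 2))"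
    unfolding exp_of_real using assms by (simp add: scaleR_conv_of_real del: of_real_power of_real_mult)
  also have "\<dots> = exp (c\<^sup>2 * of_real (\<sigma>\<^sup>2) / 2)"
    unfolding exp_add[symmetric] c by (rule arg_cong[where f=exp]) (simp add: power2_eq_square algebra_simps add_divide_distrib)
  finally show "integral\<^sup>L lborel ?f = exp (c\<^sup>2 * of_real (\<sigma>\<^sup>2) / 2)" .
qed

text \<open>The quadratic factor only changes the variance from h to h / (1 + q h), at the price of
  the normalisation 1 / sqrt (1 + q h).\<close>

lemma normal_density_cexp_quadratic:
  fixes c :: complex
  assumes h: "h > 0" and q: "q \<ge> 0"
  shows "integrable lborel (\<lambda>u. normal_density 0 (sqrt h) u *\<^sub>R exp (of_real (- q * u\<^sup>2 / 2) + c * of_real u))"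
    "(LINT u|lborel. normal_density 0 (sqrt h) u *\<^sub>R exp (of_real (- q * u\<^sup>2 / 2) + c * of_real u)) =
       of_real (1 / sqrt (1 + q * h)) * exp (c\<^sup>2 * of_real (h / (2 * (1 + q * h))))"
proof -
  let ?s = "sqrt (h / (1 + q * h))"
  have pos: "1 + q * h > 0" using h q by (simp add: add_pos_nonneg)
  have s: "?s > 0" using pos h by simp
  have eq: "normal_density 0 (sqrt h) u *\<^sub>R exp (of_real (- q * u\<^sup>2 / 2) + c * of_real u) =
    of_real (1 / sqrt (1 + q * h)) * (normal_density 0 ?s u *\<^sub>R exp (c * of_real u))" for u
  proof -
    have "- u\<^sup>2 / (2 * h) + - q * u\<^sup>2 / 2 = - u\<^sup>2 / (2 * (h / (1 + q * h)))"
      using h pos by (simp add: field_simps)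
    then have "exp (- u\<^sup>2 / (2 * h)) * exp (- q * u\<^sup>2 / 2) = exp (- u\<^sup>2 / (2 * (h / (1 + q * h))))"
      by (simp only: exp_add[symmetric])
    moreover have "1 / sqrt (2 * pi * h) = 1 / sqrt (1 + q * h) * (1 / sqrt (2 * pi * (h / (1 + q * h))))"
      using h pos by (simp add: real_sqrt_mult real_sqrt_divide)
    moreover have "?s\<^sup>2 = h / (1 + q * h)" "(sqrt h)\<^sup>2 = h" using h pos by simp_all
    ultimately have "normal_density 0 (sqrt h) u * exp (- q * u\<^sup>2 / 2) = 1 / sqrt (1 + q * h) * normal_density 0 ?s u"
      unfolding normal_density_def diff_zero by (simp only: mult.assoc)
    then have "complex_of_real (normal_density 0 (sqrt h) u) * of_real (exp (- q * u\<^sup>2 / 2)) = of_real (1 / sqrt (1 + q * h)) * of_real (normal_density 0 ?s u)"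
      by (simp only: of_real_mult[symmetric])
    then show ?thesis
      by (simp only: exp_add exp_of_real scaleR_conv_of_real mult.assoc[symmetric])
  qed
  show "integrable lborel (\<lambda>u. normal_density 0 (sqrt h) u *\<^sub>R exp (of_real (- q * u\<^sup>2 / 2) + c * of_real u))"
    unfolding eq by (intro integrable_mult_right normal_density_cexp_linear s)
  show "(LINT u|lborel. normal_density 0 (sqrt h) u *\<^sub>R exp (of_real (- q * u\<^sup>2 / 2) + c * of_real u)) =
       of_real (1 / sqrt (1 + q * h)) * exp (c\<^sup>2 * of_real (h / (2 * (1 + q * h))))"
    unfolding eq integral_mult_right_zero normal_density_cexp_linear(2)[OF s] using pos h by (simp add: field_simps)
qed

lemma lborel_integral_product:
  fixes f g :: "real \<Rightarrow> complex"
  assumes f: "integrable lborel f" and g: "integrable lborel g"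
  shows "integrable lborel (\<lambda>(u, v). f u * g v)"
    "(LINT p|lborel. (case p of (u, v) \<Rightarrow> f u * g v)) = (LINT u|lborel. f u) * (LINT v|lborel. g v)"
proof -
  have [measurable]: "f \<in> borel_measurable borel" "g \<in> borel_measurable borel" using f g by auto
  have i: "integrable (lborel \<Otimes>\<^sub>M lborel) (\<lambda>(u, v). f u * g v)"
  proof (rule lborel_pair.Fubini_integrable)
    show "integrable lborel (\<lambda>x. LINT y|lborel. norm (case (x, y) of (u, v) \<Rightarrow> f u * g v))"
      using f g by (simp add: norm_mult)
    show "AE x in lborel. integrable lborel (\<lambda>y. case (x, y) of (u, v) \<Rightarrow> f u * g v)"
      using g by simp
  qed measurable
  then show "integrable lborel (\<lambda>(u, v). f u * g v)" by (simp add: lborel_prod)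
  have "(LINT p|lborel. (case p of (u, v) \<Rightarrow> f u * g v)) = integral\<^sup>L (lborel \<Otimes>\<^sub>M lborel) (\<lambda>p. case p of (u, v) \<Rightarrow> f u * g v)"
    by (simp add: lborel_prod)
  also have "\<dots> = (LINT u|lborel. LINT v|lborel. f u * g v)"
    using lborel_pair.integral_fst'[OF i] by simp
  also have "\<dots> = (LINT u|lborel. f u) * (LINT v|lborel. g v)"
    by simp
  finally show "(LINT p|lborel. (case p of (u, v) \<Rightarrow> f u * g v)) = (LINT u|lborel. f u) * (LINT v|lborel. g v)" .
qed

text \<open>An ansatz that is stable under one backward Gaussian step twisted by the phase of the
  area: a radial quadratic, an imaginary linear term in x and a real linear term in y, which the
  twist couples to each other.\<close>

definition gauss_phase :: "real \<Rightarrow> real \<Rightarrow> real \<Rightarrow> real \<times> real \<Rightarrow> complex" where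
  "gauss_phase q \<alpha> \<beta> = (\<lambda>(x, y). exp (of_real (- q * (x\<^sup>2 + y\<^sup>2) / 2 + \<beta> * y) + \<i> * of_real (\<alpha> * x)))"

text \<open>The first parameter changes by h (\<kappa>^2 - q^2) / (1 + q h), a discrete form of the
  Riccati equation q' = \<kappa>^2 - q^2, whose solution from 0 is \<kappa> tanh (\<kappa>
  t).\<close>

abbreviation gauss_phase_next :: "real \<Rightarrow> real \<Rightarrow> real \<Rightarrow> real \<Rightarrow> real \<Rightarrow> real \<times> real \<Rightarrow> complex" where
  "gauss_phase_next q \<alpha> \<beta> h \<kappa> \<equiv> gauss_phase ((q + h * \<kappa>\<^sup>2) / (1 + q * h)) ((\<alpha> + h * \<kappa> * \<beta>) / (1 + q * h)) ((\<beta> + h * \<kappa> * \<alpha>) / (1 + q * h))"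

text \<open>The area increment is linear in the new increment \<open>p\<close>, so the integrand
  factorises into two one-dimensional Gaussian integrals with linear coefficients \<open>c\<close>
  and \<open>d\<close>. Here \<open>a\<close> is the area already accumulated, with Fourier variable
  2 \<kappa>.\<close>

lemma gauss_phase_step:
  assumes h: "h > 0" and q: "q \<ge> 0"
  shows "(LINT p|lborel. (case p of (u, v) \<Rightarrow> normal_density 0 (sqrt h) u * normal_density 0 (sqrt h) v) *\<^sub>R
      (iexp (2 * \<kappa> * (a + (x * snd p - y * fst p) / 2)) * gauss_phase q \<alpha> \<beta> ((x, y) + p))) =
    of_real (exp (- h * (\<alpha>\<^sup>2 - \<beta>\<^sup>2) / (2 * (1 + q * h))) / (1 + q * h)) *
      (iexp (2 * \<kappa> * a) * gauss_phase_next q \<alpha> \<beta> h \<kappa> (x, y))"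
proof -
  have pos: "1 + q * h > 0" using h q by (simp add: add_pos_nonneg)
  define c where "c = of_real (- q * x) + \<i> * of_real (\<alpha> - \<kappa> * y)"
  define d where "d = of_real (\<beta> - q * y) + \<i> * of_real (\<kappa> * x)"
  define K where "K = iexp (2 * \<kappa> * a) * gauss_phase q \<alpha> \<beta> (x, y)"
  let ?e = "\<lambda>c u. normal_density 0 (sqrt h) u *\<^sub>R exp (of_real (- q * u\<^sup>2 / 2) + c * of_real u)"
  have split: "(case p of (u, v) \<Rightarrow> normal_density 0 (sqrt h) u * normal_density 0 (sqrt h) v) *\<^sub>R
      (iexp (2 * \<kappa> * (a + (x * snd p - y * fst p) / 2)) * gauss_phase q \<alpha> \<beta> ((x, y) + p)) =
    K * (case p of (u, v) \<Rightarrow> ?e c u * ?e d v)" for p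
  proof -
    obtain u v where p: "p = (u, v)" by (cases p)
    have "iexp (2 * \<kappa> * (a + (x * v - y * u) / 2)) * gauss_phase q \<alpha> \<beta> (x + u, y + v) =
      K * (exp (of_real (- q * u\<^sup>2 / 2) + c * of_real u) * exp (of_real (- q * v\<^sup>2 / 2) + d * of_real v))"
      unfolding K_def gauss_phase_def prod.case exp_add[symmetric] c_def d_def
      by (rule arg_cong[where f=exp]) (simp add: power2_eq_square algebra_simps add_divide_distrib diff_divide_distrib)
    then show ?thesis by (simp add: p scaleR_conv_of_real)
  qed
  \<comment> \<open>The mixed terms in x y from the two squares cancel, which is why the ansatz is
    preserved.\<close>
  have sq: "c\<^sup>2 + d\<^sup>2 = of_real ((q\<^sup>2 - \<kappa>\<^sup>2) * (x\<^sup>2 + y\<^sup>2) - (\<alpha>\<^sup>2 - \<beta>\<^sup>2) + 2 * y * (\<kappa> * \<alpha> - q * \<beta>)) + \<i> * of_real (2 * x * (\<kappa> * \<beta> - q * \<alpha>))"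
    unfolding c_def d_def by (simp add: complex_eq_iff power2_eq_square algebra_simps)
  \<comment> \<open>Comparison of coefficients; for the quadratic part, q - h (q^2 - \<kappa>^2) /
    (1 + q h) = (q + h \<kappa>^2) / (1 + q h).\<close>
  have r1: "- q * (x\<^sup>2 + y\<^sup>2) / 2 + \<beta> * y + ((q\<^sup>2 - \<kappa>\<^sup>2) * (x\<^sup>2 + y\<^sup>2) - (\<alpha>\<^sup>2 - \<beta>\<^sup>2) + 2 * y * (\<kappa> * \<alpha> - q * \<beta>)) * (h / (2 * (1 + q * h))) =
    - h * (\<alpha>\<^sup>2 - \<beta>\<^sup>2) / (2 * (1 + q * h)) + (- ((q + h * \<kappa>\<^sup>2) / (1 + q * h)) * (x\<^sup>2 + y\<^sup>2) / 2 + ((\<beta> + h * \<kappa> * \<alpha>) / (1 + q * h)) * y)"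
    using pos by (simp add: divide_simps) (simp add: power2_eq_square algebra_simps)
  have r2: "\<alpha> * x + (2 * x * (\<kappa> * \<beta> - q * \<alpha>)) * (h / (2 * (1 + q * h))) = ((\<alpha> + h * \<kappa> * \<beta>) / (1 + q * h)) * x"
    using pos by (simp add: divide_simps) (simp add: power2_eq_square algebra_simps)
  have "(LINT p|lborel. K * (case p of (u, v) \<Rightarrow> ?e c u * ?e d v)) = K * ((LINT u|lborel. ?e c u) * (LINT v|lborel. ?e d v))"
    unfolding integral_mult_right_zero
    by (subst lborel_integral_product(2)[OF normal_density_cexp_quadratic(1)[OF h q] normal_density_cexp_quadratic(1)[OF h q]]) simp
  also have "\<dots> = K * (of_real (1 / (1 + q * h)) * exp ((c\<^sup>2 + d\<^sup>2) * of_real (h / (2 * (1 + q * h)))))"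
  proof -
    have rr: "of_real (1 / sqrt (1 + q * h)) * of_real (1 / sqrt (1 + q * h)) = complex_of_real (1 / (1 + q * h))"
      using pos by (simp only: of_real_mult[symmetric]) simp
    then show ?thesis
      unfolding normal_density_cexp_quadratic(2)[OF h q]
      unfolding distrib_right[of "c\<^sup>2"] exp_add rr[symmetric] by (simp only: mult_ac)
  qed
  also have "\<dots> = of_real (exp (- h * (\<alpha>\<^sup>2 - \<beta>\<^sup>2) / (2 * (1 + q * h))) / (1 + q * h)) *
      (iexp (2 * \<kappa> * a) * gauss_phase_next q \<alpha> \<beta> h \<kappa> (x, y))"
  proof -
    have "gauss_phase q \<alpha> \<beta> (x, y) * exp ((c\<^sup>2 + d\<^sup>2) * of_real (h / (2 * (1 + q * h)))) =
      exp (of_real (- q * (x\<^sup>2 + y\<^sup>2) / 2 + \<beta> * y + ((q\<^sup>2 - \<kappa>\<^sup>2) * (x\<^sup>2 + y\<^sup>2) - (\<alpha>\<^sup>2 - \<beta>\<^sup>2) + 2 * y * (\<kappa> * \<alpha> - q * \<beta>)) * (h / (2 * (1 + q * h))))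
        + \<i> * of_real (\<alpha> * x + (2 * x * (\<kappa> * \<beta> - q * \<alpha>)) * (h / (2 * (1 + q * h)))))"
      unfolding gauss_phase_def prod.case exp_add[symmetric] sq
      by (rule arg_cong[where f=exp]) (simp only: of_real_add of_real_mult distrib_left distrib_right mult.assoc add_ac)
    also have "\<dots> = of_real (exp (- h * (\<alpha>\<^sup>2 - \<beta>\<^sup>2) / (2 * (1 + q * h)))) *
      gauss_phase_next q \<alpha> \<beta> h \<kappa> (x, y)"
      unfolding r1 r2 gauss_phase_def prod.case exp_of_real[symmetric] exp_add[symmetric]
      by (simp only: of_real_add add.assoc)
    finally show ?thesis
      unfolding K_def by (simp add: mult_ac)
  qed
  finally show ?thesis unfolding split .
qed

lemma gauss_phase_norm_le:
  assumes "q \<ge> 0" "\<And>y. - q * y\<^sup>2 / 2 + \<beta> * y \<le> C"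
  shows "norm (gauss_phase q \<alpha> \<beta> p) \<le> exp C"
proof -
  obtain x y where p: "p = (x, y)" by (cases p)
  have "- q * (x\<^sup>2 + y\<^sup>2) / 2 + \<beta> * y \<le> - q * y\<^sup>2 / 2 + \<beta> * y"
    using assms(1) by (simp add: field_simps)
  also have "\<dots> \<le> C" by (rule assms(2))
  finally show ?thesis by (simp add: p gauss_phase_def)
qed

lemma continuous_gauss_phase: "continuous_on UNIV (gauss_phase q \<alpha> \<beta>)"
  unfolding gauss_phase_def case_prod_unfold by (intro continuous_intros) auto

lemma levy_sum_measurable:
  assumes W: "planar_brownian_motion M F W" and n: "n > 0"
  shows "levy_sum W n k \<in> borel_measurable (F (real k / n))"
proof -
  note D = planar_brownian_motionD[OF W]
  have "W (real i / n) \<in> borel_measurable (F (real k / n))" if "i \<le> k" for i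
    using that n by (intro filtration_measurable_mono[OF D(2) _ D(4)[of "real i / n"]]) (simp_all add: divide_right_mono)
  then have *: "(\<lambda>\<omega>. fst (W (real i / n) \<omega>)) \<in> borel_measurable (F (real k / n))"
      "(\<lambda>\<omega>. snd (W (real i / n) \<omega>)) \<in> borel_measurable (F (real k / n))" if "i \<le> k" for i
    using measurable_compose[OF _ measurable_fst_borel] measurable_compose[OF _ measurable_snd_borel] that by blast+
  show ?thesis
    unfolding levy_sum_def[abs_def]
  proof (rule borel_measurable_sum)
    fix i assume "i \<in> {..<k}"
    then have i: "i \<le> k" "Suc i \<le> k" by auto
    note [measurable] = *[OF i(1)] *[OF i(2)]
    show "(\<lambda>\<omega>. (fst (W (real i / n) \<omega>) * (snd (W (real (Suc i) / n) \<omega>) - snd (W (real i / n) \<omega>)) -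
      snd (W (real i / n) \<omega>) * (fst (W (real (Suc i) / n) \<omega>) - fst (W (real i / n) \<omega>))) / 2) \<in> borel_measurable (F (real k / n))"
      by measurable
  qed
qed

text \<open>Conditioning on \<open>F s\<close>, carried out as Fubini for the joint law of the past
  \<open>(A, W s)\<close> and the independent increment: the inner integral is the Gaussian step
  with the past frozen. The constant \<open>C\<close> bounds the integrand and so provides
  integrability.\<close>

lemma gauss_phase_expectation_step:
  fixes W :: "real \<Rightarrow> 'a \<Rightarrow> real \<times> real"
  assumes W: "planar_brownian_motion M F W" and st: "0 \<le> s" "s < t"
    and A: "A \<in> borel_measurable (F s)" and q: "q \<ge> 0" and C: "\<And>y. - q * y\<^sup>2 / 2 + \<beta> * y \<le> C"
  defines "h \<equiv> t - s"
  shows "(LINT \<omega>|M. iexp (2 * \<kappa> * (A \<omega> + (fst (W s \<omega>) * (snd (W t \<omega>) - snd (W s \<omega>)) - snd (W s \<omega>) * (fst (W t \<omega>) - fst (W s \<omega>))) / 2)) * gauss_phase q \<alpha> \<beta> (W t \<omega>)) =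
    of_real (exp (- h * (\<alpha>\<^sup>2 - \<beta>\<^sup>2) / (2 * (1 + q * h))) / (1 + q * h)) *
    (LINT \<omega>|M. iexp (2 * \<kappa> * A \<omega>) * gauss_phase_next q \<alpha> \<beta> h \<kappa> (W s \<omega>))"
proof -
  note D = planar_brownian_motionD[OF W]
  interpret prob_space M by (rule D(1))
  have h: "h > 0" using st by (simp add: h_def)
  define Y where "Y = (\<lambda>\<omega>. (A \<omega>, W s \<omega>))"
  define E where "E = (\<lambda>\<omega>. W t \<omega> - W s \<omega>)"
  have YF: "Y \<in> borel_measurable (F s)"
    using measurable_Pair[OF A D(4)[OF st(1)]] by (simp add: Y_def borel_prod)
  have WM: "W r \<in> borel_measurable M" if "r \<ge> 0" for r
    using measurable_from_subalg[OF D(3) D(4)] that by simp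
  have YM: "Y \<in> borel_measurable M" by (rule measurable_from_subalg[OF D(3)[OF st(1)] YF])
  have EM: "E \<in> borel_measurable M" unfolding E_def using WM st by simp
  \<comment> \<open>\<open>indep_var\<close> requires both variables to have the same codomain, hence the padding.\<close>
  define E' where "E' = (\<lambda>\<omega>. (0 :: real, E \<omega>))"
  have E'M: "E' \<in> borel_measurable M"
    using measurable_Pair[OF measurable_const[of "0 :: real" borel] EM] by (simp add: E'_def borel_prod)
  have "indep_set (sets (F s)) {E' -` B \<inter> space M | B. B \<in> sets borel}"
  proof -
    have "(\<lambda>d. (0 :: real, d)) \<in> borel_measurable (borel :: (real \<times> real) measure)"
      by (intro borel_measurable_continuous_onI continuous_intros)
    then have vimage: "(\<lambda>d. (0 :: real, d)) -` B \<in> sets (borel :: (real \<times> real) measure)" if "B \<in> sets borel" for B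
      using measurable_sets[OF _ that, of "\<lambda>d. (0 :: real, d)" "borel :: (real \<times> real) measure"] by simp
    have "{E' -` B \<inter> space M | B. B \<in> sets borel} \<subseteq> {E -` B \<inter> space M | B. B \<in> sets borel}"
    proof (intro subsetI)
      fix x assume "x \<in> {E' -` B \<inter> space M | B. B \<in> sets borel}"
      then obtain B where B: "B \<in> sets borel" "x = E' -` B \<inter> space M" by blast
      have "x = E -` ((\<lambda>d. (0 :: real, d)) -` B) \<inter> space M" unfolding B(2) E'_def by auto
      then show "x \<in> {E -` B \<inter> space M | B. B \<in> sets borel}"
        using vimage[OF B(1)] by (intro CollectI exI[of _ "(\<lambda>d. (0 :: real, d)) -` B"] conjI)
    qed
    then show ?thesis
      unfolding indep_set_def
      by (intro indep_sets_mono_sets[OF D(8)[OF st, unfolded indep_set_def]]) (auto split: bool.split simp: E_def)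
  qed
  then have "indep_var borel Y borel E'"
    by (rule indep_var_of_indep_set[OF D(3)[OF st(1)] _ YF E'M])
  then have prod: "distr M borel Y \<Otimes>\<^sub>M distr M borel E' = distr M (borel \<Otimes>\<^sub>M borel) (\<lambda>\<omega>. (Y \<omega>, E' \<omega>))"
    by (simp add: indep_var_distribution_eq)
  define G where "G = (\<lambda>p :: (real \<times> real \<times> real) \<times> (real \<times> real \<times> real). 
     iexp (2 * \<kappa> * (fst (fst p) + (fst (snd (fst p)) * snd (snd (snd p)) - snd (snd (fst p)) * fst (snd (snd p))) / 2)) * gauss_phase q \<alpha> \<beta> (snd (fst p) + snd (snd p)))"
  have Gc: "continuous_on UNIV G" unfolding G_def
    by (intro continuous_intros continuous_on_compose2[OF continuous_gauss_phase]) auto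
  then have Gm: "G \<in> borel_measurable (borel \<Otimes>\<^sub>M borel)"
    unfolding borel_prod by (rule borel_measurable_continuous_onI)
  have Gb: "norm (G p) \<le> exp C" for p
    unfolding G_def norm_mult using gauss_phase_norm_le[OF q C] by simp
  interpret PY: prob_space "distr M borel Y" by (rule prob_space_distr[OF YM])
  interpret PE: prob_space "distr M borel E'" by (rule prob_space_distr[OF E'M])
  interpret PP: pair_prob_space "distr M borel Y" "distr M borel E'" ..
  have Gi: "integrable (distr M borel Y \<Otimes>\<^sub>M distr M borel E') G"
    by (rule PP.P.integrable_const_bound[where B="exp C"]) (use Gb Gm measurable_cong_sets[OF sets_pair_measure_cong[OF sets_distr sets_distr] refl] in \<open>simp_all\<close>)
  have dE: "distr M borel E = density lborel (\<lambda>p. ennreal (case p of (u, v) \<Rightarrow> normal_density 0 (sqrt h) u * normal_density 0 (sqrt h) v))"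
  proof -
    have "distr M borel E = distr M lborel E" by (rule distr_cong) auto
    then show ?thesis
      using distributed_distr_eq_density[OF D(7)[OF st]] by (simp add: E_def h_def case_prod_unfold)
  qed
  have "(LINT \<omega>|M. iexp (2 * \<kappa> * (A \<omega> + (fst (W s \<omega>) * (snd (W t \<omega>) - snd (W s \<omega>)) - snd (W s \<omega>) * (fst (W t \<omega>) - fst (W s \<omega>))) / 2)) * gauss_phase q \<alpha> \<beta> (W t \<omega>)) = 
    (LINT \<omega>|M. G (Y \<omega>, E' \<omega>))"
    by (simp add: G_def Y_def E_def E'_def fst_diff snd_diff)
  also have "\<dots> = integral\<^sup>L (distr M (borel \<Otimes>\<^sub>M borel) (\<lambda>\<omega>. (Y \<omega>, E' \<omega>))) G"
    by (rule integral_distr[symmetric]) (use YM E'M Gm in auto)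
  also have "\<dots> = (LINT y|distr M borel Y. LINT e|distr M borel E'. G (y, e))"
    unfolding prod[symmetric] using PP.integral_fst'[OF Gi] by simp
  also have "\<dots> = (LINT y|distr M borel Y. of_real (exp (- h * (\<alpha>\<^sup>2 - \<beta>\<^sup>2) / (2 * (1 + q * h))) / (1 + q * h)) *
    (iexp (2 * \<kappa> * fst y) * gauss_phase_next q \<alpha> \<beta> h \<kappa> (snd y)))"
  proof (rule Bochner_Integration.integral_cong[OF refl])
    fix y :: "real \<times> real \<times> real"
    obtain a x z where y: "y = (a, x, z)" by (cases y)
    have G1: "(\<lambda>e. G (y, e)) \<in> borel_measurable borel"
      by (intro borel_measurable_continuous_onI continuous_on_compose2[OF Gc] continuous_intros) auto
    have G2: "(\<lambda>d. G (y, 0, d)) \<in> borel_measurable borel"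
      by (intro borel_measurable_continuous_onI continuous_on_compose2[OF Gc] continuous_intros) auto
    have "(LINT e|distr M borel E'. G (y, e)) = (LINT \<omega>|M. G (y, 0, E \<omega>))"
      using integral_distr[OF E'M G1] by (simp add: E'_def)
    also have "\<dots> = (LINT d|distr M borel E. G (y, 0, d))"
      using integral_distr[OF EM G2] by simp
    also have "\<dots> = (LINT p|lborel. (case p of (u, v) \<Rightarrow> normal_density 0 (sqrt h) u * normal_density 0 (sqrt h) v) *\<^sub>R G (y, 0, p))"
      unfolding dE using G2 measurable_compose[OF measurable_fst_borel borel_measurable_normal_density]
        measurable_compose[OF measurable_snd_borel borel_measurable_normal_density]
      by (intro integral_density) (auto simp: case_prod_unfold intro!: borel_measurable_times)
    also have "\<dots> = of_real (exp (- h * (\<alpha>\<^sup>2 - \<beta>\<^sup>2) / (2 * (1 + q * h))) / (1 + q * h)) *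
      (iexp (2 * \<kappa> * a) * gauss_phase_next q \<alpha> \<beta> h \<kappa> (x, z))"
      unfolding gauss_phase_step[OF h q, symmetric] by (simp add: G_def y)
    finally show "(LINT e|distr M borel E'. G (y, e)) = of_real (exp (- h * (\<alpha>\<^sup>2 - \<beta>\<^sup>2) / (2 * (1 + q * h))) / (1 + q * h)) *
    (iexp (2 * \<kappa> * fst y) * gauss_phase_next q \<alpha> \<beta> h \<kappa> (snd y))"
      by (simp only: y fst_conv snd_conv)
  qed
  also have "\<dots> = of_real (exp (- h * (\<alpha>\<^sup>2 - \<beta>\<^sup>2) / (2 * (1 + q * h))) / (1 + q * h)) *
    (LINT y|distr M borel Y. iexp (2 * \<kappa> * fst y) * gauss_phase_next q \<alpha> \<beta> h \<kappa> (snd y))"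
    by (rule integral_mult_right_zero)
  also have "(LINT y|distr M borel Y. iexp (2 * \<kappa> * fst y) * gauss_phase_next q \<alpha> \<beta> h \<kappa> (snd y)) =
    (LINT \<omega>|M. iexp (2 * \<kappa> * A \<omega>) * gauss_phase_next q \<alpha> \<beta> h \<kappa> (W s \<omega>))"
  proof -
    have "(\<lambda>y :: real \<times> real \<times> real. iexp (2 * \<kappa> * fst y) * gauss_phase_next q \<alpha> \<beta> h \<kappa> (snd y)) \<in> borel_measurable borel"
      by (intro borel_measurable_continuous_onI continuous_intros continuous_on_compose2[OF continuous_gauss_phase]) auto
    from integral_distr[OF YM this] show ?thesis by (simp add: Y_def)
  qed
  finally show ?thesis .
qed

lemma tanh_artanh_real:
  assumes "\<bar>x :: real\<bar> < 1"
  shows "tanh (artanh x) = x"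
proof -
  have pos: "0 < 1 - x" "0 < 1 + x" using assms by linarith+
  have "exp (2 * artanh x) = (1 + x) / (1 - x)" using pos by (simp add: artanh_def)
  then have "exp (- (2 * artanh x)) = (1 - x) / (1 + x)" by (simp add: exp_minus)
  then have "tanh (artanh x) = (1 - (1 - x) / (1 + x)) / (1 + (1 - x) / (1 + x))"
    by (simp add: tanh_real_altdef)
  also have "1 - (1 - x) / (1 + x) = 2 * x / (1 + x)" using pos by (simp add: field_simps)
  also have "1 + (1 - x) / (1 + x) = 2 / (1 + x)" using pos by (simp add: field_simps)
  finally show ?thesis using pos by simp
qed

text \<open>
  With \<open>tanh \<delta> = \<kappa> / n\<close> the coefficients after \<open>j\<close> steps are \<open>q = \<kappa> tanh (j \<delta>)\<close>, \<open>\<alpha> = \<xi>\<close>,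
  \<open>\<beta> = \<xi> tanh (j \<delta>)\<close>, so the constants telescope.
\<close>

theorem levy_sum_char:
  fixes W :: "real \<Rightarrow> 'a \<Rightarrow> real \<times> real"
  assumes W: "planar_brownian_motion M F W" and n: "n > 0" and \<kappa>: "\<kappa> \<noteq> 0" "\<bar>\<kappa>\<bar> < real n"
  defines "\<delta> \<equiv> artanh (\<kappa> / n)"
  shows "(LINT \<omega>|M. iexp (2 * \<kappa> * levy_sum W n n \<omega> + \<xi> * fst (W 1 \<omega>))) =
    of_real (cosh \<delta> ^ n / cosh (n * \<delta>) * exp (- \<xi>\<^sup>2 * tanh (n * \<delta>) / (2 * \<kappa>)))"
proof -
  note D = planar_brownian_motionD[OF W]
  interpret prob_space M by (rule D(1))
  define h where "h = 1 / real n"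
  have hpos: "h > 0" using n by (simp add: h_def)
  have td: "tanh \<delta> = \<kappa> * h" unfolding \<delta>_def h_def using \<kappa> n by (subst tanh_artanh_real) (auto simp: abs_less_iff)
  define T where "T = (\<lambda>j::nat. tanh (j * \<delta>))"
  \<comment> \<open>\<kappa> and \<delta> have the same sign, so the quadratic coefficient is
    nonnegative for either sign of \<kappa>.\<close>
  have T0: "\<kappa> * T j \<ge> 0" for j
  proof (cases "\<kappa> > 0")
    case True
    then have "tanh \<delta> > 0" using td hpos by simp
    then show ?thesis using True by (simp add: T_def)
  next
    case False
    then have "tanh \<delta> < 0" using td hpos \<kappa> by (simp add: mult_neg_pos)
    then show ?thesis using False by (simp add: T_def mult_nonpos_nonpos mult_nonneg_nonpos)
  qed
  have TS: "T (Suc j) = (T j + \<kappa> * h) / (1 + \<kappa> * T j * h)" for j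
  proof -
    have "real (Suc j) * \<delta> = j * \<delta> + \<delta>" by (simp add: distrib_right)
    then show ?thesis unfolding T_def by (simp add: tanh_add td mult_ac)
  qed
  have one: "1 + \<kappa> * T j * h > 0" for j using T0[of j] hpos by (simp add: add_pos_nonneg)
  \<comment> \<open>By the addition theorem of cosh; over all j < n these denominators multiply to
    cosh (n \<delta>) / cosh \<delta> ^ n.\<close>
  have cS: "1 + \<kappa> * T j * h = cosh (Suc j * \<delta>) / (cosh (j * \<delta>) * cosh \<delta>)" for j
  proof -
    have "1 + \<kappa> * T j * h = 1 + tanh (j * \<delta>) * tanh \<delta>" by (simp add: td T_def mult_ac)
    also have "\<dots> = (cosh (j * \<delta>) * cosh \<delta> + sinh (j * \<delta>) * sinh \<delta>) / (cosh (j * \<delta>) * cosh \<delta>)"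
      by (simp add: tanh_def field_simps)
    also have "\<dots> = cosh (Suc j * \<delta>) / (cosh (j * \<delta>) * cosh \<delta>)"
      unfolding cosh_add[symmetric] by (simp add: distrib_right add.commute)
    finally show ?thesis .
  qed
  \<comment> \<open>The index \<open>j\<close> counts the steps already integrated out, starting
    from time 1 and going backwards.\<close>
  let ?I = "\<lambda>j. LINT \<omega>|M. iexp (2 * \<kappa> * levy_sum W n (n - j) \<omega>) * gauss_phase (\<kappa> * T j) \<xi> (\<xi> * T j) (W (real (n - j) / n) \<omega>)"
  have main: "(LINT \<omega>|M. iexp (2 * \<kappa> * levy_sum W n n \<omega> + \<xi> * fst (W 1 \<omega>))) =
    of_real (cosh \<delta> ^ j / cosh (j * \<delta>) * exp (- \<xi>\<^sup>2 * T j / (2 * \<kappa>))) * ?I j" if "j \<le> n" for j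
    using that
  proof (induction j)
    case 0
    have "iexp (2 * \<kappa> * levy_sum W n n \<omega> + \<xi> * fst (W 1 \<omega>)) = iexp (2 * \<kappa> * levy_sum W n n \<omega>) * gauss_phase 0 \<xi> 0 (W 1 \<omega>)" for \<omega>
      by (simp add: gauss_phase_def case_prod_unfold exp_add[symmetric] distrib_left)
    then show ?case using n by (simp add: T_def)
  next
    case (Suc j)
    define k where "k = n - Suc j"
    have k: "n - j = Suc k" using Suc.prems by (simp add: k_def)
    have st: "0 \<le> real k / n" "real k / n < real (Suc k) / n" using n by (auto simp: divide_strict_right_mono)
    have hh: "real (Suc k) / n - real k / n = h" using n by (simp add: h_def field_simps)
    \<comment> \<open>The parabola has its vertex at y = \<xi> / \<kappa>.\<close>
    have bound: "- (\<kappa> * T j) * y\<^sup>2 / 2 + \<xi> * T j * y \<le> \<xi>\<^sup>2 * T j / (2 * \<kappa>)" for y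
    proof -
      have "\<xi>\<^sup>2 * T j / (2 * \<kappa>) - (- (\<kappa> * T j) * y\<^sup>2 / 2 + \<xi> * T j * y) = \<kappa> * T j * (y - \<xi> / \<kappa>)\<^sup>2 / 2"
        using \<kappa> by (simp add: field_simps power2_eq_square)
      also have "\<dots> \<ge> 0" using T0[of j] by simp
      finally show ?thesis by simp
    qed
    have L: "levy_sum W n (Suc k) \<omega> = levy_sum W n k \<omega> + (fst (W (real k / n) \<omega>) * (snd (W (real (Suc k) / n) \<omega>) - snd (W (real k / n) \<omega>)) - snd (W (real k / n) \<omega>) * (fst (W (real (Suc k) / n) \<omega>) - fst (W (real k / n) \<omega>))) / 2" for \<omega>
      by (simp add: levy_sum_def)
    have "?I j = of_real (exp (- h * (\<xi>\<^sup>2 - (\<xi> * T j)\<^sup>2) / (2 * (1 + \<kappa> * T j * h))) / (1 + \<kappa> * T j * h)) *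
      (LINT \<omega>|M. iexp (2 * \<kappa> * levy_sum W n k \<omega>) * gauss_phase ((\<kappa> * T j + h * \<kappa>\<^sup>2) / (1 + \<kappa> * T j * h)) ((\<xi> + h * \<kappa> * (\<xi> * T j)) / (1 + \<kappa> * T j * h)) ((\<xi> * T j + h * \<kappa> * \<xi>) / (1 + \<kappa> * T j * h)) (W (real k / n) \<omega>))"
      unfolding k L
      by (rule gauss_phase_expectation_step[OF W st levy_sum_measurable[OF W n] T0 bound, unfolded hh])
    also have "(\<kappa> * T j + h * \<kappa>\<^sup>2) / (1 + \<kappa> * T j * h) = \<kappa> * T (Suc j)"
      unfolding TS by (simp add: power2_eq_square distrib_left mult_ac)
    also have "(\<xi> + h * \<kappa> * (\<xi> * T j)) / (1 + \<kappa> * T j * h) = \<xi>"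
      using one[of j] by (simp add: divide_eq_eq distrib_left mult_ac)
    also have "(\<xi> * T j + h * \<kappa> * \<xi>) / (1 + \<kappa> * T j * h) = \<xi> * T (Suc j)"
      unfolding TS by (simp add: distrib_left mult_ac)
    \<comment> \<open>Written as a difference of consecutive values, so that the exponentials
      telescope too.\<close>
    also have "- h * (\<xi>\<^sup>2 - (\<xi> * T j)\<^sup>2) / (2 * (1 + \<kappa> * T j * h)) = - \<xi>\<^sup>2 * T (Suc j) / (2 * \<kappa>) - (- \<xi>\<^sup>2 * T j / (2 * \<kappa>))"
    proof -
      have "T (Suc j) - T j = \<kappa> * h * (1 - (T j)\<^sup>2) / (1 + \<kappa> * T j * h)"
        unfolding TS using one[of j] by (simp add: field_simps power2_eq_square)
      then have "- \<xi>\<^sup>2 * T (Suc j) / (2 * \<kappa>) - (- \<xi>\<^sup>2 * T j / (2 * \<kappa>)) = - \<xi>\<^sup>2 * (\<kappa> * h * (1 - (T j)\<^sup>2) / (1 + \<kappa> * T j * h)) / (2 * \<kappa>)"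
        by (simp only: diff_divide_distrib[symmetric] right_diff_distrib[symmetric] minus_mult_left[symmetric] minus_diff_minus)
      also have "\<dots> = - h * (\<xi>\<^sup>2 - (\<xi> * T j)\<^sup>2) / (2 * (1 + \<kappa> * T j * h))"
      proof -
        have "- \<xi>\<^sup>2 * (\<kappa> * h * (1 - a\<^sup>2) / d) / (2 * \<kappa>) = - h * (\<xi>\<^sup>2 - (\<xi> * a)\<^sup>2) / (2 * d)" if "d > 0" for a d :: real
          using \<kappa> that by (simp add: field_simps power2_eq_square)
        from this[OF one[of j]] show ?thesis .
      qed
      finally show ?thesis by simp
    qed
    finally have step: "?I j = of_real (exp (- \<xi>\<^sup>2 * T (Suc j) / (2 * \<kappa>) - (- \<xi>\<^sup>2 * T j / (2 * \<kappa>))) / (1 + \<kappa> * T j * h)) * ?I (Suc j)"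
      unfolding k_def .
    have c: "cosh \<delta> ^ j / cosh (j * \<delta>) * exp (- \<xi>\<^sup>2 * T j / (2 * \<kappa>)) * (exp (- \<xi>\<^sup>2 * T (Suc j) / (2 * \<kappa>) - (- \<xi>\<^sup>2 * T j / (2 * \<kappa>))) / (1 + \<kappa> * T j * h)) =
      cosh \<delta> ^ Suc j / cosh (Suc j * \<delta>) * exp (- \<xi>\<^sup>2 * T (Suc j) / (2 * \<kappa>))"
      unfolding cS exp_diff by (simp add: field_simps)
    have "(LINT \<omega>|M. iexp (2 * \<kappa> * levy_sum W n n \<omega> + \<xi> * fst (W 1 \<omega>))) = of_real (cosh \<delta> ^ j / cosh (j * \<delta>) * exp (- \<xi>\<^sup>2 * T j / (2 * \<kappa>))) * ?I j"
      using Suc by simp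
    also have "\<dots> = of_real (cosh \<delta> ^ Suc j / cosh (Suc j * \<delta>) * exp (- \<xi>\<^sup>2 * T (Suc j) / (2 * \<kappa>))) * ?I (Suc j)"
      by (subst step, subst c[symmetric]) (simp only: of_real_mult mult.assoc)
    finally show ?case .
  qed
  \<comment> \<open>After \<open>n\<close> steps the area sum is empty and the motion is at its
    start 0, where \<open>gauss_phase\<close> equals 1.\<close>
  have "?I n = (LINT \<omega>|M. 1)"
  proof (rule integral_cong_AE)
    have "(\<lambda>\<omega>. gauss_phase (\<kappa> * T n) \<xi> (\<xi> * T n) (W 0 \<omega>)) \<in> borel_measurable M"
      by (rule measurable_compose[OF measurable_from_subalg[OF D(3) D(4)] borel_measurable_continuous_onI[OF continuous_gauss_phase]]) simp_all
    then show "(\<lambda>\<omega>. iexp (2 * \<kappa> * levy_sum W n (n - n) \<omega>) * gauss_phase (\<kappa> * T n) \<xi> (\<xi> * T n) (W (real (n - n) / n) \<omega>)) \<in> borel_measurable M"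
      by (simp add: levy_sum_def)
    show "AE \<omega> in M. iexp (2 * \<kappa> * levy_sum W n (n - n) \<omega>) * gauss_phase (\<kappa> * T n) \<xi> (\<xi> * T n) (W (real (n - n) / n) \<omega>) = 1"
      using D(5) by eventually_elim (simp add: levy_sum_def gauss_phase_def)
  qed simp
  then have "?I n = 1" by (simp add: prob_space)
  then show ?thesis using main[of n] by (simp add: T_def)
qed

text \<open>artanh (\<kappa> / n) is \<kappa> / n up to O(n^(-3)), so n times it tends to \<kappa>,
  while its cosh is 1 + O(n^(-2)) and has n-th power tending to 1.\<close>

lemma levy_char_limit:
  fixes \<kappa> :: real
  assumes "\<kappa> \<noteq> 0"
  shows "(\<lambda>n. cosh (artanh (\<kappa> / Suc n)) ^ Suc n / cosh (real (Suc n) * artanh (\<kappa> / Suc n)) * exp (- \<xi>\<^sup>2 * tanh (real (Suc n) * artanh (\<kappa> / Suc n)) / (2 * \<kappa>)))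
    \<longlonglongrightarrow> 1 / cosh \<kappa> * exp (- \<xi>\<^sup>2 * tanh \<kappa> / (2 * \<kappa>))"
proof -
  have a: "(\<lambda>n. real (Suc n) * artanh (\<kappa> / Suc n)) \<longlonglongrightarrow> \<kappa>"
    unfolding artanh_def by real_asymp
  have b: "(\<lambda>n. cosh (artanh (\<kappa> / Suc n)) ^ Suc n) \<longlonglongrightarrow> 1"
    unfolding artanh_def cosh_field_def by real_asymp
  show ?thesis using a b assms by (intro tendsto_intros) auto
qed


lemma (in prob_space) conv_prob_cmult:
  assumes "conv_prob U V"
  shows "conv_prob (\<lambda>n \<omega>. c * U n \<omega>) (\<lambda>\<omega>. c * V \<omega>)"
proof (cases "c = 0")
  case True
  then show ?thesis by (simp add: conv_prob_def)
next
  case False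
  show ?thesis
    unfolding conv_prob_def
  proof (intro conjI allI impI)
    fix \<delta> :: real assume "\<delta> > 0"
    have "\<delta> < \<bar>c * U n \<omega> - c * V \<omega>\<bar> \<longleftrightarrow> \<delta> / \<bar>c\<bar> < \<bar>U n \<omega> - V \<omega>\<bar>" for n \<omega>
      using False by (simp add: right_diff_distrib[symmetric] abs_mult divide_less_eq mult.commute)
    then show "(\<lambda>n. prob {\<omega> \<in> space M. \<bar>c * U n \<omega> - c * V \<omega>\<bar> > \<delta>}) \<longlonglongrightarrow> 0"
      using conv_probD[OF assms, of "\<delta> / \<bar>c\<bar>"] False \<open>\<delta> > 0\<close> by simp
  qed (use assms in \<open>auto simp: conv_prob_def intro!: borel_measurable_times\<close>)
qed

text \<open>Inserting both coordinate formulas, the discretised s X + t Z becomes t \<epsilon> z0 +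
  2 \<kappa> A + \<xi> W, with A the discrete area and W the first coordinate at time 1; this is the
  origin of \<kappa> and \<xi>. The exact finite formula then passes to the limit by convergence in
  probability.\<close>

theorem heisenberg_char:
  fixes X :: "real \<Rightarrow> 'a \<Rightarrow> real \<times> real \<times> real" and s t \<epsilon> y0 z0 :: real
  assumes W: "planar_brownian_motion M F W" and X: "dilated_heisenberg_bm M F W y0 z0 \<epsilon> X"
    and \<epsilon>: "\<epsilon> > 0" and t: "t \<noteq> 0"
  defines "\<kappa> \<equiv> \<epsilon>\<^sup>2 * t / 2" and "\<xi> \<equiv> \<epsilon> * s - \<epsilon>\<^sup>2 * y0 * t / 2"
  shows "(LINT \<omega>|M. iexp (s * fst (X 1 \<omega>) + t * snd (snd (X 1 \<omega>)))) =
    iexp (t * \<epsilon> * z0) * of_real (1 / cosh \<kappa> * exp (- \<xi>\<^sup>2 * tanh \<kappa> / (2 * \<kappa>)))"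
proof -
  note D = planar_brownian_motionD[OF W]
  interpret prob_space M by (rule D(1))
  have \<kappa>: "\<kappa> \<noteq> 0" using \<epsilon> t by (simp add: \<kappa>_def)
  have XM: "(\<lambda>\<omega>. fst (X 1 \<omega>)) \<in> borel_measurable M"
  proof -
    have "X 1 \<in> borel_measurable (F 1)" using X by (simp add: dilated_heisenberg_bm_def sde_solution_def)
    from measurable_compose[OF measurable_from_subalg[OF D(3) this] measurable_fst_borel] show ?thesis by simp
  qed
  let ?U = "\<lambda>n \<omega>. s * fst (X 1 \<omega>) + t * (\<epsilon> * z0 - \<epsilon>\<^sup>2 * y0 / 2 * fst (W 1 \<omega>) + \<epsilon>\<^sup>2 * levy_sum W (Suc n) (Suc n) \<omega>)"
  have cp: "conv_prob ?U (\<lambda>\<omega>. s * fst (X 1 \<omega>) + t * snd (snd (X 1 \<omega>)))"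
    by (intro conv_prob_add conv_prob_const conv_prob_cmult heisenberg_vertical[OF W X] borel_measurable_times borel_measurable_const XM)
  have "eventually (\<lambda>n. expectation (\<lambda>\<omega>. iexp (?U n \<omega>)) = iexp (t * \<epsilon> * z0) * of_real (cosh (artanh (\<kappa> / Suc n)) ^ Suc n / cosh (real (Suc n) * artanh (\<kappa> / Suc n)) * exp (- \<xi>\<^sup>2 * tanh (real (Suc n) * artanh (\<kappa> / Suc n)) / (2 * \<kappa>)))) sequentially"
  proof -
    \<comment> \<open>The finite formula contains artanh (\<kappa> / n) and thus holds only for n
      beyond the modulus of \<kappa>.\<close>
    obtain N where N: "\<bar>\<kappa>\<bar> < real N" using reals_Archimedean2 by blast
    have "expectation (\<lambda>\<omega>. iexp (?U n \<omega>)) = iexp (t * \<epsilon> * z0) * of_real (cosh (artanh (\<kappa> / Suc n)) ^ Suc n / cosh (real (Suc n) * artanh (\<kappa> / Suc n)) * exp (- \<xi>\<^sup>2 * tanh (real (Suc n) * artanh (\<kappa> / Suc n)) / (2 * \<kappa>)))"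
      if n: "n \<ge> N" for n
    proof -
      have Um: "?U n \<in> borel_measurable M" using cp by (simp add: conv_prob_def)
      have m2: "levy_sum W (Suc n) (Suc n) \<in> borel_measurable M"
        using measurable_from_subalg[OF D(3) levy_sum_measurable[OF W, of "Suc n" "Suc n"]] by simp
      have m3: "(\<lambda>\<omega>. fst (W 1 \<omega>)) \<in> borel_measurable M"
        using measurable_compose[OF measurable_from_subalg[OF D(3)[of 1] D(4)[of 1]] measurable_fst_borel] by simp
      have "expectation (\<lambda>\<omega>. iexp (?U n \<omega>)) = expectation (\<lambda>\<omega>. iexp (t * \<epsilon> * z0) * iexp (2 * \<kappa> * levy_sum W (Suc n) (Suc n) \<omega> + \<xi> * fst (W 1 \<omega>)))"
      proof (rule integral_cong_AE)
        show "AE \<omega> in M. iexp (?U n \<omega>) = iexp (t * \<epsilon> * z0) * iexp (2 * \<kappa> * levy_sum W (Suc n) (Suc n) \<omega> + \<xi> * fst (W 1 \<omega>))"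
          using heisenberg_horizontal[OF W X zero_le_one]
        proof eventually_elim
          case (elim \<omega>)
          have "?U n \<omega> = t * \<epsilon> * z0 + (2 * \<kappa> * levy_sum W (Suc n) (Suc n) \<omega> + \<xi> * fst (W 1 \<omega>))"
            unfolding \<kappa>_def \<xi>_def using elim by (simp add: algebra_simps)
          then show ?case by (simp only: exp_add[symmetric] of_real_add distrib_left)
        qed
        show "(\<lambda>\<omega>. iexp (?U n \<omega>)) \<in> borel_measurable M" using Um by measurable
        show "(\<lambda>\<omega>. iexp (t * \<epsilon> * z0) * iexp (2 * \<kappa> * levy_sum W (Suc n) (Suc n) \<omega> + \<xi> * fst (W 1 \<omega>))) \<in> borel_measurable M"
          using m2 m3 by measurable
      qed
      also have "\<dots> = iexp (t * \<epsilon> * z0) * expectation (\<lambda>\<omega>. iexp (2 * \<kappa> * levy_sum W (Suc n) (Suc n) \<omega> + \<xi> * fst (W 1 \<omega>)))"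
        by (rule integral_mult_right_zero)
      also have "\<bar>\<kappa>\<bar> < real (Suc n)" using N n by simp
      note levy_sum_char[OF W zero_less_Suc \<kappa> this]
      finally show ?thesis .
    qed
    then show ?thesis unfolding eventually_sequentially by blast
  qed
  then have "(\<lambda>n. expectation (\<lambda>\<omega>. iexp (?U n \<omega>))) \<longlonglongrightarrow> iexp (t * \<epsilon> * z0) * of_real (1 / cosh \<kappa> * exp (- \<xi>\<^sup>2 * tanh \<kappa> / (2 * \<kappa>)))"
    by (rule tendsto_cong[THEN iffD2]) (intro tendsto_mult tendsto_const tendsto_of_real levy_char_limit \<kappa>)
  with conv_prob_char[OF cp] show ?thesis by (rule LIMSEQ_unique)
qed

subsection \<open>Fourier inversion in the plane\<close>

definition planar_gauss :: "real \<Rightarrow> real \<times> real \<Rightarrow> real" where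
  "planar_gauss \<sigma> p = normal_density 0 \<sigma> (fst p) * normal_density 0 \<sigma> (snd p)"

lemma planar_gauss_nonneg: "0 \<le> planar_gauss \<sigma> p"
  by (simp add: planar_gauss_def)

lemma planar_gauss_measurable [measurable]: "planar_gauss \<sigma> \<in> borel_measurable borel"
  unfolding planar_gauss_def[abs_def]
  by (intro borel_measurable_times measurable_compose[OF measurable_fst_borel borel_measurable_normal_density]
    measurable_compose[OF measurable_snd_borel borel_measurable_normal_density])

lemma planar_gauss_integral:
  assumes "\<sigma> > 0"
  shows "integrable lborel (planar_gauss \<sigma>)" "(LINT p|lborel. planar_gauss \<sigma> p) = 1"
proof -
  have i: "integrable lborel (\<lambda>x. complex_of_real (normal_density 0 \<sigma> x))"
    using assms by simp
  have eq: "(\<lambda>p. complex_of_real (planar_gauss \<sigma> p)) = (\<lambda>(u, v). complex_of_real (normal_density 0 \<sigma> u) * complex_of_real (normal_density 0 \<sigma> v))"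
    by (auto simp: planar_gauss_def)
  have c: "integrable lborel (\<lambda>p. complex_of_real (planar_gauss \<sigma> p))" 
    unfolding eq by (rule lborel_integral_product(1)[OF i i])
  then show I: "integrable lborel (planar_gauss \<sigma>)"
    using integrable_Re[OF c] by simp
  have "complex_of_real (LINT p|lborel. planar_gauss \<sigma> p) = (LINT p|lborel. complex_of_real (planar_gauss \<sigma> p))"
    by simp
  also have "\<dots> = complex_of_real (LINT x|lborel. normal_density 0 \<sigma> x) * complex_of_real (LINT x|lborel. normal_density 0 \<sigma> x)"
    unfolding eq lborel_integral_product(2)[OF i i] by simp
  finally show "(LINT p|lborel. planar_gauss \<sigma> p) = 1" using assms by simp
qed

text \<open>Up to normalisation the weight is the normal density with deviation 1 / \<sigma>, so
  this is the complex Gaussian integral at the imaginary argument - \<i> x.\<close>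

lemma normal_density_fourier:
  assumes s: "\<sigma> > 0"
  shows "integrable lborel (\<lambda>\<xi>. exp (of_real (- \<sigma>\<^sup>2 * \<xi>\<^sup>2 / 2)) * iexp (- (\<xi> * x)))"
    "(LINT \<xi>|lborel. exp (of_real (- \<sigma>\<^sup>2 * \<xi>\<^sup>2 / 2)) * iexp (- (\<xi> * x))) = of_real (2 * pi * normal_density 0 \<sigma> x)"
proof -
  let ?c = "- (\<i> * of_real x)"
  have eq: "exp (of_real (- \<sigma>\<^sup>2 * \<xi>\<^sup>2 / 2)) * iexp (- (\<xi> * x)) =
    of_real (sqrt (2 * pi) / \<sigma>) * (normal_density 0 (1 / \<sigma>) \<xi> *\<^sub>R exp (?c * of_real \<xi>))" for \<xi>
  proof -
    have "normal_density 0 (1 / \<sigma>) \<xi> = \<sigma> / sqrt (2 * pi) * exp (- \<sigma>\<^sup>2 * \<xi>\<^sup>2 / 2)"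
      using s by (simp add: normal_density_def power_divide real_sqrt_divide real_sqrt_mult mult.commute)
    then have "sqrt (2 * pi) / \<sigma> * normal_density 0 (1 / \<sigma>) \<xi> = exp (- \<sigma>\<^sup>2 * \<xi>\<^sup>2 / 2)"
      using s by simp
    then have "complex_of_real (sqrt (2 * pi) / \<sigma>) * of_real (normal_density 0 (1 / \<sigma>) \<xi>) = of_real (exp (- \<sigma>\<^sup>2 * \<xi>\<^sup>2 / 2))"
      by (simp only: of_real_mult[symmetric])
    moreover have "iexp (- (\<xi> * x)) = exp (?c * of_real \<xi>)" by (simp add: mult_ac)
    ultimately show ?thesis by (simp only: exp_of_real scaleR_conv_of_real mult.assoc[symmetric])
  qed
  have s': "1 / \<sigma> > 0" using s by simp
  show "integrable lborel (\<lambda>\<xi>. exp (of_real (- \<sigma>\<^sup>2 * \<xi>\<^sup>2 / 2)) * iexp (- (\<xi> * x)))"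
    unfolding eq by (intro integrable_mult_right normal_density_cexp_linear s')
  have "(LINT \<xi>|lborel. exp (of_real (- \<sigma>\<^sup>2 * \<xi>\<^sup>2 / 2)) * iexp (- (\<xi> * x))) = of_real (sqrt (2 * pi) / \<sigma>) * exp (?c\<^sup>2 * of_real ((1 / \<sigma>)\<^sup>2) / 2)"
    unfolding eq integral_mult_right_zero normal_density_cexp_linear(2)[OF s'] ..
  also have "?c\<^sup>2 * of_real ((1 / \<sigma>)\<^sup>2) / 2 = of_real (- x\<^sup>2 / (2 * \<sigma>\<^sup>2))"
    by (simp add: power_mult_distrib power_divide)
  also have "of_real (sqrt (2 * pi) / \<sigma>) * exp (of_real (- x\<^sup>2 / (2 * \<sigma>\<^sup>2))) = complex_of_real (2 * pi * normal_density 0 \<sigma> x)"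
  proof -
    define r where "r = sqrt (2 * pi)"
    have r: "r * r = 2 * pi" "r > 0" by (simp_all add: r_def)
    have nd: "normal_density 0 \<sigma> x = 1 / (r * \<sigma>) * exp (- x\<^sup>2 / (2 * \<sigma>\<^sup>2))"
      using s by (simp add: normal_density_def r_def real_sqrt_mult)
    have "2 * pi * normal_density 0 \<sigma> x = r / \<sigma> * exp (- x\<^sup>2 / (2 * \<sigma>\<^sup>2))"
      unfolding nd r(1)[symmetric] using r(2) s by (simp add: field_simps)
    then show ?thesis unfolding r_def by (simp only: exp_of_real of_real_mult[symmetric])
  qed
  finally show "(LINT \<xi>|lborel. exp (of_real (- \<sigma>\<^sup>2 * \<xi>\<^sup>2 / 2)) * iexp (- (\<xi> * x))) = of_real (2 * pi * normal_density 0 \<sigma> x)" .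
qed

text \<open>The characteristic function of the law with density
  \<open>planar_gauss \<sigma>\<close>.\<close>

definition gauss_weight :: "real \<Rightarrow> real \<times> real \<Rightarrow> real" where
  "gauss_weight \<sigma> p = exp (- \<sigma>\<^sup>2 * (fst p)\<^sup>2 / 2) * exp (- \<sigma>\<^sup>2 * (snd p)\<^sup>2 / 2)"

abbreviation fourier_phase :: "real \<times> real \<Rightarrow> real \<times> real \<Rightarrow> complex" where
  "fourier_phase p u \<equiv> iexp (fst p * fst u + snd p * snd u)"

lemma gauss_weight_measurable [measurable]: "gauss_weight \<sigma> \<in> borel_measurable borel"
  unfolding gauss_weight_def[abs_def] by (intro borel_measurable_continuous_onI continuous_intros) auto

lemma planar_gauss_fourier:
  assumes s: "\<sigma> > 0"
  shows "integrable lborel (gauss_weight \<sigma>)"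
    "(LINT p|lborel. of_real (gauss_weight \<sigma> p) * fourier_phase p (- u)) = of_real ((2 * pi)\<^sup>2 * planar_gauss \<sigma> u)"
proof -
  have eq: "(\<lambda>p. of_real (gauss_weight \<sigma> p) * fourier_phase p (- u)) =
    (\<lambda>(x, y). (exp (of_real (- \<sigma>\<^sup>2 * x\<^sup>2 / 2)) * iexp (- (x * fst u))) * (exp (of_real (- \<sigma>\<^sup>2 * y\<^sup>2 / 2)) * iexp (- (y * snd u))))" for u
    by (rule ext) (simp add: gauss_weight_def exp_of_real[symmetric] exp_add[symmetric] case_prod_unfold algebra_simps)
  have "integrable lborel (\<lambda>p. of_real (gauss_weight \<sigma> p) * fourier_phase p (- 0))"
    unfolding eq by (intro lborel_integral_product(1) normal_density_fourier s)
  then have "integrable lborel (\<lambda>p. complex_of_real (gauss_weight \<sigma> p))" by simp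
  from integrable_Re[OF this] show "integrable lborel (gauss_weight \<sigma>)" by simp
  show "(LINT p|lborel. of_real (gauss_weight \<sigma> p) * fourier_phase p (- u)) = of_real ((2 * pi)\<^sup>2 * planar_gauss \<sigma> u)"
    unfolding eq lborel_integral_product(2)[OF normal_density_fourier(1)[OF s] normal_density_fourier(1)[OF s]] normal_density_fourier(2)[OF s] of_real_mult[symmetric]
    by (rule arg_cong[where f=of_real]) (simp add: planar_gauss_def power2_eq_square)
qed

text \<open>For an integrable characteristic function the integral is already real, by symmetry
  under conjugation; \<open>Re\<close> only adjusts the type.\<close>

definition fourier_inverse :: "(real \<times> real \<Rightarrow> complex) \<Rightarrow> real \<times> real \<Rightarrow> real" where
  "fourier_inverse f u = Re (LINT p|lborel. fourier_phase p (- u) * f p) / (2 * pi)\<^sup>2"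

context prob_space
begin

context
  fixes V :: "'a \<Rightarrow> real \<times> real" and \<phi> :: "real \<times> real \<Rightarrow> complex"
  assumes V [measurable]: "V \<in> borel_measurable M"
    and \<phi>: "\<And>p. \<phi> p = expectation (\<lambda>\<omega>. fourier_phase p (V \<omega>))"
    and \<phi>_int: "integrable lborel \<phi>"
begin

lemma V_components [measurable]:
  "(\<lambda>\<omega>. fst (V \<omega>)) \<in> borel_measurable M" "(\<lambda>\<omega>. snd (V \<omega>)) \<in> borel_measurable M"
  using measurable_compose[OF V measurable_fst_borel] measurable_compose[OF V measurable_snd_borel] by auto

text \<open>
  Adding a small independent Gaussian vector to \<open>V\<close> makes the inversion formula an instance of
  Fubini's theorem; the general case follows by letting the variance tend to \<open>0\<close>.
\<close>

lemma smoothed_density: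
  assumes s: "\<sigma> > 0"
  shows "of_real ((2 * pi)\<^sup>2 * expectation (\<lambda>\<omega>. planar_gauss \<sigma> (u - V \<omega>))) =
    (LINT p|lborel. of_real (gauss_weight \<sigma> p) * (fourier_phase p (- u) * \<phi> p))"
proof -
  interpret P: pair_sigma_finite M "lborel :: (real \<times> real) measure" ..
  let ?f = "\<lambda>(\<omega>, p). of_real (gauss_weight \<sigma> p) * fourier_phase p (- (u - V \<omega>))"
  have fs: "fst \<in> borel_measurable (lborel :: (real \<times> real) measure)" "snd \<in> borel_measurable (lborel :: (real \<times> real) measure)"
    using measurable_fst_borel measurable_snd_borel by auto
  have m: "?f \<in> borel_measurable (M \<Otimes>\<^sub>M lborel)"
    using measurable_compose[OF measurable_snd[of M lborel] fs(1)] measurable_compose[OF measurable_snd[of M lborel] fs(2)]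
      measurable_compose[OF measurable_fst[of M "lborel :: (real \<times> real) measure"] V_components(1)] measurable_compose[OF measurable_fst[of M "lborel :: (real \<times> real) measure"] V_components(2)]
    by (simp add: case_prod_unfold)
  have i: "integrable (M \<Otimes>\<^sub>M lborel) ?f"
  proof (rule P.Fubini_integrable[OF m])
    show "integrable M (\<lambda>\<omega>. LINT p|lborel. norm (case (\<omega>, p) of (\<omega>, p) \<Rightarrow> of_real (gauss_weight \<sigma> p) * fourier_phase p (- (u - V \<omega>))))"
      by (simp add: norm_mult)
    have "integrable lborel (\<lambda>p. of_real (gauss_weight \<sigma> p) * fourier_phase p (- (u - V \<omega>)))" for \<omega>
    proof (rule Bochner_Integration.integrable_bound[OF planar_gauss_fourier(1)[OF s]])
      show "(\<lambda>p. of_real (gauss_weight \<sigma> p) * fourier_phase p (- (u - V \<omega>))) \<in> borel_measurable lborel"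
        using fs by simp
    qed (simp add: norm_mult)
    then show "AE \<omega> in M. integrable lborel (\<lambda>p. case (\<omega>, p) of (\<omega>, p) \<Rightarrow> of_real (gauss_weight \<sigma> p) * fourier_phase p (- (u - V \<omega>)))"
      by simp
  qed
  have "of_real ((2 * pi)\<^sup>2 * expectation (\<lambda>\<omega>. planar_gauss \<sigma> (u - V \<omega>))) = expectation (\<lambda>\<omega>. complex_of_real ((2 * pi)\<^sup>2 * planar_gauss \<sigma> (u - V \<omega>)))"
    by simp
  also have "\<dots> = (LINT \<omega>|M. LINT p|lborel. of_real (gauss_weight \<sigma> p) * fourier_phase p (- (u - V \<omega>)))"
    unfolding planar_gauss_fourier(2)[OF s] ..
  also have "\<dots> = (LINT p|lborel. LINT \<omega>|M. of_real (gauss_weight \<sigma> p) * fourier_phase p (- (u - V \<omega>)))"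
    using P.Fubini_integral[of "\<lambda>\<omega> p. of_real (gauss_weight \<sigma> p) * fourier_phase p (- (u - V \<omega>))"] i by simp
  also have "\<dots> = (LINT p|lborel. of_real (gauss_weight \<sigma> p) * (fourier_phase p (- u) * \<phi> p))"
  proof (rule Bochner_Integration.integral_cong[OF refl])
    fix p :: "real \<times> real"
    have "of_real (gauss_weight \<sigma> p) * fourier_phase p (- (u - V \<omega>)) = of_real (gauss_weight \<sigma> p) * fourier_phase p (- u) * fourier_phase p (V \<omega>)" for \<omega>
      by (simp add: exp_add[symmetric] algebra_simps)
    then show "(LINT \<omega>|M. of_real (gauss_weight \<sigma> p) * fourier_phase p (- (u - V \<omega>))) = of_real (gauss_weight \<sigma> p) * (fourier_phase p (- u) * \<phi> p)"
      unfolding \<phi> by (simp only: integral_mult_right_zero mult.assoc)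
  qed
  finally show ?thesis .
qed

lemma fourier_phase_meas [measurable]: "(\<lambda>p. fourier_phase p u) \<in> borel_measurable borel"
  by (intro borel_measurable_continuous_onI continuous_intros)

lemma \<phi>_measurable [measurable]: "\<phi> \<in> borel_measurable borel"
  using \<phi>_int by auto

lemma phase_mult_measurable: "(\<lambda>p. fourier_phase p u * \<phi> p) \<in> borel_measurable lborel"
  using borel_measurable_times[OF fourier_phase_meas \<phi>_measurable] by (simp only: measurable_lborel2)

lemma fourier_inverse_continuous: "continuous_on UNIV (fourier_inverse \<phi>)"
proof -
  have "isCont (\<lambda>u. LINT p|lborel. fourier_phase p (- u) * \<phi> p) u" for u
    unfolding continuous_at_sequentially comp_def
  proof (intro allI impI)
    fix x :: "nat \<Rightarrow> real \<times> real" assume x: "x \<longlonglongrightarrow> u"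
    show "(\<lambda>n. LINT p|lborel. fourier_phase p (- x n) * \<phi> p) \<longlonglongrightarrow> (LINT p|lborel. fourier_phase p (- u) * \<phi> p)"
    proof (rule integral_dominated_convergence[where w="\<lambda>p. norm (\<phi> p)"])
      show "AE p in lborel. (\<lambda>n. fourier_phase p (- x n) * \<phi> p) \<longlonglongrightarrow> fourier_phase p (- u) * \<phi> p"
        by (intro AE_I2 tendsto_intros x)
      show "integrable lborel (\<lambda>p. norm (\<phi> p))" using \<phi>_int by simp
      show "AE p in lborel. norm (fourier_phase p (- x n) * \<phi> p) \<le> norm (\<phi> p)" for n by (simp add: norm_mult)
    qed (rule phase_mult_measurable)+
  qed
  then show ?thesis
    unfolding fourier_inverse_def[abs_def] by (intro continuous_intros continuous_at_imp_continuous_on) auto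
qed

lemma smoothed_density_tendsto:
  "(\<lambda>n. expectation (\<lambda>\<omega>. planar_gauss (1 / Suc n) (u - V \<omega>))) \<longlonglongrightarrow> (fourier_inverse \<phi>) u"
proof -
  have "(\<lambda>n. LINT p|lborel. of_real (gauss_weight (1 / Suc n) p) * (fourier_phase p (- u) * \<phi> p)) \<longlonglongrightarrow> (LINT p|lborel. fourier_phase p (- u) * \<phi> p)"
  proof (rule integral_dominated_convergence[where w="\<lambda>p. norm (\<phi> p)"])
    show "AE p in lborel. (\<lambda>n. of_real (gauss_weight (1 / Suc n) p) * (fourier_phase p (- u) * \<phi> p)) \<longlonglongrightarrow> fourier_phase p (- u) * \<phi> p"
    proof (rule AE_I2)
      fix p
      have "(\<lambda>n. gauss_weight (1 / Suc n) p) \<longlonglongrightarrow> 1" unfolding gauss_weight_def by real_asymp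
      from tendsto_mult[OF tendsto_of_real[OF this] tendsto_const, of "fourier_phase p (- u) * \<phi> p"]
      show "(\<lambda>n. of_real (gauss_weight (1 / Suc n) p) * (fourier_phase p (- u) * \<phi> p)) \<longlonglongrightarrow> fourier_phase p (- u) * \<phi> p"
        by simp
    qed
    show "AE p in lborel. norm (of_real (gauss_weight (1 / Suc n) p) * (fourier_phase p (- u) * \<phi> p)) \<le> norm (\<phi> p)" for n
    proof (rule AE_I2)
      fix p
      have "\<bar>gauss_weight (1 / Suc n) p\<bar> \<le> 1" by (simp add: gauss_weight_def abs_mult mult_le_one)
      then show "norm (of_real (gauss_weight (1 / Suc n) p) * (fourier_phase p (- u) * \<phi> p)) \<le> norm (\<phi> p)"
        using mult_right_mono[of "\<bar>gauss_weight (1 / Suc n) p\<bar>" 1 "norm (\<phi> p)"] by (simp add: norm_mult)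
    qed
    show "integrable lborel (\<lambda>p. norm (\<phi> p))" using \<phi>_int by simp
    show "(\<lambda>p. of_real (gauss_weight (1 / Suc n) p) * (fourier_phase p (- u) * \<phi> p)) \<in> borel_measurable lborel" for n
      by (rule borel_measurable_times[OF _ phase_mult_measurable]) simp
  qed (rule phase_mult_measurable)
  then have "(\<lambda>n. complex_of_real ((2 * pi)\<^sup>2 * expectation (\<lambda>\<omega>. planar_gauss (1 / Suc n) (u - V \<omega>)))) \<longlonglongrightarrow> (LINT p|lborel. fourier_phase p (- u) * \<phi> p)"
    by (subst smoothed_density) simp_all
  from tendsto_Re[OF this] have "(\<lambda>n. (2 * pi)\<^sup>2 * expectation (\<lambda>\<omega>. planar_gauss (1 / Suc n) (u - V \<omega>))) \<longlonglongrightarrow> Re (LINT p|lborel. fourier_phase p (- u) * \<phi> p)"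
    by (simp only: Re_complex_of_real)
  from tendsto_divide[OF this tendsto_const, of "(2 * pi)\<^sup>2"] show ?thesis
    by (simp add: fourier_inverse_def)
qed

lemma fourier_inverse_nonneg: "0 \<le> (fourier_inverse \<phi>) u"
  by (rule LIMSEQ_le_const[OF smoothed_density_tendsto]) (auto intro!: Bochner_Integration.integral_nonneg planar_gauss_nonneg)

text \<open>A bound for all smoothed densities at once, independent of \<sigma>; it dominates in the
  passage to the limit.\<close>

definition inversion_bound :: real where "inversion_bound = (LINT p|lborel. norm (\<phi> p)) / (2 * pi)\<^sup>2"

lemma smoothed_density_le:
  assumes "\<sigma> > 0"
  shows "expectation (\<lambda>\<omega>. planar_gauss \<sigma> (u - V \<omega>)) \<le> inversion_bound"
proof -
  have "(2 * pi)\<^sup>2 * expectation (\<lambda>\<omega>. planar_gauss \<sigma> (u - V \<omega>)) = norm (complex_of_real ((2 * pi)\<^sup>2 * expectation (\<lambda>\<omega>. planar_gauss \<sigma> (u - V \<omega>))))"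
    unfolding norm_of_real by (simp add: Bochner_Integration.integral_nonneg planar_gauss_nonneg)
  also have "\<dots> \<le> (LINT p|lborel. norm (of_real (gauss_weight \<sigma> p) * (fourier_phase p (- u) * \<phi> p)))"
    unfolding smoothed_density[OF assms] by (rule integral_norm_bound)
  also have "\<dots> \<le> (LINT p|lborel. norm (\<phi> p))"
  proof (rule integral_mono_AE')
    show "AE p in lborel. norm (of_real (gauss_weight \<sigma> p) * (fourier_phase p (- u) * \<phi> p)) \<le> norm (\<phi> p)"
    proof (rule AE_I2)
      fix p
      have "\<bar>gauss_weight \<sigma> p\<bar> \<le> 1" by (simp add: gauss_weight_def abs_mult mult_le_one)
      then show "norm (of_real (gauss_weight \<sigma> p) * (fourier_phase p (- u) * \<phi> p)) \<le> norm (\<phi> p)"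
        using mult_right_mono[of "\<bar>gauss_weight \<sigma> p\<bar>" 1 "norm (\<phi> p)"] by (simp add: norm_mult)
    qed
  qed (use \<phi>_int in auto)
  finally show ?thesis by (simp add: inversion_bound_def field_simps)
qed

lemma fourier_inverse_le: "(fourier_inverse \<phi>) u \<le> inversion_bound"
  by (rule LIMSEQ_le_const2[OF smoothed_density_tendsto]) (auto intro!: smoothed_density_le)

text \<open>The substitution u = v + \<sigma> n, whose Jacobian \<sigma>^2 in the plane normalises
  the density. It moves \<sigma> from the Gaussian into the argument of \<open>h\<close>, where
  continuity handles \<sigma> tending to 0.\<close>

lemma planar_gauss_scale:
  fixes h :: "real \<times> real \<Rightarrow> real"
  assumes s: "\<sigma> > 0" and h: "h \<in> borel_measurable borel"
  shows "integrable lborel (\<lambda>u. h u * planar_gauss \<sigma> (u - v)) \<longleftrightarrow> integrable lborel (\<lambda>n. h (v + \<sigma> *\<^sub>R n) * planar_gauss 1 n)"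
    "(LINT u|lborel. h u * planar_gauss \<sigma> (u - v)) = (LINT n|lborel. h (v + \<sigma> *\<^sub>R n) * planar_gauss 1 n)"
proof -
  let ?T = "\<lambda>n :: real \<times> real. v + \<sigma> *\<^sub>R n"
  let ?g = "\<lambda>u. h u * planar_gauss \<sigma> (u - v)"
  have L: "lborel = density (distr lborel borel ?T) (\<lambda>_. ennreal (\<sigma>\<^sup>2))"
  proof -
    have d: "ennreal (\<bar>\<sigma>\<bar> ^ DIM(real \<times> real)) = ennreal (\<sigma>\<^sup>2)" by (simp add: power2_eq_square)
    show ?thesis unfolding d[symmetric] by (rule lborel_affine) (use s in simp)
  qed
  have gm: "?g \<in> borel_measurable borel" using h by simp
  have T: "?T \<in> measurable lborel borel" by simp
  have sc: "\<sigma>\<^sup>2 *\<^sub>R ?g (?T n) = h (?T n) * planar_gauss 1 n" for n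
  proof -
    have "\<sigma> * normal_density 0 \<sigma> (\<sigma> * x) = std_normal_density x" for x
      using s by (simp add: normal_density_def real_sqrt_mult power_mult_distrib)
    then have "\<sigma>\<^sup>2 * planar_gauss \<sigma> (\<sigma> *\<^sub>R n) = planar_gauss 1 n"
      unfolding planar_gauss_def power2_eq_square by (metis fst_scaleR snd_scaleR real_scaleR_def mult.assoc mult.left_commute)
    then show ?thesis by (simp add: mult.left_commute)
  qed
  have "integrable lborel ?g \<longleftrightarrow> integrable (density (distr lborel borel ?T) (\<lambda>_. ennreal (\<sigma>\<^sup>2))) ?g"
    by (subst L) simp
  also have "\<dots> \<longleftrightarrow> integrable (distr lborel borel ?T) (\<lambda>u. \<sigma>\<^sup>2 *\<^sub>R ?g u)"
    using gm by (intro integrable_density) auto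
  also have "\<dots> \<longleftrightarrow> integrable lborel (\<lambda>n. \<sigma>\<^sup>2 *\<^sub>R ?g (?T n))"
    using gm by (intro integrable_distr_eq T) auto
  finally show "integrable lborel ?g \<longleftrightarrow> integrable lborel (\<lambda>n. h (?T n) * planar_gauss 1 n)"
    unfolding sc .
  have "integral\<^sup>L lborel ?g = integral\<^sup>L (density (distr lborel borel ?T) (\<lambda>_. ennreal (\<sigma>\<^sup>2))) ?g"
    by (subst L) simp
  also have "\<dots> = (LINT u|distr lborel borel ?T. \<sigma>\<^sup>2 *\<^sub>R ?g u)"
    using gm by (intro integral_density) auto
  also have "\<dots> = (LINT n|lborel. \<sigma>\<^sup>2 *\<^sub>R ?g (?T n))"
    using gm by (intro integral_distr T) auto
  finally show "integral\<^sup>L lborel ?g = (LINT n|lborel. h (?T n) * planar_gauss 1 n)"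
    unfolding sc .
qed

text \<open>The expectation of \<open>h\<close> at \<open>V\<close> plus Gaussian noise is evaluated
  in two ways: for vanishing noise it tends to the expectation of \<open>h (V \<omega>)\<close>, and
  by Fubini it is the integral of \<open>h\<close> against the smoothed density, which tends to
  \<open>fourier_inverse \<phi>\<close>.\<close>

lemma expectation_test_function:
  fixes h :: "real \<times> real \<Rightarrow> real"
  assumes hc: "continuous_on UNIV h" and h0: "\<And>u. 0 \<le> h u" and h1: "\<And>u. h u \<le> 1" and hi: "integrable lborel h"
  shows "expectation (\<lambda>\<omega>. h (V \<omega>)) = (LINT u|lborel. h u * (fourier_inverse \<phi>) u)"
proof -
  have hm[measurable]: "h \<in> borel_measurable borel" using hc by (rule borel_measurable_continuous_onI)
  have fm[measurable]: "(fourier_inverse \<phi>) \<in> borel_measurable borel"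
    by (rule borel_measurable_continuous_onI[OF fourier_inverse_continuous])
  interpret P: pair_sigma_finite M "lborel :: (real \<times> real) measure" ..
  define a where "a = (\<lambda>\<sigma> \<omega>. LINT n|lborel. h (V \<omega> + \<sigma> *\<^sub>R n) * planar_gauss 1 n)"
  have gi: "integrable lborel (\<lambda>n. h (v + \<sigma> *\<^sub>R n) * planar_gauss 1 n)" for v \<sigma>
    by (rule Bochner_Integration.integrable_bound[OF planar_gauss_integral(1)[of 1]])
      (auto simp: abs_mult h0 h1 planar_gauss_nonneg intro!: mult_left_le_one_le)
  have a0: "0 \<le> a \<sigma> \<omega>" for \<sigma> \<omega>
    unfolding a_def by (intro Bochner_Integration.integral_nonneg mult_nonneg_nonneg h0 planar_gauss_nonneg)
  have a1: "a \<sigma> \<omega> \<le> 1" for \<sigma> \<omega>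
  proof -
    have "a \<sigma> \<omega> \<le> (LINT n|lborel. planar_gauss 1 n)"
      unfolding a_def using planar_gauss_integral(1)[of 1] gi
      by (intro integral_mono) (auto simp: h0 h1 planar_gauss_nonneg intro!: mult_left_le_one_le)
    then show ?thesis using planar_gauss_integral(2)[of 1] by simp
  qed
  have m: "(\<lambda>(\<omega>, u). h u * planar_gauss \<sigma> (u - V \<omega>)) \<in> borel_measurable (M \<Otimes>\<^sub>M lborel)" for \<sigma>
  proof -
    have "(\<lambda>x. snd x - V (fst x)) \<in> borel_measurable (M \<Otimes>\<^sub>M (lborel :: (real \<times> real) measure))"
      by measurable
    then show ?thesis by (simp add: case_prod_unfold)
  qed
  have am: "a \<sigma> \<in> borel_measurable M" if s: "\<sigma> > 0" for \<sigma>
  proof -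
    have "a \<sigma> = (\<lambda>\<omega>. LINT u|lborel. h u * planar_gauss \<sigma> (u - V \<omega>))"
      unfolding a_def planar_gauss_scale(2)[OF s hm] ..
    then show ?thesis using lborel.borel_measurable_lebesgue_integral[OF m] by simp
  qed
  have fub: "expectation (a \<sigma>) = (LINT u|lborel. h u * expectation (\<lambda>\<omega>. planar_gauss \<sigma> (u - V \<omega>)))" if s: "\<sigma> > 0" for \<sigma>
  proof -
    have i: "integrable (M \<Otimes>\<^sub>M lborel) (\<lambda>(\<omega>, u). h u * planar_gauss \<sigma> (u - V \<omega>))"
    proof (rule P.Fubini_integrable[OF m])
      have "(LINT u|lborel. norm (h u * planar_gauss \<sigma> (u - V \<omega>))) = a \<sigma> \<omega>" for \<omega>
        unfolding a_def planar_gauss_scale(2)[OF s hm, symmetric] by (simp add: abs_mult h0 planar_gauss_nonneg)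
      moreover have "integrable M (a \<sigma>)"
        by (rule integrable_const_bound[where B=1]) (auto simp: a0 a1 am[OF s])
      ultimately show "integrable M (\<lambda>\<omega>. LINT u|lborel. norm (case (\<omega>, u) of (\<omega>, u) \<Rightarrow> h u * planar_gauss \<sigma> (u - V \<omega>)))"
        by simp
      show "AE \<omega> in M. integrable lborel (\<lambda>u. case (\<omega>, u) of (\<omega>, u) \<Rightarrow> h u * planar_gauss \<sigma> (u - V \<omega>))"
        using gi by (simp add: planar_gauss_scale(1)[OF s hm])
    qed
    have "expectation (a \<sigma>) = (LINT \<omega>|M. LINT u|lborel. h u * planar_gauss \<sigma> (u - V \<omega>))"
      unfolding a_def planar_gauss_scale(2)[OF s hm] ..
    also have "\<dots> = (LINT u|lborel. LINT \<omega>|M. h u * planar_gauss \<sigma> (u - V \<omega>))"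
      using P.Fubini_integral[OF i] by simp
    finally show ?thesis by simp
  qed
  have "(\<lambda>n. expectation (a (1 / Suc n))) \<longlonglongrightarrow> expectation (\<lambda>\<omega>. h (V \<omega>))"
  proof (rule integral_dominated_convergence[where w="\<lambda>_. 1"])
    show "AE \<omega> in M. (\<lambda>n. a (1 / Suc n) \<omega>) \<longlonglongrightarrow> h (V \<omega>)"
    proof (rule AE_I2)
      fix \<omega>
      have "(\<lambda>k. LINT n|lborel. h (V \<omega> + (1 / Suc k) *\<^sub>R n) * planar_gauss 1 n) \<longlonglongrightarrow> (LINT n|lborel. h (V \<omega>) * planar_gauss 1 n)"
      proof (rule integral_dominated_convergence[where w="planar_gauss 1"])
        show "AE n in lborel. (\<lambda>k. h (V \<omega> + (1 / Suc k) *\<^sub>R n) * planar_gauss 1 n) \<longlonglongrightarrow> h (V \<omega>) * planar_gauss 1 n"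
        proof (intro AE_I2 tendsto_mult tendsto_const)
          fix n :: "real \<times> real"
          have "(\<lambda>k. V \<omega> + (1 / Suc k) *\<^sub>R n) \<longlonglongrightarrow> V \<omega> + 0 *\<^sub>R n"
            by (intro tendsto_intros LIMSEQ_Suc[OF lim_1_over_n])
          then have "(\<lambda>k. V \<omega> + (1 / Suc k) *\<^sub>R n) \<longlonglongrightarrow> V \<omega>" by simp
          then show "(\<lambda>k. h (V \<omega> + (1 / Suc k) *\<^sub>R n)) \<longlonglongrightarrow> h (V \<omega>)"
            by (rule continuous_on_tendsto_compose[OF hc]) auto
        qed
        show "AE n in lborel. norm (h (V \<omega> + (1 / Suc k) *\<^sub>R n) * planar_gauss 1 n) \<le> planar_gauss 1 n" for k
          by (auto simp: abs_mult h0 h1 planar_gauss_nonneg intro!: mult_left_le_one_le)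
      qed (use planar_gauss_integral in auto)
      then show "(\<lambda>k. a (1 / Suc k) \<omega>) \<longlonglongrightarrow> h (V \<omega>)"
        using planar_gauss_integral(2)[of 1] by (simp add: a_def)
    qed
  qed (use a0 a1 am in \<open>auto simp: abs_le_iff\<close>)
  moreover have "(\<lambda>n. expectation (a (1 / Suc n))) \<longlonglongrightarrow> (LINT u|lborel. h u * (fourier_inverse \<phi>) u)"
  proof -
    have "(\<lambda>n. LINT u|lborel. h u * expectation (\<lambda>\<omega>. planar_gauss (1 / Suc n) (u - V \<omega>))) \<longlonglongrightarrow> (LINT u|lborel. h u * (fourier_inverse \<phi>) u)"
    proof (rule integral_dominated_convergence[where w="\<lambda>u. h u * inversion_bound"])
      show "AE u in lborel. (\<lambda>n. h u * expectation (\<lambda>\<omega>. planar_gauss (1 / Suc n) (u - V \<omega>))) \<longlonglongrightarrow> h u * (fourier_inverse \<phi>) u"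
        by (intro AE_I2 tendsto_mult tendsto_const smoothed_density_tendsto)
      show "AE u in lborel. norm (h u * expectation (\<lambda>\<omega>. planar_gauss (1 / Suc n) (u - V \<omega>))) \<le> h u * inversion_bound" for n
        by (auto simp: abs_mult h0 Bochner_Integration.integral_nonneg planar_gauss_nonneg intro!: mult_left_mono smoothed_density_le)
      show "(\<lambda>u. h u * expectation (\<lambda>\<omega>. planar_gauss (1 / Suc n) (u - V \<omega>))) \<in> borel_measurable lborel" for n
      proof -
        have "(\<lambda>x. fst x - V (snd x)) \<in> borel_measurable ((lborel :: (real \<times> real) measure) \<Otimes>\<^sub>M M)"
          by measurable
        then have "(\<lambda>(u, \<omega>). planar_gauss (1 / Suc n) (u - V \<omega>)) \<in> borel_measurable (lborel \<Otimes>\<^sub>M M)"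
          by (simp add: case_prod_unfold)
        from borel_measurable_lebesgue_integral[OF this] show ?thesis by simp
      qed
    qed (use hi in auto)
    then show ?thesis by (simp add: fub)
  qed
  ultimately show ?thesis by (rule LIMSEQ_unique)
qed

text \<open>The indicator of an open box is the increasing limit of continuous functions built from
  the distance to the complement, so the test function identity extends to open boxes; these form an
  intersection-stable generator of the Borel sets.\<close>

theorem fourier_inversion_density: "continuous_density M V (fourier_inverse \<phi>)"
proof -
  have fm[measurable]: "(fourier_inverse \<phi>) \<in> borel_measurable borel"
    by (rule borel_measurable_continuous_onI[OF fourier_inverse_continuous])
  have box: "emeasure (distr M borel V) (box a b) = emeasure (density lborel (\<lambda>u. ennreal ((fourier_inverse \<phi>) u))) (box a b)" for a b
  proof -
    let ?U = "box a b" and ?d = "\<lambda>u. infdist u (- box a b)"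
    define h where "h = (\<lambda>k u. min 1 (real k * ?d u))"
    \<comment> \<open>The distance to the empty set is 0 by convention, so the complement of the box
      must be nonempty.\<close>
    have ne: "- ?U \<noteq> {}" using bounded_box[of a b] not_bounded_UNIV by (metis Compl_empty_eq boolean_algebra.compl_zero double_complement)
    have hc: "continuous_on UNIV (h k)" for k
      unfolding h_def by (intro continuous_intros)
    have h0: "0 \<le> h k u" and h1: "h k u \<le> 1" for k u by (auto simp: h_def infdist_nonneg)
    have hout: "h k u = 0" if "u \<notin> ?U" for k u using that by (simp add: h_def)
    have hle: "h k u \<le> indicator ?U u" for k u using hout h1 by (auto simp: indicator_def)
    have ind: "integrable lborel (indicator ?U :: real \<times> real \<Rightarrow> real)"
      by (intro integrable_real_indicator emeasure_lborel_box_finite) simp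
    have hi: "integrable lborel (h k)" for k
      by (rule Bochner_Integration.integrable_bound[OF ind])
        (use borel_measurable_continuous_onI[OF hc] hle h0 in auto)
    have lim: "(\<lambda>k. h k u) \<longlonglongrightarrow> indicator ?U u" for u
    proof (cases "u \<in> ?U")
      case True
      have "closed (- ?U)" by (intro closed_Compl open_box)
      then have "?d u > 0" using in_closed_iff_infdist_zero[OF _ ne, of u] True infdist_nonneg[of u "- ?U"] by (auto simp: less_le)
      then obtain N where N: "1 < real N * ?d u" using reals_Archimedean3 by blast
      have "h k u = 1" if "k \<ge> N" for k
      proof -
        have "real N * ?d u \<le> real k * ?d u" using that infdist_nonneg by (intro mult_right_mono) auto
        then show ?thesis using N by (simp add: h_def)
      qed
      then have "eventually (\<lambda>k. h k u = indicator ?U u) sequentially" using True by (auto simp: eventually_sequentially)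
      then show ?thesis by (rule tendsto_eventually)
    qed (simp add: hout)
    have "(\<lambda>k. expectation (\<lambda>\<omega>. h k (V \<omega>))) \<longlonglongrightarrow> expectation (\<lambda>\<omega>. indicator ?U (V \<omega>))"
    proof (rule integral_dominated_convergence[where w="\<lambda>_. 1"])
      show "(\<lambda>\<omega>. h k (V \<omega>)) \<in> borel_measurable M" for k
        by (rule measurable_compose[OF V borel_measurable_continuous_onI[OF hc]])
    qed (use h0 h1 lim in auto)
    moreover have "(\<lambda>k. expectation (\<lambda>\<omega>. h k (V \<omega>))) \<longlonglongrightarrow> (LINT u|lborel. indicator ?U u * (fourier_inverse \<phi>) u)"
      unfolding expectation_test_function[OF hc h0 h1 hi]
    proof (rule integral_dominated_convergence[where w="\<lambda>u. indicator ?U u * inversion_bound"])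
      show "AE u in lborel. norm (h k u * (fourier_inverse \<phi>) u) \<le> indicator ?U u * inversion_bound" for k
        using hle h0 fourier_inverse_nonneg fourier_inverse_le by (auto simp: abs_mult intro!: mult_mono)
      show "(\<lambda>u. h k u * (fourier_inverse \<phi>) u) \<in> borel_measurable lborel" for k
        using borel_measurable_continuous_onI[OF hc] by simp
    qed (use lim ind in \<open>auto intro!: tendsto_mult\<close>)
    ultimately have eq: "expectation (\<lambda>\<omega>. indicator ?U (V \<omega>)) = (LINT u|lborel. indicator ?U u * (fourier_inverse \<phi>) u)"
      by (rule LIMSEQ_unique)
    have fi: "integrable lborel (\<lambda>u. indicator ?U u * (fourier_inverse \<phi>) u)"
      by (rule Bochner_Integration.integrable_bound[OF integrable_mult_left[OF ind, of inversion_bound]])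
        (use fourier_inverse_nonneg fourier_inverse_le in \<open>auto simp: abs_mult indicator_def intro!: AE_I2 order.trans[OF fourier_inverse_le abs_ge_self]\<close>)
    have "emeasure (distr M borel V) ?U = emeasure M (V -` ?U \<inter> space M)" by (simp add: emeasure_distr)
    also have "\<dots> = ennreal (expectation (\<lambda>\<omega>. indicator ?U (V \<omega>)))"
    proof -
      have "expectation (\<lambda>\<omega>. indicator ?U (V \<omega>) :: real) = expectation (indicator (V -` ?U \<inter> space M))"
        by (intro Bochner_Integration.integral_cong) (auto simp: indicator_def)
      then show ?thesis by (simp add: emeasure_eq_measure)
    qed
    also have "\<dots> = (\<integral>\<^sup>+ u. ennreal (indicator ?U u * (fourier_inverse \<phi>) u) \<partial>lborel)"
      unfolding eq using fi fourier_inverse_nonneg by (intro nn_integral_eq_integral[symmetric]) auto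
    also have "\<dots> = emeasure (density lborel (\<lambda>u. ennreal ((fourier_inverse \<phi>) u))) ?U"
      by (subst emeasure_density) (auto simp: indicator_def intro!: nn_integral_cong)
    finally show ?thesis .
  qed
  have "distr M borel V = density lborel (\<lambda>u. ennreal ((fourier_inverse \<phi>) u))"
  proof (rule measure_eqI_generator_eq)
    let ?E = "range (\<lambda>(a, b). box a b :: (real \<times> real) set)"
    show "Int_stable ?E" by (auto simp: Int_stable_def box_Int_box)
    show "?E \<subseteq> Pow UNIV" by simp
    show "sets (distr M borel V) = sigma_sets UNIV ?E" "sets (density lborel (\<lambda>u. ennreal ((fourier_inverse \<phi>) u))) = sigma_sets UNIV ?E"
      by (simp_all add: borel_eq_box)
    let ?A = "\<lambda>n::nat. box (- (real n *\<^sub>R One)) (real n *\<^sub>R One) :: (real \<times> real) set"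
    show "range ?A \<subseteq> ?E" "(\<Union>i. ?A i) = UNIV" unfolding UN_box_eq_UNIV by auto
    show "emeasure (distr M borel V) (?A i) \<noteq> \<infinity>" for i
      by (simp add: emeasure_distr)
    show "emeasure (distr M borel V) X = emeasure (density lborel (\<lambda>u. ennreal ((fourier_inverse \<phi>) u))) X" if "X \<in> ?E" for X
      using that box by auto
  qed
  moreover have "distr M lborel V = distr M borel V" by (rule distr_cong) auto
  ultimately have "distributed M lborel V (\<lambda>u. ennreal ((fourier_inverse \<phi>) u))"
    by (simp add: distributed_def)
  then show ?thesis
    using fourier_inverse_continuous fourier_inverse_nonneg by (simp add: continuous_density_def)
qed

end
end

subsection \<open>Contour shift\<close>

lemma integrable_of_has_integral_nonneg:
  fixes f :: "real \<Rightarrow> real"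
  assumes f: "f \<in> borel_measurable borel" and S: "S \<in> sets borel" and nn: "\<And>x. x \<in> S \<Longrightarrow> 0 \<le> f x"
    and I: "(f has_integral I) S"
  shows "integrable lborel (\<lambda>x. indicator S x * f x)"
proof -
  have eq: "(\<lambda>x. indicator S x * f x) = (\<lambda>x. if x \<in> S then f x else 0)" by (auto simp: indicator_def)
  have g: "((\<lambda>x. indicator S x * f x) has_integral I) UNIV"
    unfolding eq using I by (simp add: has_integral_restrict_UNIV)
  have "(\<integral>\<^sup>+ x. ennreal (indicator S x * f x) \<partial>lborel) = ennreal I"
    by (rule nn_integral_has_integral_lborel[OF _ _ g]) (use f S nn in \<open>auto simp: indicator_def\<close>)
  then show ?thesis
    using f S nn by (intro integrableI_nn_integral_finite[of _ _ I]) (auto simp: indicator_def)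
qed

lemma integrable_exp_decay:
  assumes "a > 0"
  shows "integrable lborel (\<lambda>s::real. indicator {0<..} s * exp (- a * s))"
proof -
  have "integrable lborel (\<lambda>s::real. indicator {0..} s * exp (- a * s))"
    by (rule integrable_of_has_integral_nonneg[OF _ _ _ has_integral_exp_minus_to_infinity[OF assms]]) auto
  then show ?thesis
    by (rule Bochner_Integration.integrable_bound) (auto simp: indicator_def)
qed

lemma integrable_inverse_sqrt:
  assumes "c \<ge> 0"
  shows "integrable lborel (\<lambda>x::real. indicator {0<..<c} x * (1 / sqrt x))"
proof -
  have "integrable lborel (\<lambda>x::real. indicator {0..c} x * (x powr (- 1/2)))"
    by (rule integrable_of_has_integral_nonneg[OF _ _ _ has_integral_powr_from_0[OF _ assms]]) auto
  then show ?thesis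
    by (rule Bochner_Integration.integrable_bound)
      (auto simp: indicator_def powr_minus powr_half_sqrt inverse_eq_divide intro!: AE_I2)
qed

text \<open>Supplies the dominating function near the branch point, where \<open>m\<close> will be
  pi.\<close>

lemma integrable_inverse_sqrt_abs:
  assumes "c \<ge> 0"
  shows "integrable lborel (\<lambda>x::real. indicator {m - c<..<m + c} x * (1 / sqrt \<bar>x - m\<bar>))"
proof -
  let ?g = "\<lambda>x::real. indicator {0<..<c} x * (1 / sqrt x)"
  have 1: "integrable lborel (\<lambda>x. ?g (- m + 1 * x))"
    using lborel_integrable_real_affine[OF integrable_inverse_sqrt[OF assms], of 1 "- m"] by simp
  have 2: "integrable lborel (\<lambda>x. ?g (m + (- 1) * x))"
    using lborel_integrable_real_affine[OF integrable_inverse_sqrt[OF assms], of "- 1" m] by simp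
  show ?thesis
    by (rule Bochner_Integration.integrable_bound[OF Bochner_Integration.integrable_add[OF 1 2]])
      (auto simp: indicator_def intro!: AE_I2)
qed

text \<open>A branch of \<open>sqrt (l / sinh l)\<close> that is holomorphic on the whole right half-plane.\<close>

definition levy_root :: "complex \<Rightarrow> complex" where
  "levy_root l = csqrt (2 * l) * exp (- l / 2) / csqrt (1 - exp (- 2 * l))"

text \<open>The function coth (l / 2), written in exp (- l), which has modulus below 1 on the right
  half-plane.\<close>

definition half_coth :: "complex \<Rightarrow> complex" where
  "half_coth l = (1 + exp (- l)) / (1 - exp (- l))"

abbreviation half_strip :: "real \<Rightarrow> real \<Rightarrow> complex" where
  "half_strip s v \<equiv> of_real s - \<i> * of_real v"

definition levy_kernel :: "real \<Rightarrow> real \<Rightarrow> complex \<Rightarrow> complex" where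
  "levy_kernel a c l = exp (- \<i> * l * of_real a) * levy_root l * exp (- of_real c * l * half_coth l)"

lemma one_minus_exp_Re_pos: "Re l > 0 \<Longrightarrow> Re (1 - exp (- l)) > 0"
proof -
  assume "Re l > 0"
  then have "norm (exp (- l)) < 1" by simp
  then show ?thesis using complex_Re_le_cmod[of "exp (- l)"] unfolding minus_complex.sel one_complex.sel by linarith
qed

text \<open>For Re l > 0 both 2 l and 1 - exp (- 2 l) have positive real part, so neither principal
  root meets its cut. A single root of the quotient l / sinh l would not allow this
  argument.\<close>

lemma levy_kernel_holomorphic: "levy_kernel a c holomorphic_on {l. Re l > 0}"
proof -
  have 1: "2 * l \<notin> \<real>\<^sub>\<le>\<^sub>0" if "Re l > 0" for l :: complex
    using that by (auto simp: complex_nonpos_Reals_iff)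
  have 2: "1 - exp (- (2 * l)) \<notin> \<real>\<^sub>\<le>\<^sub>0" if "Re l > 0" for l :: complex
    using one_minus_exp_Re_pos[of "2 * l"] that by (auto simp: complex_nonpos_Reals_iff)
  have 3: "1 - exp (- l) \<noteq> 0" if "Re l > 0" for l :: complex
    using one_minus_exp_Re_pos[of l] that by auto
  show ?thesis
    unfolding levy_kernel_def[abs_def] levy_root_def half_coth_def
    using 1 2 3 by (auto intro!: holomorphic_intros)
qed

text \<open>A primitive on the convex half-plane turns each side of the rectangle into a difference
  of corner values, which cancel. The side at \<eta> > 0 keeps the path off the imaginary axis,
  where the branch point lies.\<close>

lemma levy_kernel_rectangle:
  fixes a c \<eta> R V :: real
  assumes \<eta>: "0 < \<eta>" "\<eta> \<le> R" and V: "0 \<le> V"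
  defines "G \<equiv> levy_kernel a c"
  shows "(LINT s|lborel. indicator {\<eta>..R} s *\<^sub>R G (of_real s)) =
     - \<i> * (LINT v|lborel. indicator {0..V} v *\<^sub>R G (half_strip \<eta> v))
     + (LINT s|lborel. indicator {\<eta>..R} s *\<^sub>R G (half_strip s V))
     + \<i> * (LINT v|lborel. indicator {0..V} v *\<^sub>R G (half_strip R v))"
proof -
  have conv: "convex {l. Re l > 0}" by (rule convex_halfspace_Re_gt)
  have op: "open {l. Re l > 0}" by (rule open_halfspace_Re_gt)
  have hol: "G holomorphic_on {l. Re l > 0}" unfolding G_def by (rule levy_kernel_holomorphic)
  obtain P where P0: "\<And>l. l \<in> {l. Re l > 0} \<Longrightarrow> (P has_field_derivative G l) (at l within {l. Re l > 0})"
    using holomorphic_convex_primitive'[OF conv op hol] by blast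
  have P: "(P has_field_derivative G l) (at l)" if "Re l > 0" for l
    using P0[of l] that at_within_open[OF _ op, of l] by simp
  have cont: "continuous_on {l. Re l > 0} G" using hol by (rule holomorphic_on_imp_continuous_on)
  have hor: "(LINT s|lborel. indicator {\<eta>..R} s *\<^sub>R G (half_strip s w)) = P (half_strip R w) - P (half_strip \<eta> w)" for w
  proof (rule integral_FTC_Icc[OF \<eta>(2)])
    fix s assume "\<eta> \<le> s" "s \<le> R"
    then have "Re (half_strip s w) > 0" using \<eta> by simp
    note pos = this
    have "((\<lambda>s. half_strip s w) has_vector_derivative 1) (at s within {\<eta>..R})"
      by (auto intro!: derivative_eq_intros)
    from field_vector_diff_chain_within[where g=P, OF this has_field_derivative_at_within[OF P[OF pos]]]
    show "((\<lambda>s. P (half_strip s w)) has_vector_derivative G (half_strip s w)) (at s within {\<eta>..R})"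
      by (simp add: comp_def)
  next
    show "continuous_on {\<eta>..R} (\<lambda>s. G (half_strip s w))"
      by (rule continuous_on_compose2[OF cont]) (use \<eta> in \<open>auto intro!: continuous_intros\<close>)
  qed
  have ver: "(LINT v|lborel. indicator {0..V} v *\<^sub>R (- \<i> * G (half_strip u v))) = P (half_strip u V) - P (of_real u)" if u: "u > 0" for u
  proof -
    have "(LINT v|lborel. indicator {0..V} v *\<^sub>R (- \<i> * G (half_strip u v))) = P (half_strip u V) - P (half_strip u 0)"
    proof (rule integral_FTC_Icc[OF V])
      fix v
      have "Re (half_strip u v) > 0" using u by simp
      note pos = this
      have "((\<lambda>v. half_strip u v) has_vector_derivative - \<i>) (at v within {0..V})"
        by (auto intro!: derivative_eq_intros)
      from field_vector_diff_chain_within[where g=P, OF this has_field_derivative_at_within[OF P[OF pos]]]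
      show "((\<lambda>v. P (half_strip u v)) has_vector_derivative - \<i> * G (half_strip u v)) (at v within {0..V})"
        by (simp add: comp_def)
    next
      show "continuous_on {0..V} (\<lambda>v. - \<i> * G (half_strip u v))"
        by (intro continuous_intros continuous_on_compose2[OF cont]) (use u in auto)
    qed
    then show ?thesis by simp
  qed
  have sc: "indicator {0..V} v *\<^sub>R (- \<i> * z) = - \<i> * (indicator {0..V} v *\<^sub>R z)" for v :: real and z by simp
  have ver': "- \<i> * (LINT v|lborel. indicator {0..V} v *\<^sub>R G (half_strip u v)) = P (half_strip u V) - P (of_real u)" if u: "u > 0" for u
    using ver[OF u] unfolding sc integral_mult_right_zero .
  have R: "R > 0" using \<eta> by simp
  have h0: "(LINT s|lborel. indicator {\<eta>..R} s *\<^sub>R G (of_real s)) = P (of_real R) - P (of_real \<eta>)"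
    using hor[of 0] by simp
  have v2: "\<i> * (LINT v|lborel. indicator {0..V} v *\<^sub>R G (half_strip R v)) = - (P (half_strip R V) - P (of_real R))"
    unfolding ver'[OF R, symmetric] by simp
  show ?thesis
    unfolding h0 hor ver'[OF \<eta>(1)] v2 by simp
qed

section \<open>Bounds for the kernel on the sides of the rectangle\<close>

lemma norm_levy_root:
  "norm (levy_root l) = sqrt (2 * norm l * exp (- Re l) / norm (1 - exp (- 2 * l)))"
proof -
  have e: "exp (- Re l / 2) = sqrt (exp (- Re l))"
    by (rule real_sqrt_unique[symmetric]) (simp_all add: power2_eq_square exp_add[symmetric])
  show ?thesis
    unfolding levy_root_def norm_divide norm_mult norm_csqrt norm_exp_eq_Re real_sqrt_divide real_sqrt_mult
    using e by (simp add: real_sqrt_mult)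
qed

text \<open>Squared modulus of 1 - w, and real part of (1 + w) times the conjugate of 1 - w, for w
  of modulus r and argument v.\<close>

lemma sq_one_minus_polar:
  fixes r v :: real
  shows "(1 - r * cos v)\<^sup>2 + (r * sin v)\<^sup>2 = 1 - 2 * r * cos v + r\<^sup>2"
    "(1 + r * cos v) * (1 - r * cos v) - r * sin v * (r * sin v) = 1 - r\<^sup>2"
proof -
  have "(1 - r * x)\<^sup>2 + (r * y)\<^sup>2 = 1 - 2 * r * x + r\<^sup>2 * (y\<^sup>2 + x\<^sup>2)" for x y :: real
    by (simp add: power2_eq_square algebra_simps)
  from this[of "cos v" "sin v"] show "(1 - r * cos v)\<^sup>2 + (r * sin v)\<^sup>2 = 1 - 2 * r * cos v + r\<^sup>2" by simp
  have "(1 + r * x) * (1 - r * x) - r * y * (r * y) = 1 - r\<^sup>2 * (y\<^sup>2 + x\<^sup>2)" for x y :: real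
    by (simp add: power2_eq_square algebra_simps)
  from this[of "cos v" "sin v"] show "(1 + r * cos v) * (1 - r * cos v) - r * sin v * (r * sin v) = 1 - r\<^sup>2" by simp
qed

text \<open>Two complementary bounds: the triangle inequality is effective away from the imaginary
  axis, and 1 + r^4 >= 2 r^2 with r = exp (- s) gives a bound that survives s tending to 0 as long
  as sin v is not 0.\<close>

lemma norm_one_minus_exp_ge:
  fixes s v :: real
  defines "l \<equiv> half_strip s v"
  shows "1 - exp (- 2 * s) \<le> norm (1 - exp (- 2 * l))" "2 * exp (- s) * \<bar>sin v\<bar> \<le> norm (1 - exp (- 2 * l))"
proof -
  have n: "norm (exp (- 2 * l)) = exp (- 2 * s)" by (simp add: l_def)
  show "1 - exp (- 2 * s) \<le> norm (1 - exp (- 2 * l))"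
    using norm_triangle_ineq2[of 1 "exp (- 2 * l)"] unfolding n by simp
  have "(2 * exp (- s) * \<bar>sin v\<bar>)\<^sup>2 = 4 * exp (- 2 * s) * (sin v)\<^sup>2"
    by (simp add: power_mult_distrib exp_double[symmetric])
  also have "\<dots> = 2 * exp (- 2 * s) - 2 * exp (- 2 * s) * cos (2 * v)"
    unfolding cos_double_sin by (simp add: algebra_simps)
  also have "\<dots> \<le> 1 + (exp (- 2 * s))\<^sup>2 - 2 * exp (- 2 * s) * cos (2 * v)"
    using zero_le_power2[of "1 - exp (- 2 * s)"] by (simp add: power2_diff)
  also have "\<dots> = (norm (1 - exp (- 2 * l)))\<^sup>2"
  proof -
    have re: "Re (exp (- 2 * l)) = exp (- 2 * s) * cos (2 * v)" "Im (exp (- 2 * l)) = exp (- 2 * s) * sin (2 * v)"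
      by (simp_all add: l_def Re_exp Im_exp)
    have "(norm (1 - exp (- 2 * l)))\<^sup>2 = (1 - exp (- 2 * s) * cos (2 * v))\<^sup>2 + (exp (- 2 * s) * sin (2 * v))\<^sup>2"
      unfolding cmod_power2 using re by simp
    also have "\<dots> = 1 + (exp (- 2 * s))\<^sup>2 - 2 * exp (- 2 * s) * cos (2 * v)"
      unfolding sq_one_minus_polar by simp
    finally show ?thesis by simp
  qed
  finally show "2 * exp (- s) * \<bar>sin v\<bar> \<le> norm (1 - exp (- 2 * l))"
    by (rule power2_le_imp_le) simp
qed

lemma one_minus_exp_ge:
  assumes "s > 0"
  shows "2 * s / (1 + 2 * s) \<le> 1 - exp (- 2 * (s :: real))"
proof -
  have "1 + 2 * s \<le> exp (2 * s)" by (rule exp_ge_add_one_self)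
  then have "exp (- (2 * s)) \<le> 1 / (1 + 2 * s)"
    using assms unfolding exp_minus inverse_eq_divide by (intro divide_left_mono) auto
  then show ?thesis using assms by (simp add: field_simps)
qed

lemma linear_exp_le:
  assumes "s \<ge> 0"
  shows "(1 + 2 * s) * exp (- s / 2) \<le> 8 * exp (- s / (4::real))"
proof -
  have "1 + 2 * s \<le> 8 * exp (s / 4)" using exp_ge_add_one_self[of "s / 4"] by linarith
  then have "(1 + 2 * s) * exp (- s / 2) \<le> 8 * exp (s / 4) * exp (- s / 2)" by (intro mult_right_mono) auto
  also have "\<dots> = 8 * exp (- s / 4)" by (simp add: mult.assoc exp_add[symmetric])
  finally show ?thesis .
qed

text \<open>The denominator is at least 2 s / (1 + 2 s), and its factor s cancels against the
  modulus of l, which is at most K s. With V = 0 and K = 1 this covers the whole positive real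
  axis.\<close>

lemma levy_root_bound_large:
  fixes s v V :: real
  assumes s: "s > 0" and v: "0 \<le> v" "v \<le> V" and K: "K \<ge> 1" "s + V \<le> K * s"
  shows "norm (levy_root (half_strip s v)) \<le> 8 * K * exp (- s / 4)"
proof -
  let ?l = "half_strip s v"
  have nl: "norm ?l \<le> K * s"
  proof -
    have "norm ?l \<le> norm (complex_of_real s) + norm (\<i> * of_real v)" by (rule norm_triangle_ineq4)
    also have "\<dots> = s + v" using s v by (simp add: norm_mult)
    finally show ?thesis using v K by simp
  qed
  have "2 * norm ?l * exp (- s) / norm (1 - exp (- 2 * ?l)) \<le> 2 * (K * s) * exp (- s) / (2 * s / (1 + 2 * s))"
  proof (rule frac_le)
    show "2 * s / (1 + 2 * s) \<le> norm (1 - exp (- 2 * ?l))"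
      using one_minus_exp_ge[OF s] norm_one_minus_exp_ge(1)[of s v] by linarith
  qed (use nl s K in auto)
  also have "\<dots> = K * ((1 + 2 * s) * exp (- s))" using s by (simp add: field_simps)
  \<comment> \<open>Enlarged to a perfect square, so that the root can be taken exactly.\<close>
  also have "\<dots> \<le> K\<^sup>2 * ((1 + 2 * s)\<^sup>2 * exp (- s))"
  proof -
    have "x \<le> x\<^sup>2" if "x \<ge> 1" for x :: real using mult_right_mono[of 1 x x] that by (simp add: power2_eq_square)
    then show ?thesis using K s by (intro mult_mono) auto
  qed
  also have "\<dots> = (K * ((1 + 2 * s) * exp (- s / 2)))\<^sup>2"
    by (simp add: power_mult_distrib power2_eq_square exp_add[symmetric])
  finally have "norm (levy_root ?l) \<le> K * ((1 + 2 * s) * exp (- s / 2))"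
    unfolding norm_levy_root using K s by (intro real_le_lsqrt) (auto intro!: divide_nonneg_nonneg mult_nonneg_nonneg)
  also have "\<dots> \<le> K * (8 * exp (- s / 4))" using linear_exp_le[of s] s K by (intro mult_left_mono) auto
  finally show ?thesis by simp
qed

text \<open>The modulus of l is at most s + v; the share of s is controlled by the first lower bound
  on the denominator and the share of v by the one with sin v.\<close>

lemma levy_root_bound_sin:
  fixes s v :: real
  assumes s: "0 < s" "s \<le> 1" and v: "0 \<le> v" "sin v \<noteq> 0"
  shows "norm (levy_root (half_strip s v)) \<le> sqrt (3 + v / \<bar>sin v\<bar>)"
proof -
  let ?l = "half_strip s v" and ?N = "norm (1 - exp (- 2 * (half_strip s v)))"
  have nl: "norm ?l \<le> s + v"
    using norm_triangle_ineq4[of "complex_of_real s" "\<i> * of_real v"] s v by (simp add: norm_mult)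
  have N1: "2 * s / (1 + 2 * s) \<le> ?N" using one_minus_exp_ge[OF s(1)] norm_one_minus_exp_ge(1)[of s v] by linarith
  have N2: "2 * exp (- s) * \<bar>sin v\<bar> \<le> ?N" by (rule norm_one_minus_exp_ge(2))
  have d1: "0 < 2 * s / (1 + 2 * s)" using s by simp
  have d2: "0 < 2 * exp (- s) * \<bar>sin v\<bar>" using v by simp
  have Np: "0 < ?N" using d1 N1 by linarith
  have t1: "2 * s * exp (- s) / ?N \<le> 2 * s * exp (- s) / (2 * s / (1 + 2 * s))"
    by (rule divide_left_mono[OF N1 _ mult_pos_pos[OF Np d1]]) (use s in simp)
  have t2: "2 * v * exp (- s) / ?N \<le> 2 * v * exp (- s) / (2 * exp (- s) * \<bar>sin v\<bar>)"
    by (rule divide_left_mono[OF N2 _ mult_pos_pos[OF Np d2]]) (use v in simp)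
  have "2 * norm ?l * exp (- s) / ?N \<le> 2 * (s + v) * exp (- s) / ?N"
    using nl by (intro divide_right_mono mult_right_mono) auto
  also have "\<dots> = 2 * s * exp (- s) / ?N + 2 * v * exp (- s) / ?N" by (simp add: algebra_simps add_divide_distrib)
  also have "\<dots> \<le> 2 * s * exp (- s) / (2 * s / (1 + 2 * s)) + 2 * v * exp (- s) / (2 * exp (- s) * \<bar>sin v\<bar>)"
    by (rule add_mono[OF t1 t2])
  also have "2 * s * exp (- s) / (2 * s / (1 + 2 * s)) = (1 + 2 * s) * exp (- s)" using s by simp
  also have "\<dots> \<le> 3 * 1" using s by (intro mult_mono) auto
  also have "2 * v * exp (- s) / (2 * exp (- s) * \<bar>sin v\<bar>) = v / \<bar>sin v\<bar>" by simp
  finally show ?thesis unfolding norm_levy_root by simp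
qed

lemma Re_half_coth:
  fixes s v :: real
  defines "l \<equiv> half_strip s v" and "r \<equiv> exp (- s)"
  shows "half_coth l = Complex (1 - r\<^sup>2) (2 * r * sin v) / of_real (1 - 2 * r * cos v + r\<^sup>2)"
    "Re (l * half_coth l) = (s * (1 - r\<^sup>2) + 2 * v * r * sin v) / (1 - 2 * r * cos v + r\<^sup>2)"
proof -
  have e: "exp (- l) = Complex (r * cos v) (r * sin v)"
    by (simp add: complex_eq_iff l_def r_def Re_exp Im_exp)
  note d = sq_one_minus_polar(1)[of r v] and n = sq_one_minus_polar(2)[of r v]
  show hc: "half_coth l = Complex (1 - r\<^sup>2) (2 * r * sin v) / of_real (1 - 2 * r * cos v + r\<^sup>2)"
  proof -
    have "half_coth l = (1 + exp (- l)) * cnj (1 - exp (- l)) / of_real ((norm (1 - exp (- l)))\<^sup>2)"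
      unfolding half_coth_def by (rule complex_div_cnj)
    also have "(norm (1 - exp (- l)))\<^sup>2 = 1 - 2 * r * cos v + r\<^sup>2"
      unfolding cmod_power2 e d[symmetric] by simp
    also have "(1 + exp (- l)) * cnj (1 - exp (- l)) = Complex (1 - r\<^sup>2) (2 * r * sin v)"
      unfolding e n[symmetric] complex_eq_iff by (simp add: algebra_simps)
    finally show ?thesis .
  qed
  show "Re (l * half_coth l) = (s * (1 - r\<^sup>2) + 2 * v * r * sin v) / (1 - 2 * r * cos v + r\<^sup>2)"
    unfolding hc by (simp add: l_def add_divide_distrib algebra_simps)
qed

text \<open>With r = exp (- s), the denominator 1 + 2 r cos b + r^2 is at least 2 r (1 + cos b),
  since (1 - r)^2 is nonnegative; so the negative term is worst at r = 1. The value on the imaginary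
  axis therefore controls the whole horizontal line.\<close>

lemma Re_half_coth_ge:
  fixes s b :: real
  assumes s: "s > 0" and b: "0 \<le> b" "b \<le> pi / 2"
  shows "- ((pi + b) * sin b / (1 + cos b)) \<le> Re ((half_strip s (pi + b)) * half_coth (half_strip s (pi + b)))"
proof -
  define r where "r = exp (- s)"
  have r: "0 < r" "r < 1" using s by (auto simp: r_def)
  have r1: "r\<^sup>2 \<le> 1" using r by (simp add: power_le_one)
  have sb: "sin b \<ge> 0" "cos b \<ge> 0" using b by (auto intro!: sin_ge_zero cos_ge_zero)
  have D: "2 * r * (1 + cos b) \<le> 1 + 2 * r * cos b + r\<^sup>2"
    using zero_le_power2[of "1 - r"] by (simp add: power2_diff algebra_simps)
  have Dp: "0 < 2 * r * (1 + cos b)" using r sb by (simp add: add_pos_nonneg)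
  have Dq: "0 < 1 + 2 * r * cos b + r\<^sup>2" using D Dp by linarith
  have "2 * (pi + b) * r * sin b / (1 + 2 * r * cos b + r\<^sup>2) \<le> 2 * (pi + b) * r * sin b / (2 * r * (1 + cos b))"
    using D Dp Dq b r sb by (intro divide_left_mono mult_nonneg_nonneg mult_pos_pos) auto
  also have "\<dots> = (2 * r) * ((pi + b) * sin b) / ((2 * r) * (1 + cos b))" by (simp only: mult_ac)
  also have "\<dots> = (pi + b) * sin b / (1 + cos b)" using r by (intro mult_divide_mult_cancel_left) simp
  finally have 1: "- ((pi + b) * sin b / (1 + cos b)) \<le> - (2 * (pi + b) * r * sin b / (1 + 2 * r * cos b + r\<^sup>2))" by simp
  also have "\<dots> \<le> (s * (1 - r\<^sup>2) + - (2 * (pi + b) * r * sin b)) / (1 + 2 * r * cos b + r\<^sup>2)"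
    unfolding minus_divide_left using s r1 Dq by (intro divide_right_mono) auto
  also have "\<dots> = Re ((half_strip s (pi + b)) * half_coth (half_strip s (pi + b)))"
    unfolding Re_half_coth(2) r_def[symmetric] by simp
  finally show ?thesis .
qed

text \<open>A crude bound for the whole rectangle: down to depth pi both terms of the numerator are
  nonnegative, and below it the previous bound is at least - (pi + b) sin b.\<close>

lemma Re_half_coth_ge':
  fixes s v :: real
  assumes s: "s > 0" and v: "0 \<le> v" "v \<le> 3 * pi / 2"
  shows "- (2 * pi) \<le> Re ((half_strip s v) * half_coth (half_strip s v))"
proof (cases "v \<le> pi")
  case True
  have r: "(exp (- s))\<^sup>2 \<le> 1" using s by (simp add: power_le_one)
  have "2 * exp (- s) * cos v \<le> 2 * exp (- s) * 1" by (intro mult_left_mono) auto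
  moreover have "0 \<le> 1 - 2 * exp (- s) + (exp (- s))\<^sup>2"
    using zero_le_power2[of "1 - exp (- s)"] by (simp add: power2_diff)
  ultimately have "0 \<le> 1 - 2 * exp (- s) * cos v + (exp (- s))\<^sup>2" by linarith
  moreover have "0 \<le> s * (1 - (exp (- s))\<^sup>2) + 2 * v * exp (- s) * sin v"
    using s r v True sin_ge_zero[of v] by (intro add_nonneg_nonneg mult_nonneg_nonneg) auto
  ultimately have "0 \<le> Re ((half_strip s v) * half_coth (half_strip s v))"
    unfolding Re_half_coth(2) by (rule divide_nonneg_nonneg[rotated])
  then show ?thesis using pi_gt_zero by linarith
next
  case False
  define b where "b = v - pi"
  have b: "0 \<le> b" "b \<le> pi / 2" "v = pi + b" using False v by (auto simp: b_def)
  have "(pi + b) * sin b / (1 + cos b) \<le> (pi + b) * sin b"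
    using b sin_ge_zero[of b] cos_ge_zero[of b] pi_gt_zero divide_left_mono[of 1 "1 + cos b" "(pi + b) * sin b"] by simp
  also have "\<dots> \<le> (2 * pi) * 1" using b pi_gt_zero sin_ge_zero[of b] by (intro mult_mono) auto
  finally show ?thesis using Re_half_coth_ge[OF s b(1,2)] unfolding b(3) by linarith
qed

lemma norm_levy_kernel:
  "norm (levy_kernel a c (half_strip s v)) =
    exp (- v * a) * norm (levy_root (half_strip s v)) * exp (- c * Re ((half_strip s v) * half_coth (half_strip s v)))"
proof -
  have "Re (- \<i> * (half_strip s v) * of_real a) = - v * a" by simp
  moreover have "Re (- of_real c * (half_strip s v) * half_coth (half_strip s v)) = - c * Re ((half_strip s v) * half_coth (half_strip s v))"
    unfolding mult.assoc by (simp add: algebra_simps)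
  ultimately show ?thesis unfolding levy_kernel_def norm_mult norm_exp_eq_Re by (simp only:)
qed

text \<open>For fixed \<open>a\<close> and \<open>c\<close> both exponentials are bounded on the
  rectangle, so domination reduces to estimating \<open>levy_root\<close>.\<close>

lemma norm_levy_kernel_le:
  assumes s: "s > 0" and v: "0 \<le> v" "v \<le> 3 * pi / 2" and c: "c \<ge> 0"
  shows "norm (levy_kernel a c (half_strip s v)) \<le> exp (2 * pi * (\<bar>a\<bar> + c)) * norm (levy_root (half_strip s v))"
proof -
  let ?x = "Re ((half_strip s v) * half_coth (half_strip s v))"
  have 1: "- v * a \<le> 2 * pi * \<bar>a\<bar>"
  proof -
    have "- v * a \<le> \<bar>- v * a\<bar>" by simp
    also have "\<dots> = v * \<bar>a\<bar>" using v by (simp add: abs_mult)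
    also have "\<dots> \<le> 2 * pi * \<bar>a\<bar>" using v pi_gt_zero by (intro mult_right_mono) auto
    finally show ?thesis .
  qed
  have 2: "- c * ?x \<le> 2 * pi * c"
    using mult_left_mono[OF Re_half_coth_ge'[OF s v] c] by (simp add: mult.commute)
  have "exp (- v * a) * norm (levy_root (half_strip s v)) * exp (- c * ?x) =
    exp (- v * a + - c * ?x) * norm (levy_root (half_strip s v))"
    unfolding exp_add by (simp only: mult_ac)
  also have "\<dots> \<le> exp (2 * pi * (\<bar>a\<bar> + c)) * norm (levy_root (half_strip s v))"
    using 1 2 by (intro mult_right_mono) (auto simp: distrib_left)
  finally show ?thesis unfolding norm_levy_kernel .
qed


text \<open>Jordan's inequality, from concavity of the sine on [0, pi]: the chord from 0 to pi / 2
  has slope 2 / pi. It is applied to v and to the distance from v to pi.\<close>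

lemma abs_sin_ge:
  fixes v :: real
  assumes "0 \<le> v" "v \<le> 3 * pi / 2"
  shows "v \<le> pi / 2 \<Longrightarrow> 2 / pi * v \<le> \<bar>sin v\<bar>" "pi / 2 \<le> v \<Longrightarrow> 2 / pi * \<bar>v - pi\<bar> \<le> \<bar>sin v\<bar>"
proof -
  have *: "2 / pi * x \<le> sin x" if "0 \<le> x" "x \<le> pi / 2" for x
  proof -
    have "concave_on {0..pi} sin"
      unfolding concave_on_def
    proof (rule f''_ge0_imp_convex)
      show "((\<lambda>x. - sin x) has_real_derivative - cos x) (at x)" for x by (auto intro!: derivative_eq_intros)
      show "((\<lambda>x. - cos x) has_real_derivative sin x) (at x)" for x by (auto intro!: derivative_eq_intros)
    qed (auto intro: sin_ge_zero)
    then have "(1 - 2 * x / pi) * sin 0 + (2 * x / pi) * sin (pi / 2) \<le> sin ((1 - 2 * x / pi) *\<^sub>R 0 + (2 * x / pi) *\<^sub>R (pi / 2))"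
      using that by (intro concave_onD) (auto simp: field_simps)
    then show ?thesis by simp
  qed
  show "v \<le> pi / 2 \<Longrightarrow> 2 / pi * v \<le> \<bar>sin v\<bar>" using *[of v] assms by auto
  show "pi / 2 \<le> v \<Longrightarrow> 2 / pi * \<bar>v - pi\<bar> \<le> \<bar>sin v\<bar>"
  proof -
    assume v: "pi / 2 \<le> v"
    have "\<bar>sin v\<bar> = \<bar>sin (v - pi)\<bar>" by (simp add: sin_diff)
    also have "\<dots> = \<bar>sin \<bar>v - pi\<bar>\<bar>" by (auto simp: abs_if)
    finally have eq: "\<bar>sin v\<bar> = \<bar>sin \<bar>v - pi\<bar>\<bar>" .
    have "\<bar>v - pi\<bar> \<le> pi / 2" using assms v by linarith
    from *[OF abs_ge_zero this] show ?thesis unfolding eq by linarith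
  qed
qed

text \<open>Uniform in s, hence a dominating function when the left side moves onto the imaginary
  axis. At v = 0 the quotient v / sin v stays bounded; at v = pi it has a simple pole, and the root
  leaves an integrable singularity. The number 64 is generous and a perfect square.\<close>

lemma levy_root_bound_left:
  fixes s v :: real
  assumes s: "0 < s" "s \<le> 1" and v: "0 < v" "v \<le> 3 * pi / 2" "v \<noteq> pi"
  shows "norm (levy_root (half_strip s v)) \<le> 8 * (1 / sqrt \<bar>v - pi\<bar>)"
proof -
  have d: "0 < \<bar>v - pi\<bar>" "\<bar>v - pi\<bar> \<le> pi" using v by auto
  have pi4: "pi < 4" "3 < pi" using pi_less_4 pi_gt3 by auto
  have "sin v \<noteq> 0 \<and> 3 + v / \<bar>sin v\<bar> \<le> 64 / \<bar>v - pi\<bar>"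
  proof (cases "v \<le> pi / 2")
    case True
    have l: "2 / pi * v \<le> \<bar>sin v\<bar>" using abs_sin_ge(1)[of v] v True by simp
    have p: "0 < 2 / pi * v" using v by simp
    have sp: "0 < \<bar>sin v\<bar>" using p l by (rule less_le_trans)
    have "v / \<bar>sin v\<bar> \<le> v / (2 / pi * v)"
      by (rule divide_left_mono[OF l _ mult_pos_pos[OF sp p]]) (use v in simp)
    also have "\<dots> = pi / 2" using v by simp
    finally have "v / \<bar>sin v\<bar> \<le> pi / 2" .
    then have "3 + v / \<bar>sin v\<bar> \<le> 8" using pi4 by linarith
    also have "\<dots> \<le> 64 / \<bar>v - pi\<bar>" using d pi4 by (simp add: le_divide_eq)
    finally have "3 + v / \<bar>sin v\<bar> \<le> 64 / \<bar>v - pi\<bar>" .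
    then show ?thesis using sp by simp
  next
    case False
    have l: "2 / pi * \<bar>v - pi\<bar> \<le> \<bar>sin v\<bar>" using abs_sin_ge(2)[of v] v False by simp
    have p: "0 < 2 / pi * \<bar>v - pi\<bar>" using d by simp
    have sp: "0 < \<bar>sin v\<bar>" using p l by (rule less_le_trans)
    have "v / \<bar>sin v\<bar> \<le> v / (2 / pi * \<bar>v - pi\<bar>)"
      by (rule divide_left_mono[OF l _ mult_pos_pos[OF sp p]]) (use v in simp)
    also have "\<dots> = (v * pi / 2) / \<bar>v - pi\<bar>" by simp
    also have "\<dots> \<le> (6 * 4 / 2) / \<bar>v - pi\<bar>"
      using v pi4 d by (intro divide_right_mono mult_mono) auto
    finally have "3 + v / \<bar>sin v\<bar> \<le> 12 / \<bar>v - pi\<bar> + 12 / \<bar>v - pi\<bar>"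
      using d pi4 by (intro add_mono) (auto simp: le_divide_eq)
    also have "\<dots> \<le> 64 / \<bar>v - pi\<bar>" using d by (simp add: add_divide_distrib[symmetric] divide_right_mono)
    finally have "3 + v / \<bar>sin v\<bar> \<le> 64 / \<bar>v - pi\<bar>" .
    then show ?thesis using sp by simp
  qed
  then have "norm (levy_root (half_strip s v)) \<le> sqrt (64 / \<bar>v - pi\<bar>)"
    using levy_root_bound_sin[OF s, of v] v by (auto intro: order.trans)
  also have "\<dots> = 8 * (1 / sqrt \<bar>v - pi\<bar>)"
    using real_sqrt_unique[of 8 64] by (simp add: real_sqrt_divide)
  finally show ?thesis .
qed

text \<open>Strictly below the branch point sin (pi + b) is not 0, so the sine bound handles s < 1;
  for s >= 1 the exponential bound applies. The constant adds both, with a factor 2 to insert exp (-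
  s / 4) >= 1 / 2.\<close>

lemma levy_root_bound_bottom:
  fixes s b :: real
  assumes b: "0 < b" "b \<le> pi / 2"
  obtains K where "\<And>s. s > 0 \<Longrightarrow> norm (levy_root (half_strip s (pi + b))) \<le> K * exp (- s / 4)"
proof -
  have sb: "sin b > 0" using b pi_gt_zero by (intro sin_gt_zero) auto
  define K where "K = 8 * (1 + (pi + b)) + 2 * sqrt (3 + (pi + b) / sin b)"
  have "norm (levy_root (half_strip s (pi + b))) \<le> K * exp (- s / 4)" if s: "s > 0" for s
  proof (cases "s \<ge> 1")
    case True
    have "s + (pi + b) \<le> (1 + (pi + b)) * s"
      using True b pi_gt_zero mult_left_mono[of 1 s "pi + b"] by (simp add: distrib_right)
    then have "norm (levy_root (half_strip s (pi + b))) \<le> 8 * (1 + (pi + b)) * exp (- s / 4)"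
      using b pi_gt_zero by (intro levy_root_bound_large[where V="pi + b"] s) auto
    also have "\<dots> \<le> K * exp (- s / 4)" using sb b pi_gt_zero by (intro mult_right_mono) (auto simp: K_def)
    finally show ?thesis .
  next
    case False
    have "1 / 2 \<le> exp (- s / 4)" using exp_ge_add_one_self[of "- s / 4"] False by linarith
    then have e: "1 \<le> 2 * exp (- s / 4)" by simp
    have "norm (levy_root (half_strip s (pi + b))) \<le> sqrt (3 + (pi + b) / sin b)"
      using levy_root_bound_sin[of s "pi + b"] s False b sb pi_gt_zero by simp
    also have "\<dots> \<le> sqrt (3 + (pi + b) / sin b) * (2 * exp (- s / 4))"
      using mult_left_mono[OF e, of "sqrt (3 + (pi + b) / sin b)"] sb b pi_gt_zero by simp
    also have "\<dots> \<le> K * exp (- s / 4)" using b pi_gt_zero by (simp add: K_def distrib_right)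
    finally show ?thesis .
  qed
  then show ?thesis using that by blast
qed

section \<open>Boundary values of the kernel on the imaginary axis\<close>

lemma csqrt_one_minus_exp:
  fixes v :: real
  shows "0 < v \<Longrightarrow> v < pi \<Longrightarrow> csqrt (1 - exp (2 * \<i> * of_real v)) = of_real (sqrt (2 * sin v)) * exp (\<i> * of_real (v / 2 - pi / 4))"
    "pi < v \<Longrightarrow> v < 2 * pi \<Longrightarrow> csqrt (1 - exp (2 * \<i> * of_real v)) = of_real (sqrt (- 2 * sin v)) * exp (\<i> * of_real (v / 2 - 3 * pi / 4))"
proof -
  have e: "1 - exp (2 * \<i> * of_real v) = of_real (- 2 * sin v) * (\<i> * exp (\<i> * of_real v))"
  proof -
    have 1: "exp (2 * \<i> * of_real v) = cis (2 * v)" and 2: "exp (\<i> * of_real v) = cis v"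
      by (simp_all add: cis_conv_exp mult_ac)
    show ?thesis
      unfolding 1 2 by (simp add: complex_eq_iff cos_double_sin sin_double power2_eq_square)
  qed
  have re: "Re (of_real r * exp (\<i> * of_real x)) = r * cos x" for r x :: real
    by (simp add: cis_conv_exp[symmetric])
  \<comment> \<open>The angle v / 2 - pi / 4 lies between - pi / 4 and pi / 4, which identifies the
    principal root.\<close>
  show "csqrt (1 - exp (2 * \<i> * of_real v)) = of_real (sqrt (2 * sin v)) * exp (\<i> * of_real (v / 2 - pi / 4))"
    if v: "0 < v" "v < pi"
  proof (rule csqrt_unique)
    have s: "sin v > 0" using v by (rule sin_gt_zero)
    have "(of_real (sqrt (2 * sin v)) * exp (\<i> * of_real (v / 2 - pi / 4)))\<^sup>2 = of_real (2 * sin v) * (exp (\<i> * of_real v) * exp (- (\<i> * of_real pi / 2)))"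
      using s unfolding power_mult_distrib of_real_power[symmetric] exp_double[symmetric] exp_add[symmetric]
      by (simp add: algebra_simps)
    also have "exp (- (\<i> * of_real pi / 2)) = - \<i>"
      using cis_conv_exp[of "- pi / 2"] by (simp add: complex_eq_iff)
    finally show "(of_real (sqrt (2 * sin v)) * exp (\<i> * of_real (v / 2 - pi / 4)))\<^sup>2 = 1 - exp (2 * \<i> * of_real v)"
      unfolding e by simp
    have "cos (v / 2 - pi / 4) > 0" using v by (intro cos_gt_zero_pi) auto
    then show "0 < Re (of_real (sqrt (2 * sin v)) * exp (\<i> * of_real (v / 2 - pi / 4))) \<or> Re (of_real (sqrt (2 * sin v)) * exp (\<i> * of_real (v / 2 - pi / 4))) = 0 \<and> 0 \<le> Im (of_real (sqrt (2 * sin v)) * exp (\<i> * of_real (v / 2 - pi / 4)))"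
      unfolding re using s by simp
  qed
  \<comment> \<open>At v = pi the argument of the root passes through 0. Past it, the angle that
    lies between - pi / 4 and pi / 4 is smaller by pi / 2, and this jump is the source of the factor
    \<i>.\<close>
  show "csqrt (1 - exp (2 * \<i> * of_real v)) = of_real (sqrt (- 2 * sin v)) * exp (\<i> * of_real (v / 2 - 3 * pi / 4))"
    if v: "pi < v" "v < 2 * pi"
  proof (rule csqrt_unique)
    have s: "sin v < 0" using v by (intro sin_lt_zero) auto
    have "(of_real (sqrt (- 2 * sin v)) * exp (\<i> * of_real (v / 2 - 3 * pi / 4)))\<^sup>2 = of_real (- 2 * sin v) * (exp (\<i> * of_real v) * exp (- (\<i> * of_real (3 * pi / 2))))"
      using s unfolding power_mult_distrib of_real_power[symmetric] exp_double[symmetric] exp_add[symmetric]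
      by (simp add: algebra_simps)
    also have "exp (- (\<i> * of_real (3 * pi / 2))) = \<i>"
      using cis_conv_exp[of "- (3 * pi / 2)"] cos_3over2_pi sin_3over2_pi by (simp add: complex_eq_iff)
    finally show "(of_real (sqrt (- 2 * sin v)) * exp (\<i> * of_real (v / 2 - 3 * pi / 4)))\<^sup>2 = 1 - exp (2 * \<i> * of_real v)"
      unfolding e by simp
    have "cos (v / 2 - 3 * pi / 4) > 0" using v by (intro cos_gt_zero_pi) auto
    then show "0 < Re (of_real (sqrt (- 2 * sin v)) * exp (\<i> * of_real (v / 2 - 3 * pi / 4))) \<or> Re (of_real (sqrt (- 2 * sin v)) * exp (\<i> * of_real (v / 2 - 3 * pi / 4))) = 0 \<and> 0 \<le> Im (of_real (sqrt (- 2 * sin v)) * exp (\<i> * of_real (v / 2 - 3 * pi / 4)))"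
      unfolding re using s by (simp add: mult_pos_pos)
  qed
qed

lemma csqrt_minus_i:
  fixes v :: real
  assumes "v > 0"
  shows "csqrt (- 2 * \<i> * of_real v) = of_real (sqrt (2 * v)) * exp (- (\<i> * of_real (pi / 4)))"
proof (rule csqrt_unique)
  have "exp (- (\<i> * of_real (pi / 4))) ^ 2 = - \<i>"
    using cis_conv_exp[of "- pi / 2"] unfolding exp_double[symmetric] by (simp add: complex_eq_iff)
  then show "(of_real (sqrt (2 * v)) * exp (- (\<i> * of_real (pi / 4))))\<^sup>2 = - 2 * \<i> * of_real v"
    using assms unfolding power_mult_distrib of_real_power[symmetric] by (simp add: mult_ac)
  have "Re (exp (- (\<i> * of_real (pi / 4)))) > 0"
  proof -
    have "exp (- (\<i> * of_real (pi / 4))) = cis (- (pi / 4))" by (simp add: cis_conv_exp)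
    then show ?thesis using cos_gt_zero_pi[of "pi / 4"] by simp
  qed
  then show "0 < Re (of_real (sqrt (2 * v)) * exp (- (\<i> * of_real (pi / 4)))) \<or> Re (of_real (sqrt (2 * v)) * exp (- (\<i> * of_real (pi / 4)))) = 0 \<and> 0 \<le> Im (of_real (sqrt (2 * v)) * exp (- (\<i> * of_real (pi / 4))))"
    using assms by simp
qed

text \<open>Numerator and denominator carry the same phase for v < pi, leaving a positive number;
  past pi the denominator lags by a quarter turn, leaving \<i> times a positive number.\<close>

lemma levy_root_imaginary:
  fixes v :: real
  shows "0 < v \<Longrightarrow> v < pi \<Longrightarrow> levy_root (- \<i> * of_real v) = of_real (sqrt (v / sin v))"
    "pi < v \<Longrightarrow> v < 2 * pi \<Longrightarrow> levy_root (- \<i> * of_real v) = \<i> * of_real (sqrt (v / - sin v))"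
proof -
  have c: "csqrt (2 * (- \<i> * of_real v)) = of_real (sqrt (2 * v)) * exp (- (\<i> * of_real (pi / 4)))" if "v > 0"
  proof -
    have "2 * (- \<i> * complex_of_real v) = - 2 * \<i> * of_real v" by (simp add: complex_eq_iff)
    then show ?thesis using csqrt_minus_i[OF that] by (simp only:)
  qed
  have e1: "exp (- (- \<i> * of_real v) / 2) = exp (\<i> * of_real (v / 2))" by simp
  have e2: "exp (- 2 * (- \<i> * of_real v)) = exp (2 * \<i> * of_real v)" by (simp add: mult.assoc)
  show "levy_root (- \<i> * of_real v) = of_real (sqrt (v / sin v))" if v: "0 < v" "v < pi"
  proof -
    have s: "sin v > 0" using v by (rule sin_gt_zero)
    have "levy_root (- \<i> * of_real v) = of_real (sqrt (2 * v)) * exp (- (\<i> * of_real (pi / 4))) * exp (\<i> * of_real (v / 2)) / (of_real (sqrt (2 * sin v)) * exp (\<i> * of_real (v / 2 - pi / 4)))"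
      unfolding levy_root_def c[OF v(1)] e1 e2 csqrt_one_minus_exp(1)[OF v] ..
    also have "exp (\<i> * of_real (v / 2 - pi / 4)) = exp (- (\<i> * of_real (pi / 4))) * exp (\<i> * complex_of_real (v / 2))"
      unfolding exp_add[symmetric] by (simp add: algebra_simps)
    also have "of_real (sqrt (2 * v)) * exp (- (\<i> * of_real (pi / 4))) * exp (\<i> * of_real (v / 2)) / (of_real (sqrt (2 * sin v)) * (exp (- (\<i> * of_real (pi / 4))) * exp (\<i> * complex_of_real (v / 2))))
      = complex_of_real (sqrt (2 * v) / sqrt (2 * sin v))" by simp
    also have "sqrt (2 * v) / sqrt (2 * sin v) = sqrt (v / sin v)"
      by (simp add: real_sqrt_mult real_sqrt_divide)
    finally show ?thesis .
  qed
  show "levy_root (- \<i> * of_real v) = \<i> * of_real (sqrt (v / - sin v))" if v: "pi < v" "v < 2 * pi"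
  proof -
    have s: "sin v < 0" using v by (intro sin_lt_zero) auto
    have v0: "v > 0" using v pi_gt_zero by linarith
    have "levy_root (- \<i> * of_real v) = of_real (sqrt (2 * v)) * exp (- (\<i> * of_real (pi / 4))) * exp (\<i> * of_real (v / 2)) / (of_real (sqrt (- 2 * sin v)) * exp (\<i> * of_real (v / 2 - 3 * pi / 4)))"
      unfolding levy_root_def c[OF v0] e1 e2 csqrt_one_minus_exp(2)[OF v] ..
    also have "exp (- (\<i> * of_real (pi / 4))) = \<i> * exp (- (\<i> * complex_of_real (3 * pi / 4)))"
    proof -
      have "\<i> = exp (\<i> * of_real (pi / 2))" using cis_conv_exp[of "pi / 2"] by (simp add: complex_eq_iff)
      then have "\<i> * exp (- (\<i> * complex_of_real (3 * pi / 4))) = exp (\<i> * of_real (pi / 2) + - (\<i> * complex_of_real (3 * pi / 4)))"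
        unfolding exp_add by metis
      also have "\<i> * of_real (pi / 2) + - (\<i> * complex_of_real (3 * pi / 4)) = - (\<i> * of_real (pi / 4))"
        by (simp add: complex_eq_iff)
      finally show ?thesis ..
    qed
    also have "exp (\<i> * of_real (v / 2 - 3 * pi / 4)) = exp (- (\<i> * of_real (3 * pi / 4))) * exp (\<i> * complex_of_real (v / 2))"
      unfolding exp_add[symmetric] by (simp add: algebra_simps)
    also have "of_real (sqrt (2 * v)) * (\<i> * exp (- (\<i> * complex_of_real (3 * pi / 4)))) * exp (\<i> * of_real (v / 2)) / (of_real (sqrt (- 2 * sin v)) * (exp (- (\<i> * of_real (3 * pi / 4))) * exp (\<i> * complex_of_real (v / 2))))
      = \<i> * complex_of_real (sqrt (2 * v) / sqrt (- 2 * sin v))" by simp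
    also have "sqrt (2 * v) / sqrt (- 2 * sin v) = sqrt (v / - sin v)"
      unfolding real_sqrt_divide[symmetric] by (rule arg_cong[where f=sqrt]) simp
    finally show ?thesis .
  qed
qed

text \<open>On the imaginary axis \<open>half_coth\<close> is purely imaginary, so both exponents of
  the kernel are real and only the root can carry a phase.\<close>

lemma levy_kernel_imaginary:
  fixes a c v :: real
  shows "levy_kernel a c (- \<i> * of_real v) = of_real (exp (- v * a) * exp (- c * (v * sin v / (1 - cos v)))) * levy_root (- \<i> * of_real v)"
proof -
  have h: "half_coth (- \<i> * of_real v) = \<i> * of_real (sin v / (1 - cos v))"
  proof -
    have "2 * sin v / (2 - 2 * cos v) = (2 * sin v) / (2 * (1 - cos v))" by simp
    also have "\<dots> = sin v / (1 - cos v)" by (rule mult_divide_mult_cancel_left) simp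
    finally show ?thesis using Re_half_coth(1)[of 0 v] by (simp add: complex_eq_iff)
  qed
  have 1: "exp (- \<i> * (- \<i> * of_real v) * of_real a) = of_real (exp (- v * a))"
    unfolding exp_of_real[symmetric] by (rule arg_cong[where f=exp]) (simp add: complex_eq_iff)
  have 2: "exp (- of_real c * (- \<i> * of_real v) * half_coth (- \<i> * of_real v)) = of_real (exp (- c * (v * sin v / (1 - cos v))))"
    unfolding exp_of_real[symmetric] h by (rule arg_cong[where f=exp]) (simp add: complex_eq_iff)
  show ?thesis unfolding levy_kernel_def 1 2 by simp
qed

text \<open>At - \<i> v the quantity 1 - exp (- 2 l) has real part 2 (sin v)^2 > 0, so the kernel
  extends continuously to these boundary points.\<close>

lemma levy_kernel_left_limit:
  fixes a c v :: real
  assumes v: "sin v \<noteq> 0" "v > 0"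
  shows "(\<lambda>n. levy_kernel a c (half_strip (1 / Suc n) v)) \<longlonglongrightarrow> levy_kernel a c (- \<i> * of_real v)"
proof -
  let ?l = "- \<i> * complex_of_real v"
  have lim: "(\<lambda>n. half_strip (1 / Suc n) v) \<longlonglongrightarrow> ?l"
    using tendsto_diff[OF tendsto_of_real[OF LIMSEQ_Suc[OF lim_1_over_n]] tendsto_const, of "\<i> * of_real v"] by simp
  have c1: "cos v \<noteq> 1"
  proof
    assume "cos v = 1"
    then show False using v sin_squared_eq[of v] by simp
  qed
  have n1: "2 * ?l \<notin> \<real>\<^sub>\<le>\<^sub>0" using v by (simp add: complex_nonpos_Reals_iff)
  have e2: "exp (- (2 * ?l)) = cis (2 * v)" by (simp add: cis_conv_exp mult_ac)
  have n2: "1 - exp (- (2 * ?l)) \<notin> \<real>\<^sub>\<le>\<^sub>0"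
  proof -
    have "Re (1 - exp (- (2 * ?l))) = 2 * (sin v)\<^sup>2" unfolding e2 by (simp add: cos_double_sin)
    then have "Re (1 - exp (- (2 * ?l))) > 0" using v by simp
    then show ?thesis by (auto simp: complex_nonpos_Reals_iff)
  qed
  have n3: "1 - exp (- ?l) \<noteq> 0"
  proof -
    have "exp (- ?l) = cis v" by (simp add: cis_conv_exp)
    then show ?thesis using c1 by (auto simp: complex_eq_iff)
  qed
  have n4: "csqrt (1 - exp (- (2 * ?l))) \<noteq> 0" using n2 by auto
  have A1: "isCont (\<lambda>l. csqrt (2 * l)) ?l"
    by (rule isCont_o2[where g=csqrt]) (use n1 in \<open>auto intro: continuous_at_csqrt\<close>)
  have A2: "isCont (\<lambda>l. csqrt (1 - exp (- 2 * l))) ?l"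
    by (rule isCont_o2[where g=csqrt]) (use n2 in \<open>auto intro: continuous_at_csqrt\<close>)
  have "isCont (\<lambda>l. levy_kernel a c l) ?l"
    unfolding levy_kernel_def levy_root_def half_coth_def
    using n3 n4 by (intro isCont_mult isCont_divide isCont_add isCont_diff isCont_exp' isCont_minus A1 A2 continuous_const continuous_ident) auto
  from isCont_tendsto_compose[OF this lim] show ?thesis .
qed

text \<open>The rectangle identity for the left side at 1 / (n + 1) and the right side at n + 1. The
  right side vanishes exponentially, the left side converges to the imaginary axis by domination,
  and the real part of - \<i> times an integral is the imaginary part of that integral.\<close>

theorem levy_contour:
  fixes a b c :: real
  assumes b: "0 < b" "b \<le> pi / 2" and c: "c \<ge> 0"
  defines "V \<equiv> pi + b"
  shows "Re (LINT s|lborel. indicator {0<..} s *\<^sub>R levy_kernel a c (of_real s)) =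
    (LINT v|lborel. indicator {pi<..<V} v * (exp (- v * a) * exp (- c * (v * sin v / (1 - cos v))) * sqrt (v / - sin v)))
    + Re (LINT s|lborel. indicator {0<..} s *\<^sub>R levy_kernel a c (half_strip s V))"
proof -
  let ?G = "levy_kernel a c"
  define E where "E = exp (2 * pi * (\<bar>a\<bar> + c))"
  have E: "E > 0" by (simp add: E_def)
  have V: "0 \<le> V" "V \<le> 3 * pi / 2" "pi < V" "V < pi + 4" using b pi_gt_zero pi_less_4 by (auto simp: V_def)
  have pi4: "pi < 4" using pi_less_4 .
  define r where "r = (\<lambda>n. 1 / real (Suc n))"
  define R where "R = (\<lambda>n. real (Suc n))"
  have r: "0 < r n" "r n \<le> 1" "r n \<le> R n" "1 \<le> R n" for n
  proof -
    show 1: "0 < r n" "r n \<le> 1" "1 \<le> R n" by (auto simp: r_def R_def divide_le_eq)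
    show "r n \<le> R n" using 1 by linarith
  qed
  have r0: "r \<longlonglongrightarrow> 0" unfolding r_def by (rule LIMSEQ_Suc[OF lim_1_over_n])
  have Rinf: "filterlim R at_top sequentially" unfolding R_def by real_asymp
  have kb: "norm (?G (half_strip s v)) \<le> E * norm (levy_root (half_strip s v))"
    if "s > 0" "0 \<le> v" "v \<le> V" for s v
    unfolding E_def using norm_levy_kernel_le[of s v c a] that V c by simp
  have cont: "continuous_on {l. Re l > 0} ?G"
    by (rule holomorphic_on_imp_continuous_on[OF levy_kernel_holomorphic])
  have ch: "continuous_on {0<..} (\<lambda>s. ?G (half_strip s v))" for v
    by (rule continuous_on_compose2[OF cont]) (auto intro!: continuous_intros)
  have cv: "continuous_on UNIV (\<lambda>v. ?G (half_strip s v))" if "s > 0" for s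
    by (rule continuous_on_compose2[OF cont]) (use that in \<open>auto intro!: continuous_intros\<close>)
  have hm: "(\<lambda>s. indicator {0<..} s *\<^sub>R ?G (half_strip s v)) \<in> borel_measurable lborel" for v
    using borel_measurable_continuous_on_indicator[OF _ ch[of v]] by simp
  have hm2: "(\<lambda>s. indicator {r n..R n} s *\<^sub>R ?G (half_strip s v)) \<in> borel_measurable lborel" for v n
  proof -
    have "{r n..R n} \<subseteq> {0<..}" using r(1)[of n] by (auto intro: less_le_trans)
    from borel_measurable_continuous_on_indicator[OF _ continuous_on_subset[OF ch[of v] this]] show ?thesis by simp
  qed
  have vm: "(\<lambda>v. indicator {0..V} v *\<^sub>R ?G (half_strip s v)) \<in> borel_measurable lborel" if "s > 0" for s
    using borel_measurable_continuous_onI[OF cv[OF that]] by simp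
  have ind: "(\<lambda>n. indicator {r n..R n} s :: real) \<longlonglongrightarrow> indicator {0<..} s" for s
  proof (cases "s > 0")
    case True
    have "eventually (\<lambda>n. r n < s) sequentially" using order_tendstoD(2)[OF r0 True] .
    moreover have "eventually (\<lambda>n. s < R n) sequentially" using Rinf by (auto simp: filterlim_at_top_dense)
    ultimately have "eventually (\<lambda>n. indicator {r n..R n} s = (indicator {0<..} s :: real)) sequentially"
      by eventually_elim (use True in auto)
    then show ?thesis by (rule tendsto_eventually)
  next
    case False
    then have "indicator {r n..R n} s = (0::real)" for n using r(1)[of n] by (auto simp: indicator_def)
    then show ?thesis using False by simp
  qed
  have hor: "(\<lambda>n. LINT s|lborel. indicator {r n..R n} s *\<^sub>R ?G (half_strip s v)) \<longlonglongrightarrow> (LINT s|lborel. indicator {0<..} s *\<^sub>R ?G (half_strip s v))"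
    if v: "0 \<le> v" "v \<le> V" and K: "\<And>s. s > 0 \<Longrightarrow> norm (levy_root (half_strip s v)) \<le> K * exp (- s / 4)" for v K
  proof (rule integral_dominated_convergence[where w="\<lambda>s. E * K * (indicator {0<..} s * exp (- (1/4) * s))", OF hm hm2])
    show "integrable lborel (\<lambda>s. E * K * (indicator {0<..} s * exp (- (1/4) * s)))"
      by (intro integrable_mult_right integrable_exp_decay) simp
    show "AE s in lborel. (\<lambda>n. indicator {r n..R n} s *\<^sub>R ?G (half_strip s v)) \<longlonglongrightarrow> indicator {0<..} s *\<^sub>R ?G (half_strip s v)"
      by (intro AE_I2 tendsto_scaleR ind tendsto_const)
    show "AE s in lborel. norm (indicator {r n..R n} s *\<^sub>R ?G (half_strip s v)) \<le> E * K * (indicator {0<..} s * exp (- (1/4) * s))" for n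
    proof (rule AE_I2)
      fix s :: real
      show "norm (indicator {r n..R n} s *\<^sub>R ?G (half_strip s v)) \<le> E * K * (indicator {0<..} s * exp (- (1/4) * s))"
      proof (cases "s > 0")
        case True
        have "norm (?G (half_strip s v)) \<le> E * (K * exp (- s / 4))"
          using kb[OF True v] K[OF True] E by (meson mult_left_mono less_imp_le order.trans)
        moreover have "indicator {r n..R n} s * norm (?G (half_strip s v)) \<le> norm (?G (half_strip s v))"
          by (simp add: indicator_def)
        ultimately show ?thesis using True by simp
      next
        case False
        then show ?thesis using r(1)[of n] by (auto simp: indicator_def)
      qed
    qed
  qed
  \<comment> \<open>The real axis is the horizontal line at depth 0, so the same limit argument
    serves both horizontal sides.\<close>
  have top: "(\<lambda>n. LINT s|lborel. indicator {r n..R n} s *\<^sub>R ?G (of_real s)) \<longlonglongrightarrow> (LINT s|lborel. indicator {0<..} s *\<^sub>R ?G (of_real s))"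
    using hor[of 0 "8 * 1"] levy_root_bound_large[of _ 0 0 1] V by simp
  obtain K where "\<And>s. s > 0 \<Longrightarrow> norm (levy_root (half_strip s (pi + b))) \<le> K * exp (- s / 4)"
    using levy_root_bound_bottom[OF b] by blast
  then have bot: "(\<lambda>n. LINT s|lborel. indicator {r n..R n} s *\<^sub>R ?G (half_strip s V)) \<longlonglongrightarrow> (LINT s|lborel. indicator {0<..} s *\<^sub>R ?G (half_strip s V))"
    using hor[of V K] V by (simp add: V_def)
  have right: "(\<lambda>n. LINT v|lborel. indicator {0..V} v *\<^sub>R ?G (half_strip (R n) v)) \<longlonglongrightarrow> integral\<^sup>L (lborel :: real measure) (\<lambda>v. 0 :: complex)"
  proof (rule integral_dominated_convergence[where w="\<lambda>v. E * (8 * (1 + V)) * indicator {0..V} v"])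
    have bnd: "norm (indicator {0..V} v *\<^sub>R ?G (half_strip (R n) v)) \<le> E * (8 * (1 + V)) * indicator {0..V} v * exp (- R n / 4)" for n v
    proof (cases "v \<in> {0..V}")
      case True
      have "R n + V \<le> (1 + V) * R n" using mult_left_mono[OF r(4)[of n] V(1)] by (simp add: distrib_right)
      then have "norm (levy_root (half_strip (R n) v)) \<le> 8 * (1 + V) * exp (- R n / 4)"
        using True r(4)[of n] V by (intro levy_root_bound_large[where V=V]) auto
      then have "norm (?G (half_strip (R n) v)) \<le> E * (8 * (1 + V) * exp (- R n / 4))"
        using kb[of "R n" v] True r(4)[of n] E by (smt (verit) mult_left_mono atLeastAtMost_iff)
      then show ?thesis using True by (simp add: mult.assoc)
    qed simp
    show "AE v in lborel. (\<lambda>n. indicator {0..V} v *\<^sub>R ?G (half_strip (R n) v)) \<longlonglongrightarrow> 0"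
    proof (rule AE_I2)
      fix v :: real
      have "(\<lambda>n. exp (- R n / 4)) \<longlonglongrightarrow> 0" unfolding R_def by real_asymp
      from tendsto_mult_right_zero[OF this, of "E * (8 * (1 + V)) * indicator {0..V} v"]
      show "(\<lambda>n. indicator {0..V} v *\<^sub>R ?G (half_strip (R n) v)) \<longlonglongrightarrow> 0"
        by (rule Lim_null_comparison[rotated]) (use bnd in \<open>auto intro!: always_eventually\<close>)
    qed
    show "AE v in lborel. norm (indicator {0..V} v *\<^sub>R ?G (half_strip (R n) v)) \<le> E * (8 * (1 + V)) * indicator {0..V} v" for n
    proof (rule AE_I2)
      fix v
      have "exp (- R n / 4) \<le> 1" using r(4)[of n] by simp
      then have "E * (8 * (1 + V)) * indicator {0..V} v * exp (- R n / 4) \<le> E * (8 * (1 + V)) * indicator {0..V} v * 1"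
        using E V(1) by (intro mult_left_mono) auto
      then show "norm (indicator {0..V} v *\<^sub>R ?G (half_strip (R n) v)) \<le> E * (8 * (1 + V)) * indicator {0..V} v"
        using bnd[of v n] by simp
    qed
    show "integrable lborel (\<lambda>v. E * (8 * (1 + V)) * indicator {0..V} v)"
      by (intro integrable_mult_right integrable_real_indicator) (auto simp: emeasure_lborel_Icc_eq)
    have "R n > 0" for n using r(4)[of n] by simp
    then show "(\<lambda>v. indicator {0..V} v *\<^sub>R ?G (half_strip (R n) v)) \<in> borel_measurable lborel" for n
      by (rule vm)
  qed simp
  define p where "p = (\<lambda>v. exp (- v * a) * exp (- c * (v * sin v / (1 - cos v))))"
  \<comment> \<open>The limit of the left side; the value 0 at the exceptional points 0, pi and V is
    arbitrary.\<close>
  define L where "L = (\<lambda>v. if 0 < v \<and> v < pi then of_real (p v * sqrt (v / sin v)) else if pi < v \<and> v < V then \<i> * of_real (p v * sqrt (v / - sin v)) else 0)"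
  have Lm: "L \<in> borel_measurable lborel" unfolding L_def p_def by measurable
  have Llim: "(\<lambda>n. indicator {0..V} v *\<^sub>R ?G (half_strip (r n) v)) \<longlonglongrightarrow> L v"
    if v: "v \<noteq> 0" "v \<noteq> pi" "v \<noteq> V" for v
  proof (cases "0 < v \<and> v < V")
    case True
    have V2: "V < 2 * pi" using V pi_gt_zero by linarith
    have "sin v \<noteq> 0"
    proof (cases "v < pi")
      case True
      then show ?thesis using sin_gt_zero[of v] \<open>0 < v \<and> v < V\<close> by auto
    next
      case False
      then show ?thesis using sin_lt_zero[of v] \<open>0 < v \<and> v < V\<close> v V2 by auto
    qed
    then have lim: "(\<lambda>n. ?G (half_strip (r n) v)) \<longlonglongrightarrow> ?G (- \<i> * of_real v)"
      unfolding r_def using True by (intro levy_kernel_left_limit) auto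
    moreover have "?G (- \<i> * of_real v) = L v"
    proof (cases "v < pi")
      case True
      then show ?thesis unfolding levy_kernel_imaginary L_def p_def
        using \<open>0 < v \<and> v < V\<close> levy_root_imaginary(1)[of v] by simp
    next
      case False
      then have "pi < v" "v < 2 * pi" using v \<open>0 < v \<and> v < V\<close> V2 by auto
      then show ?thesis unfolding levy_kernel_imaginary L_def p_def
        using \<open>0 < v \<and> v < V\<close> levy_root_imaginary(2)[of v] by simp
    qed
    ultimately show ?thesis using True by simp
  next
    case False
    then have "v \<notin> {0..V}" using v by auto
    moreover have "L v = 0" using False v V pi_gt_zero by (auto simp: L_def)
    ultimately show ?thesis by simp
  qed
  have left: "integrable lborel L" "(\<lambda>n. LINT v|lborel. indicator {0..V} v *\<^sub>R ?G (half_strip (r n) v)) \<longlonglongrightarrow> (LINT v|lborel. L v)"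
  proof -
    \<comment> \<open>The interval of radius 4 about pi contains [0, V] because pi < 4 and b <= pi /
      2.\<close>
    have dom: "AE v in lborel. norm (indicator {0..V} v *\<^sub>R ?G (half_strip (r n) v)) \<le> E * 8 * (indicator {pi - 4<..<pi + 4} v * (1 / sqrt \<bar>v - pi\<bar>))" for n
      using AE_lborel_singleton[of 0] AE_lborel_singleton[of pi]
    proof eventually_elim
      case (elim v)
      show ?case
      proof (cases "v \<in> {0..V}")
        case True
        then have "norm (levy_root (half_strip (r n) v)) \<le> 8 * (1 / sqrt \<bar>v - pi\<bar>)"
          using elim V r[of n] by (intro levy_root_bound_left) auto
        then have "norm (?G (half_strip (r n) v)) \<le> E * (8 * (1 / sqrt \<bar>v - pi\<bar>))"
          using kb[of "r n" v] True r(1)[of n] E by (smt (verit) mult_left_mono atLeastAtMost_iff)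
        moreover have "v \<in> {pi - 4<..<pi + 4}" using True V pi4 by auto
        ultimately show ?thesis using True by simp
      next
        case False
        then show ?thesis using E by simp
      qed
    qed
    have w: "integrable lborel (\<lambda>v. E * 8 * (indicator {pi - 4<..<pi + 4} v * (1 / sqrt \<bar>v - pi\<bar>)))"
      by (intro integrable_mult_right integrable_inverse_sqrt_abs) simp
    have lim: "AE v in lborel. (\<lambda>n. indicator {0..V} v *\<^sub>R ?G (half_strip (r n) v)) \<longlonglongrightarrow> L v"
      using AE_lborel_singleton[of 0] AE_lborel_singleton[of pi] AE_lborel_singleton[of V] by eventually_elim (rule Llim)
    show "integrable lborel L" by (rule integrable_dominated_convergence[OF Lm vm[OF r(1)] w lim dom])
    show "(\<lambda>n. LINT v|lborel. indicator {0..V} v *\<^sub>R ?G (half_strip (r n) v)) \<longlonglongrightarrow> (LINT v|lborel. L v)"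
      by (rule integral_dominated_convergence[OF Lm vm[OF r(1)] w lim dom])
  qed
  have id: "(LINT s|lborel. indicator {r n..R n} s *\<^sub>R ?G (of_real s)) =
     - \<i> * (LINT v|lborel. indicator {0..V} v *\<^sub>R ?G (half_strip (r n) v))
     + (LINT s|lborel. indicator {r n..R n} s *\<^sub>R ?G (half_strip s V))
     + \<i> * (LINT v|lborel. indicator {0..V} v *\<^sub>R ?G (half_strip (R n) v))" for n
    by (rule levy_kernel_rectangle[OF r(1,3) V(1)])
  have "(\<lambda>n. LINT s|lborel. indicator {r n..R n} s *\<^sub>R ?G (of_real s)) \<longlonglongrightarrow>
     - \<i> * (LINT v|lborel. L v) + (LINT s|lborel. indicator {0<..} s *\<^sub>R ?G (half_strip s V)) + \<i> * integral\<^sup>L (lborel :: real measure) (\<lambda>v. 0 :: complex)"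
    unfolding id by (intro tendsto_intros left bot right)
  from LIMSEQ_unique[OF top this]
  have "(LINT s|lborel. indicator {0<..} s *\<^sub>R ?G (of_real s)) = - \<i> * (LINT v|lborel. L v) + (LINT s|lborel. indicator {0<..} s *\<^sub>R ?G (half_strip s V))"
    by simp
  then have "Re (LINT s|lborel. indicator {0<..} s *\<^sub>R ?G (of_real s)) = Im (LINT v|lborel. L v) + Re (LINT s|lborel. indicator {0<..} s *\<^sub>R ?G (half_strip s V))"
    by simp
  also have "Im (LINT v|lborel. L v) = (LINT v|lborel. Im (L v))" by (rule integral_Im[OF left(1), symmetric])
  \<comment> \<open>\<open>L\<close> is real above the branch point, so only the part between pi and
    V has an imaginary part.\<close>
  also have "\<dots> = (LINT v|lborel. indicator {pi<..<V} v * (exp (- v * a) * exp (- c * (v * sin v / (1 - cos v))) * sqrt (v / - sin v)))"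
    using pi_gt_zero by (intro Bochner_Integration.integral_cong) (auto simp: L_def p_def)
  finally show ?thesis .
qed

subsection \<open>Laplace asymptotics\<close>

lemma integrable_exp_inverse_sqrt:
  assumes "g > 0"
  shows "integrable lborel (\<lambda>u::real. indicator {0<..} u * (exp (- g * u) * (1 / sqrt u)))"
proof (rule Bochner_Integration.integrable_bound[OF Bochner_Integration.integrable_add[OF integrable_inverse_sqrt[of 1] integrable_exp_decay[OF assms]]])
  show "AE u in lborel. norm (indicator {0<..} u * (exp (- g * u) * (1 / sqrt u))) \<le> norm (indicator {0<..<1} u * (1 / sqrt u) + indicator {0<..} u * exp (- g * u))"
  proof (rule AE_I2)
    fix u :: real
    show "norm (indicator {0<..} u * (exp (- g * u) * (1 / sqrt u))) \<le> norm (indicator {0<..<1} u * (1 / sqrt u) + indicator {0<..} u * exp (- g * u))"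
    proof (cases "0 < u")
      case u: True
      show ?thesis
      proof (cases "u < 1")
        case True
        have "exp (- g * u) * (1 / sqrt u) \<le> 1 * (1 / sqrt u)" using u assms by (intro mult_right_mono) auto
        also have "\<dots> \<le> 1 / sqrt u + exp (- g * u)" by simp
        finally show ?thesis using True u by simp
      next
        case False
        have "exp (- g * u) * (1 / sqrt u) \<le> exp (- g * u) * 1" using False by (intro mult_left_mono) auto
        then show ?thesis using False u by simp
      qed
    qed simp
  qed
qed auto

text \<open>After v = pi + \<epsilon>^2 u the integrand converges pointwise. The margin 2 g in the
  hypothesis is split: one g pays for the perturbation \<epsilon> m, the other remains as a decay
  rate uniform in \<epsilon> and supplies the dominating function exp (- g u) / sqrt u.\<close>

lemma laplace_part_tendsto:
  fixes x z m b g :: real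
  assumes b: "0 < b" "b \<le> pi / 2" and g: "g > 0" "x\<^sup>2 / 4 * (pi + b) / (1 + cos b) + 2 * g \<le> z"
  defines "F \<equiv> \<lambda>\<epsilon> v. indicator {pi<..<pi + b} v * (exp (- v * ((z - \<epsilon> * m) / \<epsilon>\<^sup>2)) * exp (- (x\<^sup>2 / (4 * \<epsilon>\<^sup>2)) * (v * sin v / (1 - cos v))) * sqrt (v / - sin v))"
  shows "((\<lambda>\<epsilon>. (LINT v|lborel. F \<epsilon> v) * exp (pi * ((z - \<epsilon> * m) / \<epsilon>\<^sup>2)) / \<epsilon>) \<longlongrightarrow>
    (LINT u|lborel. indicator {0<..} u * (exp (- u * (z - pi * x\<^sup>2 / 8)) * sqrt (pi / u)))) (at_right 0)"
proof -
  \<comment> \<open>The integrand in the new variable: \<open>e\<close> is the exponential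
    normalised by exp (pi a), and \<open>q\<close> is the root together with the factor \<epsilon>
    left over from \<epsilon>^2 du / \<epsilon>.\<close>
  define e where "e = (\<lambda>\<epsilon> u. exp (- u * (z - \<epsilon> * m) + x\<^sup>2 / 4 * (pi + \<epsilon>\<^sup>2 * u) * (sin (\<epsilon>\<^sup>2 * u) / (\<epsilon>\<^sup>2 * (1 + cos (\<epsilon>\<^sup>2 * u))))))"
  define q where "q = (\<lambda>\<epsilon> u. sqrt ((pi + \<epsilon>\<^sup>2 * u) * (\<epsilon>\<^sup>2 / sin (\<epsilon>\<^sup>2 * u))))"
  define H where "H = (\<lambda>\<epsilon> u. indicator {0<..<b / \<epsilon>\<^sup>2} u * (e \<epsilon> u * q \<epsilon> u))"
  have HF: "(LINT v|lborel. F \<epsilon> v) * exp (pi * ((z - \<epsilon> * m) / \<epsilon>\<^sup>2)) / \<epsilon> = (LINT u|lborel. H \<epsilon> u)" if \<epsilon>: "\<epsilon> > 0" for \<epsilon>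
  proof -
    let ?a = "(z - \<epsilon> * m) / \<epsilon>\<^sup>2"
    have "(LINT v|lborel. F \<epsilon> v) = \<epsilon>\<^sup>2 * (LINT u|lborel. F \<epsilon> (pi + \<epsilon>\<^sup>2 * u))"
      using lborel_integral_real_affine[of "\<epsilon>\<^sup>2" "F \<epsilon>" pi] \<epsilon> by simp
    then have "(LINT v|lborel. F \<epsilon> v) * exp (pi * ?a) / \<epsilon> = (\<epsilon> * exp (pi * ?a)) * (LINT u|lborel. F \<epsilon> (pi + \<epsilon>\<^sup>2 * u))"
      using \<epsilon> by (simp add: power2_eq_square)
    also have "\<dots> = (LINT u|lborel. (\<epsilon> * exp (pi * ?a)) * F \<epsilon> (pi + \<epsilon>\<^sup>2 * u))" by simp
    also have "\<dots> = (LINT u|lborel. H \<epsilon> u)"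
    proof (rule Bochner_Integration.integral_cong[OF refl])
      fix u
      show "(\<epsilon> * exp (pi * ?a)) * F \<epsilon> (pi + \<epsilon>\<^sup>2 * u) = H \<epsilon> u"
      proof (cases "0 < u \<and> u < b / \<epsilon>\<^sup>2")
        case True
        define s where "s = \<epsilon>\<^sup>2 * u"
        have s: "0 < s" "s < b" using True \<epsilon> by (auto simp: s_def field_simps)
        have "s < pi" using s b pi_gt_zero by linarith
        then have sn: "sin s > 0" using s by (intro sin_gt_zero)
        have ex: "exp (pi * ?a) * (exp (- (pi + s) * ?a) * exp (- (x\<^sup>2 / (4 * \<epsilon>\<^sup>2)) * ((pi + s) * sin (pi + s) / (1 - cos (pi + s))))) = e \<epsilon> u"
        proof -
          have "pi * ?a + (- (pi + s) * ?a + - (x\<^sup>2 / (4 * \<epsilon>\<^sup>2)) * ((pi + s) * sin (pi + s) / (1 - cos (pi + s)))) = - u * (z - \<epsilon> * m) + x\<^sup>2 / 4 * (pi + s) * (sin s / (\<epsilon>\<^sup>2 * (1 + cos s)))"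
          proof -
            have "p * r + - (p + t) * r = - (t * r)" for p r t :: real by (simp add: algebra_simps)
            then have "pi * ?a + - (pi + s) * ?a = - (s * ?a)" .
            moreover have "s * ?a = u * (z - \<epsilon> * m)" using \<epsilon> by (simp add: s_def)
            ultimately have "pi * ?a + - (pi + s) * ?a = - u * (z - \<epsilon> * m)" by simp
            moreover have "- (x\<^sup>2 / (4 * \<epsilon>\<^sup>2)) * ((pi + s) * sin (pi + s) / (1 - cos (pi + s))) = x\<^sup>2 / 4 * (pi + s) * (sin s / (\<epsilon>\<^sup>2 * (1 + cos s)))"
              by simp
            ultimately show ?thesis by linarith
          qed
          then show ?thesis unfolding e_def s_def[symmetric] exp_add[symmetric] by (simp only:)
        qed
        have sq: "\<epsilon> * sqrt ((pi + s) / - sin (pi + s)) = q \<epsilon> u"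
        proof -
          have "\<epsilon> * sqrt ((pi + s) / - sin (pi + s)) = sqrt (\<epsilon>\<^sup>2) * sqrt ((pi + s) / sin s)" using \<epsilon> by simp
          also have "\<dots> = sqrt ((pi + s) * (\<epsilon>\<^sup>2 / sin s))" unfolding real_sqrt_mult[symmetric] by (simp add: mult.commute)
          finally show ?thesis by (simp add: q_def s_def)
        qed
        have "F \<epsilon> (pi + s) = exp (- (pi + s) * ?a) * exp (- (x\<^sup>2 / (4 * \<epsilon>\<^sup>2)) * ((pi + s) * sin (pi + s) / (1 - cos (pi + s)))) * sqrt ((pi + s) / - sin (pi + s))"
        proof -
          have "indicator {pi<..<pi + b} (pi + s) = (1 :: real)" using s by simp
          then show ?thesis by (simp only: F_def mult_1)
        qed
        then have "(\<epsilon> * exp (pi * ?a)) * F \<epsilon> (pi + s) = e \<epsilon> u * q \<epsilon> u"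
          unfolding ex[symmetric] sq[symmetric] by (simp only: mult_ac)
        then show ?thesis using True by (simp add: H_def s_def)
      next
        case False
        then have "pi + \<epsilon>\<^sup>2 * u \<notin> {pi<..<pi + b}" using \<epsilon> by (auto simp: field_simps zero_less_mult_iff)
        then show ?thesis using False by (auto simp: F_def H_def)
      qed
    qed
    finally show ?thesis .
  qed
  have sinle: "2 / pi * s \<le> sin s" if "0 < s" "s < b" for s
    using abs_sin_ge(1)[of s] that b sin_gt_zero[of s] pi_gt_zero by (simp add: abs_of_pos)
  \<comment> \<open>The product of pi + s <= 3 pi / 2 and the factor pi / 2 from Jordan's
    inequality.\<close>
  define A where "A = sqrt (3 * pi\<^sup>2 / 4)"
  have bound: "norm (H \<epsilon> u) \<le> A * (indicator {0<..} u * (exp (- g * u) * (1 / sqrt u)))" if \<epsilon>: "\<epsilon> > 0" "\<epsilon> * \<bar>m\<bar> \<le> g" for \<epsilon> u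
  proof (cases "0 < u \<and> u < b / \<epsilon>\<^sup>2")
    case True
    define s where "s = \<epsilon>\<^sup>2 * u"
    have u: "u > 0" using True by simp
    have s: "0 < s" "s < b" using True \<epsilon> by (auto simp: s_def field_simps)
    have cb: "0 \<le> cos b" using b by (intro cos_ge_zero) auto
    have cs: "cos b \<le> cos s" using s b pi_gt_zero by (intro cos_monotone_0_pi_le) auto
    have sn: "sin s > 0" using s b pi_gt_zero by (intro sin_gt_zero) auto
    have e_le: "e \<epsilon> u \<le> exp (- g * u)"
    proof -
      \<comment> \<open>Using sin s <= s and cos s >= cos b reduces the exponent to a linear
        function of u, whose slope is the quantity assumed to be at most z - 2 g.\<close>
      have "sin s / (\<epsilon>\<^sup>2 * (1 + cos s)) \<le> s / (\<epsilon>\<^sup>2 * (1 + cos b))"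
        using sin_x_le_x[of s] s sn \<epsilon> cb cs by (intro frac_le mult_left_mono mult_pos_pos) auto
      also have "\<dots> = u / (1 + cos b)" using \<epsilon> by (simp add: s_def)
      finally have "x\<^sup>2 / 4 * (pi + s) * (sin s / (\<epsilon>\<^sup>2 * (1 + cos s))) \<le> x\<^sup>2 / 4 * (pi + b) * (u / (1 + cos b))"
        using s sn \<epsilon> cb cs pi_gt_zero by (intro mult_mono) auto
      also have "\<dots> = u * (x\<^sup>2 / 4 * (pi + b) / (1 + cos b))" by simp
      also have "\<dots> \<le> u * (z - 2 * g)" using g(2) u by (intro mult_left_mono) auto
      finally have 1: "x\<^sup>2 / 4 * (pi + s) * (sin s / (\<epsilon>\<^sup>2 * (1 + cos s))) \<le> u * (z - 2 * g)" .
      have "\<epsilon> * m \<le> g" using \<epsilon> abs_ge_self[of m] mult_left_mono[of m "\<bar>m\<bar>" \<epsilon>] by linarith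
      then have 2: "- u * (z - \<epsilon> * m) \<le> - u * (z - g)" using u by simp
      have "- u * (z - \<epsilon> * m) + x\<^sup>2 / 4 * (pi + s) * (sin s / (\<epsilon>\<^sup>2 * (1 + cos s))) \<le> - u * (z - g) + u * (z - 2 * g)"
        using 1 2 by linarith
      also have "\<dots> = - g * u" by (simp add: algebra_simps)
      finally show ?thesis unfolding e_def s_def by simp
    qed
    have q_le: "q \<epsilon> u \<le> A * (1 / sqrt u)"
    proof -
      have "\<epsilon>\<^sup>2 / sin s \<le> \<epsilon>\<^sup>2 / (2 / pi * s)"
        using sinle[OF s] sn s pi_gt_zero by (intro divide_left_mono mult_pos_pos) auto
      also have "\<dots> = (pi / 2) / u" using \<epsilon> u by (simp add: s_def field_simps)
      finally have "(pi + s) * (\<epsilon>\<^sup>2 / sin s) \<le> (3 * pi / 2) * ((pi / 2) / u)"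
        using s b sn pi_gt_zero by (intro mult_mono) auto
      also have "\<dots> = (3 * pi\<^sup>2 / 4) * (1 / u)" by (simp add: power2_eq_square)
      finally have "sqrt ((pi + s) * (\<epsilon>\<^sup>2 / sin s)) \<le> sqrt ((3 * pi\<^sup>2 / 4) * (1 / u))" by simp
      also have "\<dots> = A * (1 / sqrt u)" unfolding A_def real_sqrt_mult real_sqrt_divide real_sqrt_one ..
      finally show ?thesis by (simp add: q_def s_def)
    qed
    have "q \<epsilon> u \<ge> 0" using s sn pi_gt_zero by (simp add: q_def s_def[symmetric])
    moreover have "e \<epsilon> u > 0" by (simp add: e_def)
    moreover have "e \<epsilon> u * q \<epsilon> u \<le> exp (- g * u) * (A * (1 / sqrt u))"
      using e_le q_le calculation by (intro mult_mono) auto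
    ultimately show ?thesis using True by (simp add: H_def abs_mult mult_ac)
  next
    case False
    then have "H \<epsilon> u = 0" by (auto simp: H_def)
    then show ?thesis by (simp add: A_def indicator_def)
  qed
  have lim: "((\<lambda>\<epsilon>. H \<epsilon> u) \<longlongrightarrow> indicator {0<..} u * (exp (- u * (z - pi * x\<^sup>2 / 8)) * sqrt (pi / u))) (at_right 0)" for u
  proof (cases "u > 0")
    case u: True
    have sq: "((\<lambda>\<epsilon>. \<epsilon>\<^sup>2 * u) \<longlongrightarrow> 0) (at_right 0)" by real_asymp
    \<comment> \<open>Together with 1 + cos tending to 2, this limit produces pi x^2 u / 8 in the
      exponent.\<close>
    have s1: "((\<lambda>\<epsilon>. sin (\<epsilon>\<^sup>2 * u) / \<epsilon>\<^sup>2) \<longlongrightarrow> u) (at_right 0)" by real_asymp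
    have s2: "((\<lambda>\<epsilon>. \<epsilon>\<^sup>2 / sin (\<epsilon>\<^sup>2 * u)) \<longlongrightarrow> 1 / u) (at_right 0)"
      using tendsto_divide[OF tendsto_const s1, of 1] u by simp
    have e0: "((\<lambda>\<epsilon>. exp (- u * (z - \<epsilon> * m) + x\<^sup>2 / 4 * (pi + \<epsilon>\<^sup>2 * u) * (sin (\<epsilon>\<^sup>2 * u) / \<epsilon>\<^sup>2 / (1 + cos (\<epsilon>\<^sup>2 * u))))) \<longlongrightarrow> exp (- u * (z - 0 * m) + x\<^sup>2 / 4 * (pi + 0) * (u / (1 + cos 0)))) (at_right 0)"
      by (intro tendsto_intros sq s1 tendsto_ident_at) simp
    have "- u * (z - 0 * m) + x\<^sup>2 / 4 * (pi + 0) * (u / (1 + cos 0)) = - u * (z - pi * x\<^sup>2 / 8)"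
      by (simp add: algebra_simps)
    then have el: "((\<lambda>\<epsilon>. e \<epsilon> u) \<longlongrightarrow> exp (- u * (z - pi * x\<^sup>2 / 8))) (at_right 0)"
      using e0 unfolding e_def by (simp only: divide_divide_eq_left)
    have "((\<lambda>\<epsilon>. q \<epsilon> u) \<longlongrightarrow> sqrt ((pi + 0) * (1 / u))) (at_right 0)"
      unfolding q_def by (intro tendsto_intros sq s2)
    then have ql: "((\<lambda>\<epsilon>. q \<epsilon> u) \<longlongrightarrow> sqrt (pi / u)) (at_right 0)" by simp
    have "eventually (\<lambda>\<epsilon>. \<epsilon>\<^sup>2 * u < b) (at_right 0)" using order_tendstoD(2)[OF sq b(1)] .
    moreover have "eventually (\<lambda>\<epsilon>::real. \<epsilon> > 0) (at_right 0)" by (simp add: eventually_at_right_less)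
    ultimately have "eventually (\<lambda>\<epsilon>. e \<epsilon> u * q \<epsilon> u = H \<epsilon> u) (at_right 0)"
    proof eventually_elim
      case (elim \<epsilon>)
      then have "u < b / \<epsilon>\<^sup>2" by (simp add: field_simps)
      then show ?case using u by (simp add: H_def)
    qed
    from tendsto_cong[OF this] show ?thesis using tendsto_mult[OF el ql] u by simp
  next
    case False
    then show ?thesis by (simp add: H_def indicator_def)
  qed
  \<comment> \<open>Dominated convergence is applied at infinity, in the variable t = 1 /
    \<epsilon>.\<close>
  have T: "((\<lambda>t. LINT u|lborel. H (inverse t) u) \<longlongrightarrow> (LINT u|lborel. indicator {0<..} u * (exp (- u * (z - pi * x\<^sup>2 / 8)) * sqrt (pi / u)))) at_top"
  proof (rule integral_dominated_convergence_at_top[where w="\<lambda>u. A * (indicator {0<..} u * (exp (- g * u) * (1 / sqrt u)))"])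
    show "AE u in lborel. ((\<lambda>t. H (inverse t) u) \<longlongrightarrow> indicator {0<..} u * (exp (- u * (z - pi * x\<^sup>2 / 8)) * sqrt (pi / u))) at_top"
      by (intro AE_I2 filterlim_compose[OF lim] filterlim_inverse_at_right_top)
    have "((\<lambda>t. inverse t * \<bar>m\<bar>) \<longlongrightarrow> 0) at_top" by real_asymp
    then have "eventually (\<lambda>t. inverse t * \<bar>m\<bar> < g) at_top" using g(1) by (intro order_tendstoD)
    moreover have "eventually (\<lambda>t::real. t > 0) at_top" by (rule eventually_gt_at_top)
    ultimately show "eventually (\<lambda>t. AE u in lborel. norm (H (inverse t) u) \<le> A * (indicator {0<..} u * (exp (- g * u) * (1 / sqrt u)))) at_top"
      by eventually_elim (intro AE_I2 bound, auto)
    show "(\<lambda>u. H (inverse t) u) \<in> borel_measurable lborel" for t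
      unfolding H_def e_def q_def by measurable
    show "integrable lborel (\<lambda>u. A * (indicator {0<..} u * (exp (- g * u) * (1 / sqrt u))))"
      by (intro integrable_mult_right integrable_exp_inverse_sqrt g)
  qed measurable
  then have "((\<lambda>\<epsilon>. LINT u|lborel. H \<epsilon> u) \<longlongrightarrow> (LINT u|lborel. indicator {0<..} u * (exp (- u * (z - pi * x\<^sup>2 / 8)) * sqrt (pi / u)))) (at_right 0)"
    unfolding filterlim_at_right_to_top .
  moreover have "eventually (\<lambda>\<epsilon>. (LINT v|lborel. F \<epsilon> v) * exp (pi * ((z - \<epsilon> * m) / \<epsilon>\<^sup>2)) / \<epsilon> = (LINT u|lborel. H \<epsilon> u)) (at_right 0)"
    using eventually_at_right_less[of "0::real"] by eventually_elim (rule HF)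
  ultimately show ?thesis by (simp add: tendsto_cong)
qed

text \<open>The value is pi / sqrt k, a Gamma integral at 1/2; for positivity a lower bound of the
  integrand on [1, 2] is enough.\<close>

lemma laplace_constant_pos:
  fixes k :: real
  assumes "k > 0"
  shows "(LINT u|lborel. indicator {0<..} u * (exp (- u * k) * sqrt (pi / u))) > 0"
proof -
  let ?f = "\<lambda>u::real. indicator {0<..} u * (exp (- u * k) * sqrt (pi / u))"
  have eq: "?f = (\<lambda>u. sqrt pi * (indicator {0<..} u * (exp (- k * u) * (1 / sqrt u))))"
    by (auto simp: real_sqrt_divide mult_ac)
  have int: "integrable lborel ?f"
    unfolding eq by (intro integrable_mult_right integrable_exp_inverse_sqrt assms)
  define d where "d = exp (- 2 * k) * sqrt (pi / 2)"
  have d: "d > 0" by (simp add: d_def)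
  have "d = (LINT u|lborel. d * indicator {1..2::real} u)" by simp
  also have "\<dots> \<le> (LINT u|lborel. ?f u)"
  proof (rule integral_mono[OF _ int])
    show "integrable lborel (\<lambda>u. d * indicator {1..2::real} u)"
      by (intro integrable_mult_right integrable_real_indicator) (auto simp: emeasure_lborel_Icc_eq)
    fix u :: real
    show "d * indicator {1..2} u \<le> ?f u"
    proof (cases "u \<in> {1..2}")
      case True
      have "u * k \<le> 2 * k" using True assms by (intro mult_right_mono) auto
      then have "exp (- 2 * k) \<le> exp (- u * k)" by simp
      moreover have "sqrt (pi / 2) \<le> sqrt (pi / u)" using True by (intro real_sqrt_le_mono divide_left_mono) auto
      ultimately have "d \<le> exp (- u * k) * sqrt (pi / u)" unfolding d_def by (intro mult_mono) auto
      then show ?thesis using True by simp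
    next
      case False
      moreover have "0 \<le> ?f u" by (auto simp: indicator_def)
      ultimately show ?thesis by simp
    qed
  qed
  finally show ?thesis using d by linarith
qed

text \<open>On the line at depth pi + b the factor exp (- (pi + b) a) gains exp (- b a) over the
  main term, while the coth factor loses at most exp (c (pi + b) b / (1 + cos b)). The margin leaves
  a net gain exp (- b g / \<epsilon>^2), which beats the division by \<epsilon>.\<close>

lemma tail_part_tendsto:
  fixes x z m b g :: real
  assumes b: "0 < b" "b \<le> pi / 2" and g: "g > 0" "x\<^sup>2 / 4 * (pi + b) / (1 + cos b) + 2 * g \<le> z"
  shows "((\<lambda>\<epsilon>. Re (LINT s|lborel. indicator {0<..} s *\<^sub>R levy_kernel ((z - \<epsilon> * m) / \<epsilon>\<^sup>2) (x\<^sup>2 / (4 * \<epsilon>\<^sup>2)) (half_strip s (pi + b))) * exp (pi * ((z - \<epsilon> * m) / \<epsilon>\<^sup>2)) / \<epsilon>) \<longlongrightarrow> 0) (at_right 0)"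
proof -
  obtain K where K: "\<And>s. s > 0 \<Longrightarrow> norm (levy_root (half_strip s (pi + b))) \<le> K * exp (- s / 4)"
    using levy_root_bound_bottom[OF b] by blast
  have K0: "K \<ge> 0"
  proof -
    have "0 \<le> K * exp (- 1 / 4)" by (rule order.trans[OF norm_ge_zero K]) simp
    then show ?thesis by (simp add: zero_le_mult_iff)
  qed
  define Q where "Q = (LINT s|lborel. K * (indicator {0<..} s * exp (- (1/4) * s)))"
  have Qi: "integrable lborel (\<lambda>s. K * (indicator {0<..} s * exp (- (1/4) * s)))"
    by (intro integrable_mult_right integrable_exp_decay) simp
  have cb: "0 \<le> cos b" using b by (intro cos_ge_zero) auto
  have sb: "0 \<le> sin b" using b pi_gt_zero by (intro sin_ge_zero) auto
  have main: "norm (Re (LINT s|lborel. indicator {0<..} s *\<^sub>R levy_kernel ((z - \<epsilon> * m) / \<epsilon>\<^sup>2) (x\<^sup>2 / (4 * \<epsilon>\<^sup>2)) (half_strip s (pi + b))) * exp (pi * ((z - \<epsilon> * m) / \<epsilon>\<^sup>2)) / \<epsilon>)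
    \<le> Q * (exp (- (b * g) / \<epsilon>\<^sup>2) / \<epsilon>)" if \<epsilon>: "\<epsilon> > 0" "\<epsilon> * \<bar>m\<bar> \<le> g" for \<epsilon>
  proof -
    let ?a = "(z - \<epsilon> * m) / \<epsilon>\<^sup>2" and ?c = "x\<^sup>2 / (4 * \<epsilon>\<^sup>2)"
    let ?G = "\<lambda>s. indicator {0<..} s *\<^sub>R levy_kernel ?a ?c (half_strip s (pi + b))"
    \<comment> \<open>The first term is cancelled by the normalisation exp (pi a), so only the
      exponentially small factor survives.\<close>
    define w where "w = exp (- pi * ?a - (b * g) / \<epsilon>\<^sup>2)"
    have c0: "0 \<le> ?c" by simp
    have wle: "exp (- (pi + b) * ?a) * exp (?c * ((pi + b) * sin b / (1 + cos b))) \<le> w"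
    proof -
      have "\<epsilon> * m \<le> g" using \<epsilon> abs_ge_self[of m] mult_left_mono[of m "\<bar>m\<bar>" \<epsilon>] by linarith
      then have k: "x\<^sup>2 / 4 * (pi + b) / (1 + cos b) - (z - \<epsilon> * m) \<le> - g" using g by linarith
      have "(pi + b) * sin b / (1 + cos b) \<le> (pi + b) * b / (1 + cos b)"
        using sin_x_le_x[of b] b cb pi_gt_zero by (intro divide_right_mono mult_left_mono) auto
      then have "?c * ((pi + b) * sin b / (1 + cos b)) \<le> ?c * ((pi + b) * b / (1 + cos b))"
        using c0 by (intro mult_left_mono)
      also have "\<dots> = b / \<epsilon>\<^sup>2 * (x\<^sup>2 / 4 * (pi + b) / (1 + cos b))"
      proof -
        have "X / (4 * E) * (P * b / D) = b / E * (X / 4 * P / D)" for X E P D :: real by (simp add: mult_ac)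
        then show ?thesis .
      qed
      finally have "- (pi + b) * ?a + ?c * ((pi + b) * sin b / (1 + cos b)) \<le> - (pi + b) * ?a + b / \<epsilon>\<^sup>2 * (x\<^sup>2 / 4 * (pi + b) / (1 + cos b))" by simp
      also have "\<dots> = - pi * ?a + b / \<epsilon>\<^sup>2 * (x\<^sup>2 / 4 * (pi + b) / (1 + cos b) - (z - \<epsilon> * m))"
      proof -
        have "- (p + b) * (n / E) + b / E * Y = - p * (n / E) + b / E * (Y - n)" for p n E Y :: real
          by (simp add: algebra_simps diff_divide_distrib add_divide_distrib)
        then show ?thesis .
      qed
      also have "\<dots> \<le> - pi * ?a + b / \<epsilon>\<^sup>2 * (- g)" using k b by (intro add_left_mono mult_left_mono) auto
      also have "\<dots> = - pi * ?a - (b * g) / \<epsilon>\<^sup>2" by simp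
      finally show ?thesis unfolding w_def exp_add[symmetric] by simp
    qed
    have pt: "norm (?G s) \<le> w * (K * (indicator {0<..} s * exp (- (1/4) * s)))" for s
    proof (cases "s > 0")
      case True
      have "norm (?G s) = exp (- (pi + b) * ?a) * norm (levy_root (half_strip s (pi + b))) * exp (- ?c * Re ((half_strip s (pi + b)) * half_coth (half_strip s (pi + b))))"
        using True norm_levy_kernel[of ?a ?c s "pi + b"] by simp
      also have "\<dots> \<le> exp (- (pi + b) * ?a) * (K * exp (- s / 4)) * exp (?c * ((pi + b) * sin b / (1 + cos b)))"
      proof (intro mult_mono)
        have "?c * - ((pi + b) * sin b / (1 + cos b)) \<le> ?c * Re ((half_strip s (pi + b)) * half_coth (half_strip s (pi + b)))"
          using Re_half_coth_ge[OF True _ b(2)] b(1) c0 by (intro mult_left_mono) auto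
        then show "exp (- ?c * Re ((half_strip s (pi + b)) * half_coth (half_strip s (pi + b)))) \<le> exp (?c * ((pi + b) * sin b / (1 + cos b)))"
          unfolding exp_le_cancel_iff by (simp only: mult_minus_left mult_minus_right)
      qed (use K[OF True] K0 in auto)
      also have "\<dots> = (exp (- (pi + b) * ?a) * exp (?c * ((pi + b) * sin b / (1 + cos b)))) * (K * exp (- s / 4))" by (simp only: mult_ac)
      also have "\<dots> \<le> w * (K * exp (- s / 4))" using wle K0 by (intro mult_right_mono) auto
      finally show ?thesis using True by simp
    qed (simp add: K0 w_def)
    have "\<bar>Re (LINT s|lborel. ?G s)\<bar> \<le> norm (LINT s|lborel. ?G s)" by (rule abs_Re_le_cmod)
    also have "\<dots> \<le> (LINT s|lborel. w * (K * (indicator {0<..} s * exp (- (1/4) * s))))"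
    proof (rule order.trans[OF integral_norm_bound integral_mono_AE'])
      show "integrable lborel (\<lambda>s. w * (K * (indicator {0<..} s * exp (- (1/4) * s))))" by (rule integrable_mult_right[OF Qi])
      show "AE s in lborel. norm (?G s) \<le> w * (K * (indicator {0<..} s * exp (- (1/4) * s)))" by (intro AE_I2 pt)
      show "AE s in lborel. 0 \<le> w * (K * (indicator {0<..} s * exp (- (1/4) * s)))" by (intro AE_I2 order.trans[OF norm_ge_zero pt])
    qed
    also have "\<dots> = w * Q" unfolding Q_def by simp
    finally have "\<bar>Re (LINT s|lborel. ?G s)\<bar> * exp (pi * ?a) / \<epsilon> \<le> w * Q * exp (pi * ?a) / \<epsilon>"
      using \<epsilon> by (intro divide_right_mono mult_right_mono) auto
    also have "\<dots> = Q * ((w * exp (pi * ?a)) / \<epsilon>)" by simp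
    also have "w * exp (pi * ?a) = exp (- (b * g) / \<epsilon>\<^sup>2)" unfolding w_def exp_add[symmetric] by simp
    finally show ?thesis using \<epsilon> by (simp add: abs_mult)
  qed
  have "((\<lambda>\<epsilon>. \<epsilon> * \<bar>m\<bar>) \<longlongrightarrow> 0) (at_right 0)" by real_asymp
  then have "eventually (\<lambda>\<epsilon>. \<epsilon> * \<bar>m\<bar> < g) (at_right 0)" using g(1) by (intro order_tendstoD)
  then have ev: "eventually (\<lambda>\<epsilon>. norm (Re (LINT s|lborel. indicator {0<..} s *\<^sub>R levy_kernel ((z - \<epsilon> * m) / \<epsilon>\<^sup>2) (x\<^sup>2 / (4 * \<epsilon>\<^sup>2)) (half_strip s (pi + b))) * exp (pi * ((z - \<epsilon> * m) / \<epsilon>\<^sup>2)) / \<epsilon>)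
    \<le> Q * (exp (- (b * g) / \<epsilon>\<^sup>2) / \<epsilon>)) (at_right 0)"
    using eventually_at_right_less[of "0::real"] by eventually_elim (intro main, auto)
  have bg: "b * g > 0" using b g by simp
  have "((\<lambda>\<epsilon>. exp (- (b * g) / \<epsilon>\<^sup>2) / \<epsilon>) \<longlongrightarrow> 0) (at_right 0)"
  proof -
    have "((\<lambda>\<epsilon>. exp (- k / \<epsilon>\<^sup>2) / \<epsilon>) \<longlongrightarrow> 0) (at_right 0)" if "k > 0" for k :: real using that by real_asymp
    from this[OF bg] show ?thesis .
  qed
  from tendsto_mult_right_zero[OF this, of Q] show ?thesis
    by (rule Lim_null_comparison[OF ev])
qed

text \<open>As b tends to 0, the rate x^2 (pi + b) / (4 (1 + cos b)) tends to pi x^2 / 8, which the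
  condition on x puts strictly below z. Hence some depth pi + b still has a positive margin 2 g, and
  both limit lemmas apply with the same b and g.\<close>

theorem levy_kernel_integral_asymptotics:
  fixes x z m :: real
  assumes z: "z > 0" "\<bar>x\<bar> < sqrt (8 * z / pi)"
  shows "\<exists>C>0. ((\<lambda>\<epsilon>. Re (LINT s|lborel. indicator {0<..} s *\<^sub>R levy_kernel ((z - \<epsilon> * m) / \<epsilon>\<^sup>2) (x\<^sup>2 / (4 * \<epsilon>\<^sup>2)) (of_real s)) * exp (pi * ((z - \<epsilon> * m) / \<epsilon>\<^sup>2)) / \<epsilon>) \<longlongrightarrow> C) (at_right 0)"
proof -
  have "x\<^sup>2 < 8 * z / pi"
    using z real_sqrt_less_iff[of "x\<^sup>2" "8 * z / pi"] by simp
  then have k: "z - pi * x\<^sup>2 / 8 > 0" using pi_gt_zero by (simp add: field_simps)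
  have "((\<lambda>b. x\<^sup>2 / 4 * (pi + b) / (1 + cos b)) \<longlongrightarrow> x\<^sup>2 / 4 * (pi + 0) / (1 + cos 0)) (at_right 0)"
    by (intro tendsto_intros tendsto_ident_at) simp
  then have l: "((\<lambda>b. x\<^sup>2 / 4 * (pi + b) / (1 + cos b)) \<longlongrightarrow> pi * x\<^sup>2 / 8) (at_right 0)" by (simp add: mult.commute)
  have "eventually (\<lambda>b. x\<^sup>2 / 4 * (pi + b) / (1 + cos b) < z) (at_right 0)"
    using order_tendstoD(2)[OF l] k by simp
  moreover have "eventually (\<lambda>b::real. b \<in> {0<..<pi / 2}) (at_right 0)"
    by (rule eventually_at_right_real) simp
  ultimately have "eventually (\<lambda>b. x\<^sup>2 / 4 * (pi + b) / (1 + cos b) < z \<and> b \<in> {0<..<pi / 2}) (at_right 0)"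
    by eventually_elim simp
  then obtain b where b: "x\<^sup>2 / 4 * (pi + b) / (1 + cos b) < z" "0 < b" "b \<le> pi / 2"
    using eventually_happens'[of "at_right (0::real)"] by fastforce
  obtain g where g: "g > 0" "x\<^sup>2 / 4 * (pi + b) / (1 + cos b) + 2 * g \<le> z"
  proof -
    have "\<exists>g>0. y + 2 * g \<le> z" if "y < z" for y :: real
      using that by (intro exI[of _ "(z - y) / 2"]) (simp add: field_simps)
    from this[OF b(1)] show ?thesis using that by blast
  qed
  define C where "C = (LINT u|lborel. indicator {0<..} u * (exp (- u * (z - pi * x\<^sup>2 / 8)) * sqrt (pi / u)))"
  have C: "C > 0" unfolding C_def by (rule laplace_constant_pos[OF k])
  let ?a = "\<lambda>\<epsilon>. (z - \<epsilon> * m) / \<epsilon>\<^sup>2" and ?c = "\<lambda>\<epsilon>. x\<^sup>2 / (4 * \<epsilon>\<^sup>2)"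
  have "(\<lambda>\<epsilon>. Re (LINT s|lborel. indicator {0<..} s *\<^sub>R levy_kernel (?a \<epsilon>) (?c \<epsilon>) (of_real s)) * exp (pi * ?a \<epsilon>) / \<epsilon>) =
    (\<lambda>\<epsilon>. (LINT v|lborel. indicator {pi<..<pi + b} v * (exp (- v * ?a \<epsilon>) * exp (- ?c \<epsilon> * (v * sin v / (1 - cos v))) * sqrt (v / - sin v))) * exp (pi * ?a \<epsilon>) / \<epsilon>
     + Re (LINT s|lborel. indicator {0<..} s *\<^sub>R levy_kernel (?a \<epsilon>) (?c \<epsilon>) (half_strip s (pi + b))) * exp (pi * ?a \<epsilon>) / \<epsilon>)"
    by (rule ext, subst levy_contour[OF b(2,3)]) (simp_all add: distrib_right add_divide_distrib)
  moreover have "(\<dots> \<longlongrightarrow> C + 0) (at_right 0)"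
    unfolding C_def by (intro tendsto_add laplace_part_tendsto[OF b(2,3) g] tail_part_tendsto[OF b(2,3) g])
  ultimately show ?thesis using C by auto
qed

subsection \<open>The density of the dilated Brownian motion\<close>

text \<open>The variable u = \<epsilon> s - \<eta> gives a centred Gaussian of variance 1 / (2
  \<tau>); undoing the shift \<eta> / \<epsilon> only contributes a phase.\<close>

lemma normal_fourier_affine:
  fixes \<tau> \<epsilon> \<eta> x :: real
  assumes \<tau>: "\<tau> > 0" and \<epsilon>: "\<epsilon> > 0"
  shows "integrable lborel (\<lambda>s. of_real (exp (- (\<epsilon> * s - \<eta>)\<^sup>2 * \<tau>)) * iexp (- (s * x)))"
    "(LINT s|lborel. of_real (exp (- (\<epsilon> * s - \<eta>)\<^sup>2 * \<tau>)) * iexp (- (s * x))) =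
       of_real (sqrt (pi / \<tau>) / \<epsilon> * exp (- ((x / \<epsilon>)\<^sup>2 / (4 * \<tau>)))) * iexp (- (\<eta> * x / \<epsilon>))"
proof -
  let ?f = "\<lambda>s. complex_of_real (exp (- (\<epsilon> * s - \<eta>)\<^sup>2 * \<tau>)) * iexp (- (s * x))"
  define \<sigma> where "\<sigma> = sqrt (1 / (2 * \<tau>))"
  have \<sigma>: "\<sigma> > 0" "\<sigma>\<^sup>2 = 1 / (2 * \<tau>)" using \<tau> by (simp_all add: \<sigma>_def)
  define c where "c = - (\<i> * of_real (x / \<epsilon>))"
  have nd: "exp (- u\<^sup>2 * \<tau>) = sqrt (pi / \<tau>) * normal_density 0 \<sigma> u" for u
    unfolding normal_density_def \<sigma>(2) using \<tau> by (simp add: real_sqrt_divide)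
  have eq: "?f (\<eta> / \<epsilon> + 1 / \<epsilon> * u) = (of_real (sqrt (pi / \<tau>)) * iexp (- (\<eta> * x / \<epsilon>))) * (normal_density 0 \<sigma> u *\<^sub>R exp (c * of_real u))" for u
  proof -
    have "\<epsilon> * (\<eta> / \<epsilon> + 1 / \<epsilon> * u) - \<eta> = u" using \<epsilon> by (simp add: field_simps)
    moreover have "iexp (- ((\<eta> / \<epsilon> + 1 / \<epsilon> * u) * x)) = iexp (- (\<eta> * x / \<epsilon>)) * exp (c * of_real u)"
      unfolding exp_add[symmetric] c_def by (rule arg_cong[where f=exp]) (simp add: algebra_simps)
    ultimately have "?f (\<eta> / \<epsilon> + 1 / \<epsilon> * u) = of_real (exp (- u\<^sup>2 * \<tau>)) * (iexp (- (\<eta> * x / \<epsilon>)) * exp (c * of_real u))"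
      by (simp only:)
    then show ?thesis unfolding nd by (simp only: scaleR_conv_of_real of_real_mult mult_ac)
  qed
  have "integrable lborel (\<lambda>u. ?f (\<eta> / \<epsilon> + 1 / \<epsilon> * u))"
    unfolding eq by (intro integrable_mult_right normal_density_cexp_linear \<sigma>)
  then show "integrable lborel ?f"
    using lborel_integrable_real_affine_iff[of "1 / \<epsilon>" ?f "\<eta> / \<epsilon>"] \<epsilon> by simp
  have "integral\<^sup>L lborel ?f = \<bar>1 / \<epsilon>\<bar> *\<^sub>R (LINT u|lborel. ?f (\<eta> / \<epsilon> + 1 / \<epsilon> * u))"
    using \<epsilon> by (intro lborel_integral_real_affine) simp
  also have "(LINT u|lborel. ?f (\<eta> / \<epsilon> + 1 / \<epsilon> * u)) = (of_real (sqrt (pi / \<tau>)) * iexp (- (\<eta> * x / \<epsilon>))) * exp (c\<^sup>2 * of_real (\<sigma>\<^sup>2) / 2)"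
    unfolding eq integral_mult_right_zero normal_density_cexp_linear(2)[OF \<sigma>(1)] ..
  also have "c\<^sup>2 * of_real (\<sigma>\<^sup>2) / 2 = of_real (- ((x / \<epsilon>)\<^sup>2 / (4 * \<tau>)))"
    unfolding \<sigma>(2) c_def by (simp add: power_mult_distrib power_divide)
  finally show "integral\<^sup>L lborel ?f = of_real (sqrt (pi / \<tau>) / \<epsilon> * exp (- ((x / \<epsilon>)\<^sup>2 / (4 * \<tau>)))) * iexp (- (\<eta> * x / \<epsilon>))"
    using \<epsilon> by (simp only: exp_of_real scaleR_conv_of_real) (simp add: mult_ac)
qed

section \<open>The kernel on the real axis and the inversion integral\<close>

definition levy_root_real :: "real \<Rightarrow> real" where
  "levy_root_real l = sqrt (l / sinh l)"

text \<open>The kernel on the real axis without its phase. It is even in l, which reduces the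
  inversion integral to the half-line; at l = 0 division by zero gives 0.\<close>

definition levy_profile :: "real \<Rightarrow> real \<Rightarrow> real" where
  "levy_profile c l = levy_root_real l * exp (- (c * (l / tanh (l / 2))))"

lemma levy_root_of_real: "s > 0 \<Longrightarrow> levy_root (of_real s) = of_real (levy_root_real s)"
proof -
  assume s: "s > 0"
  have e: "exp (- of_real s / 2) = complex_of_real (exp (- s / 2))" "exp (- 2 * of_real s) = complex_of_real (exp (- 2 * s))"
    unfolding exp_of_real[symmetric] by simp_all
  have "exp (- 2 * s) < 1" using s by simp
  then have c: "csqrt (1 - of_real (exp (- 2 * s))) = of_real (sqrt (1 - exp (- 2 * s)))"
    using of_real_sqrt[of "1 - exp (- 2 * s)"] by simp
  have c2: "csqrt (2 * of_real s) = of_real (sqrt (2 * s))" using of_real_sqrt[of "2 * s"] s by simp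
  have e2: "exp (- s / 2) = sqrt (exp (- s))"
    by (rule real_sqrt_unique[symmetric]) (simp_all add: power2_eq_square exp_add[symmetric])
  have sh: "sinh s = exp s * (1 - exp (- 2 * s)) / 2"
    by (simp add: sinh_field_def right_diff_distrib exp_add[symmetric])
  have "levy_root (of_real s) = of_real (sqrt (2 * s) * exp (- s / 2) / sqrt (1 - exp (- 2 * s)))"
    unfolding levy_root_def e c c2 by simp
  also have "sqrt (2 * s) * exp (- s / 2) / sqrt (1 - exp (- 2 * s)) = sqrt (2 * s * exp (- s) / (1 - exp (- 2 * s)))"
    unfolding e2 real_sqrt_mult[symmetric] real_sqrt_divide[symmetric] ..
  also have "2 * s * exp (- s) / (1 - exp (- 2 * s)) = s / sinh s"
    unfolding sh using s by (simp add: exp_minus field_simps)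
  finally show ?thesis by (simp add: levy_root_real_def)
qed

lemma levy_root_real_bound: "l \<noteq> 0 \<Longrightarrow> 0 \<le> levy_root_real l \<and> levy_root_real l \<le> 8 * exp (- (1/4) * \<bar>l\<bar>)"
proof -
  have pos: "0 \<le> levy_root_real l \<and> levy_root_real l \<le> 8 * exp (- (1/4) * l)" if "l > 0" for l
  proof -
    have "norm (levy_root (of_real l - \<i> * of_real 0)) \<le> 8 * 1 * exp (- l / 4)"
      using that by (intro levy_root_bound_large[where V=0]) auto
    then show ?thesis using that levy_root_of_real[OF that] by (simp add: levy_root_real_def)
  qed
  assume "l \<noteq> 0"
  then consider "l > 0" | "l < 0" by linarith
  then show ?thesis
  proof cases
    case 2
    then have "levy_root_real l = levy_root_real (- l)" by (simp add: levy_root_real_def)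
    then show ?thesis using pos[of "- l"] 2 by simp
  qed (use pos in simp)
qed

lemma levy_kernel_of_real:
  assumes s: "s > 0"
  shows "levy_kernel a c (of_real s) = iexp (- (s * a)) * of_real (levy_profile c s)"
proof -
  have e: "exp (- of_real s) = complex_of_real (exp (- s))" unfolding exp_of_real[symmetric] by simp
  have th: "(1 + exp (- s)) / (1 - exp (- s)) = 1 / tanh (s / 2)"
    unfolding tanh_real_altdef by simp
  have h: "half_coth (of_real s) = of_real (1 / tanh (s / 2))"
    unfolding half_coth_def e th[symmetric] by simp
  have x: "exp (- of_real c * of_real s * half_coth (of_real s)) = complex_of_real (exp (- (c * (s / tanh (s / 2)))))"
    unfolding h exp_of_real[symmetric] by (rule arg_cong[where f=exp]) simp
  have y: "exp (- \<i> * of_real s * of_real a) = iexp (- (s * a))" by (simp add: mult.assoc)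
  show ?thesis unfolding levy_kernel_def levy_profile_def levy_root_of_real[OF s] x y by simp
qed

lemma integrable_exp_abs:
  assumes "a > 0"
  shows "integrable lborel (\<lambda>x::real. exp (- a * \<bar>x\<bar>))"
proof -
  let ?g = "\<lambda>x::real. indicator {0<..} x * exp (- a * x)"
  have 1: "integrable lborel ?g" by (rule integrable_exp_decay[OF assms])
  have 2: "integrable lborel (\<lambda>x. ?g (0 + (- 1) * x))"
    by (rule lborel_integrable_real_affine[OF 1]) simp
  show ?thesis
  proof (rule integrable_cong_AE_imp[OF Bochner_Integration.integrable_add[OF 1 2]])
    show "AE x in lborel. ?g x + ?g (0 + (- 1) * x) = exp (- a * \<bar>x\<bar>)"
      by (rule AE_mp[OF AE_lborel_singleton[of 0]]) (auto intro!: AE_I2 simp: indicator_def)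
  qed simp
qed

text \<open>Reflection turns the integral over the negative half-line into the conjugate of the one
  over the positive half-line.\<close>

lemma integral_hermitian:
  fixes f :: "real \<Rightarrow> complex"
  assumes f: "integrable lborel f" and sym: "\<And>l. f (- l) = cnj (f l)"
  shows "(LINT l|lborel. f l) = of_real (2 * Re (LINT l|lborel. indicator {0<..} l *\<^sub>R f l))"
proof -
  have fm: "f \<in> borel_measurable borel" using f by auto
  have i1: "integrable lborel (\<lambda>l. indicator {0<..} l *\<^sub>R f l)"
    by (rule Bochner_Integration.integrable_bound[OF f]) (use fm in \<open>auto simp: indicator_def\<close>)
  have i2: "integrable lborel (\<lambda>l. indicator {..<0} l *\<^sub>R f l)"
    by (rule Bochner_Integration.integrable_bound[OF f]) (use fm in \<open>auto simp: indicator_def\<close>)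
  have "(LINT l|lborel. f l) = (LINT l|lborel. indicator {0<..} l *\<^sub>R f l + indicator {..<0} l *\<^sub>R f l)"
  proof (rule integral_cong_AE)
    show "AE l in lborel. f l = indicator {0<..} l *\<^sub>R f l + indicator {..<0} l *\<^sub>R f l"
      by (rule AE_mp[OF AE_lborel_singleton[of 0]]) (auto intro!: AE_I2 simp: indicator_def)
  qed (use fm in auto)
  also have "\<dots> = (LINT l|lborel. indicator {0<..} l *\<^sub>R f l) + (LINT l|lborel. indicator {..<0} l *\<^sub>R f l)"
    by (rule Bochner_Integration.integral_add[OF i1 i2])
  also have "(LINT l|lborel. indicator {..<0} l *\<^sub>R f l) = (LINT l|lborel. indicator {..<0} (0 + (- 1) * l) *\<^sub>R f (0 + (- 1) * l))"
    using lborel_integral_real_affine[of "- 1" "\<lambda>l. indicator {..<0} l *\<^sub>R f l" 0] by simp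
  also have "\<dots> = (LINT l|lborel. cnj (indicator {0<..} l *\<^sub>R f l))"
    by (intro Bochner_Integration.integral_cong) (auto simp: sym indicator_def)
  also have "\<dots> = cnj (LINT l|lborel. indicator {0<..} l *\<^sub>R f l)" by (rule integral_bounded_linear[OF bounded_linear_cnj i1])
  finally show ?thesis by (simp add: complex_add_cnj)
qed

lemma AE_lborel_snd_neq: "AE p in lborel. snd (p :: real \<times> real) \<noteq> 0"
proof -
  have "AE p in lborel \<Otimes>\<^sub>M lborel. snd (p :: real \<times> real) \<noteq> 0"
  proof (rule lborel_pair.AE_pair_measure)
    show "{p \<in> space (lborel \<Otimes>\<^sub>M lborel). snd (p :: real \<times> real) \<noteq> 0} \<in> sets (lborel \<Otimes>\<^sub>M lborel)" by measurable
    show "AE x in lborel. AE y in lborel. snd (x :: real, y :: real) \<noteq> 0"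
      using AE_lborel_singleton[of "0::real"] by simp
  qed
  then show ?thesis unfolding lborel_prod .
qed

text \<open>At \<open>t = 0\<close> this is a junk value (division by zero); the line \<open>t = 0\<close> is a null set.\<close>

definition heisenberg_char_fun :: "real \<Rightarrow> real \<Rightarrow> real \<Rightarrow> real \<Rightarrow> real \<Rightarrow> complex" where
  "heisenberg_char_fun y0 z0 \<epsilon> s t = iexp (t * \<epsilon> * z0) * of_real (1 / cosh (\<epsilon>\<^sup>2 * t / 2) *
     exp (- (\<epsilon> * s - \<epsilon>\<^sup>2 * y0 * t / 2)\<^sup>2 * tanh (\<epsilon>\<^sup>2 * t / 2) / (2 * (\<epsilon>\<^sup>2 * t / 2))))"

text \<open>Origin of sqrt (l / sinh l): squaring the product and using sinh (2 \<kappa>) = 2 sinh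
  \<kappa> cosh \<kappa> leaves 2 pi times 2 \<kappa> / sinh (2 \<kappa>), and l = 2
  \<kappa>.\<close>

lemma levy_rate:
  fixes \<kappa> :: real
  assumes "\<kappa> \<noteq> 0"
  shows "tanh \<kappa> / (2 * \<kappa>) > 0" "1 / cosh \<kappa> * sqrt (pi / (tanh \<kappa> / (2 * \<kappa>))) = sqrt (2 * pi) * levy_root_real (2 * \<kappa>)"
proof -
  show pos: "tanh \<kappa> / (2 * \<kappa>) > 0"
  proof (cases "\<kappa> > 0")
    case False
    then have "\<kappa> < 0" using assms by simp
    then show ?thesis by (simp add: divide_neg_neg)
  qed simp
  have sh: "sinh \<kappa> \<noteq> 0" using assms by simp
  have ch: "cosh \<kappa> > 0" by (rule cosh_real_pos)
  have "1 / cosh \<kappa> * sqrt (pi / (tanh \<kappa> / (2 * \<kappa>))) = sqrt ((1 / cosh \<kappa>)\<^sup>2 * (pi / (tanh \<kappa> / (2 * \<kappa>))))"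
    unfolding real_sqrt_mult real_sqrt_abs using ch by simp
  also have "(1 / cosh \<kappa>)\<^sup>2 * (pi / (tanh \<kappa> / (2 * \<kappa>))) = 2 * pi * (2 * \<kappa> / sinh (2 * \<kappa>))"
    unfolding sinh_double tanh_def using sh ch by (simp add: field_simps power2_eq_square)
  also have "sqrt (2 * pi * (2 * \<kappa> / sinh (2 * \<kappa>))) = sqrt (2 * pi) * levy_root_real (2 * \<kappa>)"
    by (simp only: real_sqrt_mult levy_root_real_def)
  finally show "1 / cosh \<kappa> * sqrt (pi / (tanh \<kappa> / (2 * \<kappa>))) = sqrt (2 * pi) * levy_root_real (2 * \<kappa>)" .
qed

lemma heisenberg_char_fun_alt:
  "heisenberg_char_fun y0 z0 \<epsilon> s t = iexp (t * \<epsilon> * z0) * of_real (1 / cosh (\<epsilon>\<^sup>2 * t / 2)) *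
     of_real (exp (- (\<epsilon> * s - \<epsilon>\<^sup>2 * y0 * t / 2)\<^sup>2 * (tanh (\<epsilon>\<^sup>2 * t / 2) / (2 * (\<epsilon>\<^sup>2 * t / 2)))))"
  unfolding heisenberg_char_fun_def of_real_mult times_divide_eq_right mult.assoc ..

lemma heisenberg_char_fun_measurable:
  "(\<lambda>(t, s). heisenberg_char_fun y0 z0 \<epsilon> s t) \<in> borel_measurable (lborel \<Otimes>\<^sub>M lborel)"
  unfolding heisenberg_char_fun_def tanh_def sinh_field_def cosh_field_def by measurable

text \<open>For fixed t the function is Gaussian in s, centred at \<eta> / \<epsilon> because of the
  starting point. In the third integral the centre becomes a phase that shifts z0 to z0 - y0 x / 2,
  which is where that combination in the final exponent arises.\<close>

lemma heisenberg_char_fun_slice: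
  assumes \<epsilon>: "\<epsilon> > 0" and t: "t \<noteq> 0"
  shows "integrable lborel (\<lambda>s. heisenberg_char_fun y0 z0 \<epsilon> s t)"
    "(LINT s|lborel. norm (heisenberg_char_fun y0 z0 \<epsilon> s t)) = sqrt (2 * pi) / \<epsilon> * levy_root_real (\<epsilon>\<^sup>2 * t)"
    "(LINT s|lborel. iexp (- (s * x + t * z)) * heisenberg_char_fun y0 z0 \<epsilon> s t) =
       of_real (sqrt (2 * pi) / \<epsilon>) * (iexp (- (\<epsilon>\<^sup>2 * t * ((z - \<epsilon> * (z0 - y0 * x / 2)) / \<epsilon>\<^sup>2))) * of_real (levy_profile (x\<^sup>2 / (4 * \<epsilon>\<^sup>2)) (\<epsilon>\<^sup>2 * t)))"
proof -
  define \<kappa> where "\<kappa> = \<epsilon>\<^sup>2 * t / 2"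
  define \<tau> where "\<tau> = tanh \<kappa> / (2 * \<kappa>)"
  define \<eta> where "\<eta> = \<epsilon>\<^sup>2 * y0 * t / 2"
  have \<kappa>: "\<kappa> \<noteq> 0" using \<epsilon> t by (simp add: \<kappa>_def)
  note rate = levy_rate[OF \<kappa>, folded \<tau>_def]
  let ?E = "\<lambda>s. complex_of_real (exp (- (\<epsilon> * s - \<eta>)\<^sup>2 * \<tau>))"
  have alt: "heisenberg_char_fun y0 z0 \<epsilon> s t = iexp (t * \<epsilon> * z0) * of_real (1 / cosh \<kappa>) * ?E s" for s
    unfolding heisenberg_char_fun_alt \<kappa>_def[symmetric] \<tau>_def[symmetric] \<eta>_def[symmetric] ..
  have E: "integrable lborel ?E" "(LINT s|lborel. ?E s) = of_real (sqrt (pi / \<tau>) / \<epsilon>)"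
    using normal_fourier_affine[OF rate(1) \<epsilon>, of \<eta> 0] by simp_all
  show "integrable lborel (\<lambda>s. heisenberg_char_fun y0 z0 \<epsilon> s t)"
    unfolding alt by (intro integrable_mult_right E)
  have ch: "cosh \<kappa> > 0" by (rule cosh_real_pos)
  have n: "norm (heisenberg_char_fun y0 z0 \<epsilon> s t) = 1 / cosh \<kappa> * Re (?E s)" for s
    unfolding alt norm_mult using ch by (simp add: norm_divide)
  have "(LINT s|lborel. norm (heisenberg_char_fun y0 z0 \<epsilon> s t)) = 1 / cosh \<kappa> * Re (LINT s|lborel. ?E s)"
    unfolding n integral_mult_right_zero integral_Re[OF E(1)] ..
  also have "\<dots> = (1 / cosh \<kappa> * sqrt (pi / \<tau>)) / \<epsilon>" unfolding E(2) by simp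
  also have "\<dots> = sqrt (2 * pi) / \<epsilon> * levy_root_real (\<epsilon>\<^sup>2 * t)" unfolding rate(2) by (simp add: \<kappa>_def)
  finally show "(LINT s|lborel. norm (heisenberg_char_fun y0 z0 \<epsilon> s t)) = sqrt (2 * pi) / \<epsilon> * levy_root_real (\<epsilon>\<^sup>2 * t)" .
  have ph: "iexp (- (s * x + t * z)) * heisenberg_char_fun y0 z0 \<epsilon> s t = (iexp (t * \<epsilon> * z0 - t * z) * of_real (1 / cosh \<kappa>)) * (?E s * iexp (- (s * x)))" for s
  proof -
    have "iexp (- (s * x + t * z)) * iexp (t * \<epsilon> * z0) = iexp (t * \<epsilon> * z0 - t * z) * iexp (- (s * x))"
      unfolding exp_add[symmetric] by (rule arg_cong[where f=exp]) (simp add: algebra_simps)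
    then have "iexp (- (s * x + t * z)) * iexp (t * \<epsilon> * z0) * (of_real (1 / cosh \<kappa>) * ?E s) = iexp (t * \<epsilon> * z0 - t * z) * iexp (- (s * x)) * (of_real (1 / cosh \<kappa>) * ?E s)"
      by simp
    then show ?thesis unfolding alt by (simp only: mult_ac)
  qed
  have "(LINT s|lborel. iexp (- (s * x + t * z)) * heisenberg_char_fun y0 z0 \<epsilon> s t) =
    (iexp (t * \<epsilon> * z0 - t * z) * of_real (1 / cosh \<kappa>)) * (of_real (sqrt (pi / \<tau>) / \<epsilon> * exp (- ((x / \<epsilon>)\<^sup>2 / (4 * \<tau>)))) * iexp (- (\<eta> * x / \<epsilon>)))"
    unfolding ph integral_mult_right_zero normal_fourier_affine(2)[OF rate(1) \<epsilon>] ..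
  also have "\<dots> = (iexp (t * \<epsilon> * z0 - t * z) * iexp (- (\<eta> * x / \<epsilon>))) * of_real ((1 / cosh \<kappa> * sqrt (pi / \<tau>)) / \<epsilon> * exp (- ((x / \<epsilon>)\<^sup>2 / (4 * \<tau>))))"
    by simp
  also have "iexp (t * \<epsilon> * z0 - t * z) * iexp (- (\<eta> * x / \<epsilon>)) = iexp (- (\<epsilon>\<^sup>2 * t * ((z - \<epsilon> * (z0 - y0 * x / 2)) / \<epsilon>\<^sup>2)))"
  proof -
    have "\<eta> * x / \<epsilon> = \<epsilon> * y0 * t * x / 2" using \<epsilon> by (simp add: \<eta>_def power2_eq_square)
    then have "t * \<epsilon> * z0 - t * z + - (\<eta> * x / \<epsilon>) = - (\<epsilon>\<^sup>2 * t * ((z - \<epsilon> * (z0 - y0 * x / 2)) / \<epsilon>\<^sup>2))"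
    proof -
      have "\<epsilon>\<^sup>2 * t * ((z - \<epsilon> * (z0 - y0 * x / 2)) / \<epsilon>\<^sup>2) = t * (z - \<epsilon> * (z0 - y0 * x / 2))" using \<epsilon> by simp
      then show ?thesis unfolding \<open>\<eta> * x / \<epsilon> = \<epsilon> * y0 * t * x / 2\<close> by (simp add: algebra_simps)
    qed
    then show ?thesis unfolding exp_add[symmetric] distrib_left[symmetric] of_real_add[symmetric] by (simp only:)
  qed
  also have "(1 / cosh \<kappa> * sqrt (pi / \<tau>)) / \<epsilon> * exp (- ((x / \<epsilon>)\<^sup>2 / (4 * \<tau>))) = sqrt (2 * pi) / \<epsilon> * levy_profile (x\<^sup>2 / (4 * \<epsilon>\<^sup>2)) (\<epsilon>\<^sup>2 * t)"
  proof -
    have th: "tanh \<kappa> \<noteq> 0" using \<kappa> by simp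
    have "(x / \<epsilon>)\<^sup>2 / (4 * \<tau>) = x\<^sup>2 / (4 * \<epsilon>\<^sup>2) * (2 * \<kappa> / tanh \<kappa>)"
      unfolding \<tau>_def using th \<kappa> \<epsilon> by (simp add: power_divide mult_ac)
    then show ?thesis unfolding rate(2) levy_profile_def by (simp add: \<kappa>_def)
  qed
  finally show "(LINT s|lborel. iexp (- (s * x + t * z)) * heisenberg_char_fun y0 z0 \<epsilon> s t) =
       of_real (sqrt (2 * pi) / \<epsilon>) * (iexp (- (\<epsilon>\<^sup>2 * t * ((z - \<epsilon> * (z0 - y0 * x / 2)) / \<epsilon>\<^sup>2))) * of_real (levy_profile (x\<^sup>2 / (4 * \<epsilon>\<^sup>2)) (\<epsilon>\<^sup>2 * t)))"
    by (simp only: of_real_mult mult_ac)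
qed

text \<open>Integrating in s first leaves a multiple of \<open>levy_root_real\<close> at
  \<epsilon>^2 t, which decays exponentially in t. The slice t = 0 is excluded as a null
  set.\<close>

lemma heisenberg_char_fun_integrable:
  assumes \<epsilon>: "\<epsilon> > 0"
  shows "integrable (lborel \<Otimes>\<^sub>M lborel) (\<lambda>(s, t). heisenberg_char_fun y0 z0 \<epsilon> s t)"
proof -
  note m = heisenberg_char_fun_measurable[of y0 z0 \<epsilon>]
  have "integrable (lborel \<Otimes>\<^sub>M lborel) (\<lambda>(t, s). heisenberg_char_fun y0 z0 \<epsilon> s t)"
  proof (rule lborel_pair.Fubini_integrable[OF m])
    have e: "\<epsilon>\<^sup>2 > 0" using \<epsilon> by simp
    have "integrable lborel (\<lambda>t::real. exp (- (\<epsilon>\<^sup>2 / 4) * \<bar>t\<bar>))" by (rule integrable_exp_abs) (use e in simp)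
    then have i: "integrable lborel (\<lambda>t::real. sqrt (2 * pi) / \<epsilon> * (8 * exp (- (\<epsilon>\<^sup>2 / 4) * \<bar>t\<bar>)))" by simp
    show "integrable lborel (\<lambda>t. LINT s|lborel. norm (case (t, s) of (t, s) \<Rightarrow> heisenberg_char_fun y0 z0 \<epsilon> s t))"
    proof (rule Bochner_Integration.integrable_bound[OF i])
      show "(\<lambda>t. LINT s|lborel. norm (case (t, s) of (t, s) \<Rightarrow> heisenberg_char_fun y0 z0 \<epsilon> s t)) \<in> borel_measurable lborel"
        by (rule lborel.borel_measurable_lebesgue_integral)
          (use measurable_compose[OF m borel_measurable_norm] in \<open>simp only: case_prod_unfold fst_conv snd_conv\<close>)
      show "AE t in lborel. norm (LINT s|lborel. norm (case (t, s) of (t, s) \<Rightarrow> heisenberg_char_fun y0 z0 \<epsilon> s t)) \<le> norm (sqrt (2 * pi) / \<epsilon> * (8 * exp (- (\<epsilon>\<^sup>2 / 4) * \<bar>t\<bar>)))"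
        using AE_lborel_singleton[of "0::real"]
      proof eventually_elim
        case (elim t)
        then have "\<epsilon>\<^sup>2 * t \<noteq> 0" using e by simp
        from levy_root_real_bound[OF this] have b: "0 \<le> levy_root_real (\<epsilon>\<^sup>2 * t)" "levy_root_real (\<epsilon>\<^sup>2 * t) \<le> 8 * exp (- (\<epsilon>\<^sup>2 / 4) * \<bar>t\<bar>)"
          by (simp_all add: abs_mult)
        have "sqrt (2 * pi) / \<epsilon> * levy_root_real (\<epsilon>\<^sup>2 * t) \<le> sqrt (2 * pi) / \<epsilon> * (8 * exp (- (\<epsilon>\<^sup>2 / 4) * \<bar>t\<bar>))"
          using b \<epsilon> by (intro mult_left_mono) auto
        moreover have "0 \<le> sqrt (2 * pi) / \<epsilon> * levy_root_real (\<epsilon>\<^sup>2 * t)" using b \<epsilon> by simp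
        moreover have "(LINT s|lborel. norm (case (t, s) of (t, s) \<Rightarrow> heisenberg_char_fun y0 z0 \<epsilon> s t)) = sqrt (2 * pi) / \<epsilon> * levy_root_real (\<epsilon>\<^sup>2 * t)"
          unfolding prod.case by (rule heisenberg_char_fun_slice(2)[OF \<epsilon> elim])
        ultimately show ?case by (simp only: real_norm_def)
      qed
    qed
    show "AE t in lborel. integrable lborel (\<lambda>s. case (t, s) of (t, s) \<Rightarrow> heisenberg_char_fun y0 z0 \<epsilon> s t)"
      using AE_lborel_singleton[of "0::real"] by eventually_elim (simp add: heisenberg_char_fun_slice(1)[OF \<epsilon>])
  qed
  from lborel_pair.integrable_product_swap[OF this] show ?thesis by (simp add: case_prod_unfold)
qed

text \<open>The prefactor collects sqrt (2 pi) / \<epsilon> from the Gaussian slices, 1 /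
  \<epsilon>^2 from l = \<epsilon>^2 t, the 2 from the two conjugate half-lines and the
  normalisation of the plane.\<close>

lemma fourier_inverse_heisenberg:
  assumes \<epsilon>: "\<epsilon> > 0" and \<phi>: "\<And>p. snd p \<noteq> 0 \<Longrightarrow> \<phi> p = heisenberg_char_fun y0 z0 \<epsilon> (fst p) (snd p)"
    and \<phi>m: "\<phi> \<in> borel_measurable borel"
  shows "integrable lborel \<phi>"
    "fourier_inverse \<phi> (x, z) = 2 * sqrt (2 * pi) / ((2 * pi)\<^sup>2 * \<epsilon> ^ 3) *
      Re (LINT l|lborel. indicator {0<..} l *\<^sub>R levy_kernel ((z - \<epsilon> * (z0 - y0 * x / 2)) / \<epsilon>\<^sup>2) (x\<^sup>2 / (4 * \<epsilon>\<^sup>2)) (of_real l))"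
proof -
  let ?h = "heisenberg_char_fun y0 z0 \<epsilon>"
  let ?a = "(z - \<epsilon> * (z0 - y0 * x / 2)) / \<epsilon>\<^sup>2" and ?c = "x\<^sup>2 / (4 * \<epsilon>\<^sup>2)"
  have hi: "integrable lborel (\<lambda>p. ?h (fst p) (snd p))"
    using heisenberg_char_fun_integrable[OF \<epsilon>, of y0 z0] by (simp add: lborel_prod case_prod_unfold)
  have ae: "AE p in lborel. \<phi> p = ?h (fst p) (snd p)"
    using AE_lborel_snd_neq by eventually_elim (rule \<phi>)
  then have ae': "AE p in lborel. ?h (fst p) (snd p) = \<phi> p" by eventually_elim simp
  show "integrable lborel \<phi>"
    using integrable_cong_AE_imp[OF hi _ ae'] \<phi>m by simp
  have hm: "(\<lambda>p. ?h (fst p) (snd p)) \<in> borel_measurable lborel" using hi by auto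
  have pm: "(\<lambda>p. fourier_phase p (- (x, z))) \<in> borel_measurable lborel"
  proof -
    have "(\<lambda>p. fourier_phase p (- (x, z))) \<in> borel_measurable borel"
      by (intro borel_measurable_continuous_onI continuous_intros)
    then show ?thesis by (simp only: measurable_lborel2)
  qed
  have phi: "integrable lborel (\<lambda>p. fourier_phase p (- (x, z)) * ?h (fst p) (snd p))"
    by (rule Bochner_Integration.integrable_bound[OF hi borel_measurable_times[OF pm hm]]) (simp add: norm_mult)
  have "(LINT p|lborel. fourier_phase p (- (x, z)) * \<phi> p) = (LINT p|lborel. fourier_phase p (- (x, z)) * ?h (fst p) (snd p))"
  proof (rule integral_cong_AE[OF borel_measurable_times[OF pm] borel_measurable_times[OF pm hm]])
    show "\<phi> \<in> borel_measurable lborel" unfolding measurable_lborel2 by (rule \<phi>m)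
    show "AE p in lborel. fourier_phase p (- (x, z)) * \<phi> p = fourier_phase p (- (x, z)) * ?h (fst p) (snd p)"
      using ae by eventually_elim (simp only:)
  qed
  also have "\<dots> = (LINT t|lborel. LINT s|lborel. iexp (- (s * x + t * z)) * ?h s t)"
  proof -
    have eq: "(\<lambda>p. fourier_phase p (- (x, z)) * ?h (fst p) (snd p)) = (\<lambda>(s, t). iexp (- (s * x + t * z)) * ?h s t)"
      by (auto simp: fun_eq_iff)
    show ?thesis
      using lborel_pair.integral_snd[of "\<lambda>s t. iexp (- (s * x + t * z)) * ?h s t"] phi unfolding eq lborel_prod by simp
  qed
  also have "\<dots> = (LINT t|lborel. of_real (sqrt (2 * pi) / \<epsilon>) * (iexp (- (\<epsilon>\<^sup>2 * t * ?a)) * of_real (levy_profile ?c (\<epsilon>\<^sup>2 * t))))"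
  proof (rule integral_cong_AE)
    show "(\<lambda>t. LINT s|lborel. iexp (- (s * x + t * z)) * ?h s t) \<in> borel_measurable lborel"
    proof (rule lborel.borel_measurable_lebesgue_integral)
      have "(\<lambda>p. iexp (- (snd p * x + fst p * z))) \<in> borel_measurable ((lborel :: real measure) \<Otimes>\<^sub>M (lborel :: real measure))"
        by measurable
      from borel_measurable_times[OF this heisenberg_char_fun_measurable[of y0 z0 \<epsilon>]]
      show "(\<lambda>(t, s). iexp (- (s * x + t * z)) * ?h s t) \<in> borel_measurable (lborel \<Otimes>\<^sub>M lborel)"
        by (simp only: case_prod_unfold)
    qed
    show "(\<lambda>t. of_real (sqrt (2 * pi) / \<epsilon>) * (iexp (- (\<epsilon>\<^sup>2 * t * ?a)) * of_real (levy_profile ?c (\<epsilon>\<^sup>2 * t)))) \<in> borel_measurable lborel"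
      unfolding levy_profile_def levy_root_real_def tanh_def sinh_field_def cosh_field_def by measurable
    show "AE t in lborel. (LINT s|lborel. iexp (- (s * x + t * z)) * ?h s t) = of_real (sqrt (2 * pi) / \<epsilon>) * (iexp (- (\<epsilon>\<^sup>2 * t * ?a)) * of_real (levy_profile ?c (\<epsilon>\<^sup>2 * t)))"
      using AE_lborel_singleton[of "0::real"] by eventually_elim (rule heisenberg_char_fun_slice(3)[OF \<epsilon>])
  qed
  also have "\<dots> = of_real (sqrt (2 * pi) / \<epsilon>) * (LINT t|lborel. iexp (- (\<epsilon>\<^sup>2 * t * ?a)) * of_real (levy_profile ?c (\<epsilon>\<^sup>2 * t)))"
    by (rule integral_mult_right_zero)
  \<comment> \<open>Substitution l = \<epsilon>^2 t.\<close>
  also have "(LINT t|lborel. iexp (- (\<epsilon>\<^sup>2 * t * ?a)) * of_real (levy_profile ?c (\<epsilon>\<^sup>2 * t))) = of_real (1 / \<epsilon>\<^sup>2) * (LINT l|lborel. iexp (- (l * ?a)) * of_real (levy_profile ?c l))"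
    using lborel_integral_real_affine[of "\<epsilon>\<^sup>2" "\<lambda>l. iexp (- (l * ?a)) * complex_of_real (levy_profile ?c l)" 0] \<epsilon>
    by (simp add: scaleR_conv_of_real)
  also have "(LINT l|lborel. iexp (- (l * ?a)) * of_real (levy_profile ?c l)) = of_real (2 * Re (LINT l|lborel. indicator {0<..} l *\<^sub>R (iexp (- (l * ?a)) * of_real (levy_profile ?c l))))"
  proof (rule integral_hermitian)
    have pmeas: "levy_profile ?c \<in> borel_measurable borel"
      unfolding levy_profile_def[abs_def] levy_root_real_def tanh_def sinh_field_def cosh_field_def by measurable
    show "integrable lborel (\<lambda>l. iexp (- (l * ?a)) * of_real (levy_profile ?c l))"
    proof (rule Bochner_Integration.integrable_bound[OF integrable_mult_right[OF integrable_exp_abs[of "1/4"], of 8]])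
      show "(\<lambda>l. iexp (- (l * ?a)) * of_real (levy_profile ?c l)) \<in> borel_measurable lborel" using pmeas by simp
      show "AE l in lborel. norm (iexp (- (l * ?a)) * of_real (levy_profile ?c l)) \<le> norm (8 * exp (- (1/4) * \<bar>l\<bar>))"
        using AE_lborel_singleton[of "0::real"]
      proof eventually_elim
        case (elim l)
        have "l / tanh (l / 2) \<ge> 0"
          by (cases "l \<ge> 0") (auto intro: divide_nonneg_nonneg divide_nonpos_nonpos)
        then have "0 \<le> ?c * (l / tanh (l / 2))" by (intro mult_nonneg_nonneg) auto
        then have "exp (- (?c * (l / tanh (l / 2)))) \<le> 1" by (simp only: exp_le_one_iff neg_le_0_iff_le)
        then have "levy_profile ?c l \<le> levy_root_real l * 1"
          unfolding levy_profile_def using levy_root_real_bound[OF elim] by (intro mult_left_mono) auto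
        moreover have "0 \<le> levy_profile ?c l" using levy_root_real_bound[OF elim] by (simp add: levy_profile_def)
        ultimately show ?case using levy_root_real_bound[OF elim] by (simp add: norm_mult)
      qed
    qed simp
    show "iexp (- (- l * ?a)) * of_real (levy_profile ?c (- l)) = cnj (iexp (- (l * ?a)) * of_real (levy_profile ?c l))" for l
      by (simp add: levy_profile_def levy_root_real_def exp_cnj)
  qed
  also have "(LINT l|lborel. indicator {0<..} l *\<^sub>R (iexp (- (l * ?a)) * of_real (levy_profile ?c l))) = (LINT l|lborel. indicator {0<..} l *\<^sub>R levy_kernel ?a ?c (of_real l))"
    by (intro Bochner_Integration.integral_cong) (auto simp: indicator_def levy_kernel_of_real)
  finally have "Re (LINT p|lborel. fourier_phase p (- (x, z)) * \<phi> p) = sqrt (2 * pi) / \<epsilon> * (1 / \<epsilon>\<^sup>2 * (2 * Re (LINT l|lborel. indicator {0<..} l *\<^sub>R levy_kernel ?a ?c (of_real l))))"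
    by (simp only: of_real_mult[symmetric] Re_complex_of_real)
  then show "fourier_inverse \<phi> (x, z) = 2 * sqrt (2 * pi) / ((2 * pi)\<^sup>2 * \<epsilon> ^ 3) *
      Re (LINT l|lborel. indicator {0<..} l *\<^sub>R levy_kernel ?a ?c (of_real l))"
    unfolding fourier_inverse_def using \<epsilon> by (simp add: power2_eq_square power3_eq_cube)
qed

text \<open>Two densities of the same law agree almost everywhere; the set where they differ is open
  by continuity, and a nonempty open set is not null.\<close>

lemma continuous_density_unique:
  fixes f g :: "'b::euclidean_space \<Rightarrow> real"
  assumes "continuous_density M V f" "continuous_density M V g" 
  shows "f = g"
proof (rule ccontr)
  assume "f \<noteq> g"
  then obtain p where p: "f p \<noteq> g p" by auto
  have c: "continuous_on UNIV f" "continuous_on UNIV g" and nn: "\<And>p. 0 \<le> f p" "\<And>p. 0 \<le> g p"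
    and d: "distributed M lborel V (\<lambda>p. ennreal (f p))" "distributed M lborel V (\<lambda>p. ennreal (g p))"
    using assms by (auto simp: continuous_density_def)
  let ?U = "{p. f p \<noteq> g p}"
  have "open ?U" using c by (intro open_Collect_neq)
  have "density lborel (\<lambda>p. ennreal (f p)) = density lborel (\<lambda>p. ennreal (g p))"
    using d by (simp add: distributed_def)
  moreover have "(\<lambda>p. ennreal (f p)) \<in> borel_measurable lborel" "(\<lambda>p. ennreal (g p)) \<in> borel_measurable lborel"
    using d by (auto simp: distributed_def)
  ultimately have "AE p in lborel. ennreal (f p) = ennreal (g p)"
    using sigma_finite_measure.density_unique[OF sigma_finite_lborel] by blast
  then have "AE p in lborel. f p = g p" using nn by simp
  then have "?U \<in> null_sets lborel"
    using \<open>open ?U\<close> by (subst AE_iff_null_sets) auto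
  then have "negligible ?U"
    unfolding negligible_iff_null_sets by (rule null_sets_completionI)
  then show False using open_not_negligible[OF \<open>open ?U\<close>] p by auto
qed

theorem heisenberg_density:
  fixes X :: "real \<Rightarrow> 'a \<Rightarrow> real \<times> real \<times> real"
  assumes W: "planar_brownian_motion M F W" and X: "dilated_heisenberg_bm M F W y0 z0 \<epsilon> X" and \<epsilon>: "\<epsilon> > 0"
  shows "\<exists>f. continuous_density M (\<lambda>\<omega>. proj_xz (X 1 \<omega>)) f \<and>
    (\<forall>x z. f (x, z) = 2 * sqrt (2 * pi) / ((2 * pi)\<^sup>2 * \<epsilon> ^ 3) *
      Re (LINT l|lborel. indicator {0<..} l *\<^sub>R levy_kernel ((z - \<epsilon> * (z0 - y0 * x / 2)) / \<epsilon>\<^sup>2) (x\<^sup>2 / (4 * \<epsilon>\<^sup>2)) (of_real l)))"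
proof -
  note D = planar_brownian_motionD[OF W]
  interpret prob_space M by (rule D(1))
  let ?V = "\<lambda>\<omega>. proj_xz (X 1 \<omega>)"
  define \<phi> where "\<phi> = (\<lambda>p. expectation (\<lambda>\<omega>. fourier_phase p (?V \<omega>)))"
  have V: "?V \<in> borel_measurable M"
  proof -
    have "X 1 \<in> borel_measurable (F 1)" using X by (simp add: dilated_heisenberg_bm_def sde_solution_def)
    then have "X 1 \<in> borel_measurable M" using measurable_from_subalg[OF D(3)[of 1]] by simp
    moreover have "proj_xz \<in> borel_measurable borel"
      unfolding proj_xz_def case_prod_unfold by (intro borel_measurable_continuous_onI continuous_intros)
    ultimately show ?thesis by (rule measurable_compose)
  qed
  \<comment> \<open>The explicit formula is available off the null line t = 0, so Borel
    measurability of \<open>\<phi>\<close> is derived separately, from its definition as an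
    expectation.\<close>
  have \<phi>eq: "\<phi> p = heisenberg_char_fun y0 z0 \<epsilon> (fst p) (snd p)" if "snd p \<noteq> 0" for p
    using heisenberg_char[OF W X \<epsilon> that, of "fst p"]
    unfolding \<phi>_def heisenberg_char_fun_def proj_xz_def case_prod_unfold fst_conv snd_conv .
  have \<phi>m: "\<phi> \<in> borel_measurable borel"
  proof -
    have "(\<lambda>(p, \<omega>). fourier_phase p (?V \<omega>)) \<in> borel_measurable ((lborel :: (real \<times> real) measure) \<Otimes>\<^sub>M M)"
    proof -
      have m: "(\<lambda>x. fst (fst x)) \<in> borel_measurable ((lborel :: (real \<times> real) measure) \<Otimes>\<^sub>M M)" "(\<lambda>x. snd (fst x)) \<in> borel_measurable ((lborel :: (real \<times> real) measure) \<Otimes>\<^sub>M M)"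
        "(\<lambda>x. fst (?V (snd x))) \<in> borel_measurable ((lborel :: (real \<times> real) measure) \<Otimes>\<^sub>M M)" "(\<lambda>x. snd (?V (snd x))) \<in> borel_measurable ((lborel :: (real \<times> real) measure) \<Otimes>\<^sub>M M)"
        using measurable_compose[OF measurable_fst[of lborel M], of fst borel] measurable_compose[OF measurable_fst[of lborel M], of snd borel]
          measurable_compose[OF measurable_compose[OF measurable_snd[of lborel M] V] measurable_fst_borel] measurable_compose[OF measurable_compose[OF measurable_snd[of lborel M] V] measurable_snd_borel]
          measurable_fst_borel measurable_snd_borel by simp_all
      have r: "(\<lambda>x. fst (fst x) * fst (?V (snd x)) + snd (fst x) * snd (?V (snd x))) \<in> borel_measurable ((lborel :: (real \<times> real) measure) \<Otimes>\<^sub>M M)"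
        by (intro borel_measurable_add borel_measurable_times m)
      have "(\<lambda>r::real. iexp r) \<in> borel_measurable borel"
        by (intro borel_measurable_continuous_onI continuous_intros)
      from measurable_compose[OF r this] show ?thesis by (simp only: case_prod_unfold)
    qed
    then have "\<phi> \<in> borel_measurable lborel" unfolding \<phi>_def by (rule borel_measurable_lebesgue_integral)
    then show ?thesis unfolding measurable_lborel2 .
  qed
  note I = fourier_inverse_heisenberg[OF \<epsilon> \<phi>eq \<phi>m]
  have "continuous_density M ?V (fourier_inverse \<phi>)"
    by (rule fourier_inversion_density[OF V _ I(1)]) (simp only: \<phi>_def)
  then show ?thesis using I(2) by blast
qed

theorem proposition23:
  fixes M :: "'a measure" and F :: "real \<Rightarrow> 'a measure"
    and W :: "real \<Rightarrow> 'a \<Rightarrow> real \<times> real"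
    and y0 z0 :: real
    and X :: "real \<Rightarrow> real \<Rightarrow> 'a \<Rightarrow> real \<times> real \<times> real"
  assumes "planar_brownian_motion M F W"
    and "\<And>\<epsilon>. \<epsilon> > 0 \<Longrightarrow> dilated_heisenberg_bm M F W y0 z0 \<epsilon> (X \<epsilon>)"
  shows "(\<forall>\<epsilon>>0. \<exists>f. continuous_density M (\<lambda>\<omega>. proj_xz (X \<epsilon> 1 \<omega>)) f) \<and>
    (\<forall>f. (\<forall>\<epsilon>>0. continuous_density M (\<lambda>\<omega>. proj_xz (X \<epsilon> 1 \<omega>)) (f \<epsilon>)) \<longrightarrow>
      (\<forall>x z. z > 0 \<and> \<bar>x\<bar> < sqrt (8 * z / pi) \<longrightarrow>
        (\<exists>c0>0. (\<lambda>\<epsilon>. f \<epsilon> (x, z)) \<sim>[at_right 0]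
          (\<lambda>\<epsilon>::real. exp (- pi * z / \<epsilon>\<^sup>2) * exp (pi * (z0 - y0 * x / 2) / \<epsilon>) * \<epsilon> powi (- 2) * c0))))"
proof (intro conjI allI impI)
  note H = heisenberg_density[OF assms(1) assms(2)]
  show "\<exists>f. continuous_density M (\<lambda>\<omega>. proj_xz (X \<epsilon> 1 \<omega>)) f" if "\<epsilon> > 0" for \<epsilon>
    using H[OF that that] by blast
  fix f x z
  assume f: "\<forall>\<epsilon>>0. continuous_density M (\<lambda>\<omega>. proj_xz (X \<epsilon> 1 \<omega>)) (f \<epsilon>)"
    and xz: "z > 0 \<and> \<bar>x\<bar> < sqrt (8 * z / pi)"
  define m where "m = z0 - y0 * x / 2"
  define J where "J = (\<lambda>\<epsilon>. Re (LINT l|lborel. indicator {0<..} l *\<^sub>R levy_kernel ((z - \<epsilon> * m) / \<epsilon>\<^sup>2) (x\<^sup>2 / (4 * \<epsilon>\<^sup>2)) (of_real l)))"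
  \<comment> \<open>The part of the inversion prefactor that does not depend on \<epsilon>.\<close>
  define k where "k = 2 * sqrt (2 * pi) / (2 * pi)\<^sup>2"
  have k: "k > 0" by (simp add: k_def)
  \<comment> \<open>Uniqueness of the continuous density transfers the inversion formula to the
    given \<open>f \<epsilon>\<close>, at every point and not just almost everywhere.\<close>
  have fe: "f \<epsilon> (x, z) = k / \<epsilon> ^ 3 * J \<epsilon>" if \<epsilon>: "\<epsilon> > 0" for \<epsilon>
  proof -
    obtain g where g: "continuous_density M (\<lambda>\<omega>. proj_xz (X \<epsilon> 1 \<omega>)) g"
      "g (x, z) = 2 * sqrt (2 * pi) / ((2 * pi)\<^sup>2 * \<epsilon> ^ 3) * J \<epsilon>"
      using H[OF \<epsilon> \<epsilon>] unfolding J_def m_def by blast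
    have "f \<epsilon> = g" using f \<epsilon> g(1) continuous_density_unique by blast
    then show ?thesis using g(2) by (simp add: k_def)
  qed
  obtain C where C: "C > 0" "((\<lambda>\<epsilon>. J \<epsilon> * exp (pi * ((z - \<epsilon> * m) / \<epsilon>\<^sup>2)) / \<epsilon>) \<longlongrightarrow> C) (at_right 0)"
    using levy_kernel_integral_asymptotics[of z x m] xz unfolding J_def by blast
  have "(\<lambda>\<epsilon>. f \<epsilon> (x, z)) \<sim>[at_right 0] (\<lambda>\<epsilon>::real. exp (- pi * z / \<epsilon>\<^sup>2) * exp (pi * m / \<epsilon>) * \<epsilon> powi (- 2) * (k * C))"
  proof (rule asymp_equivI')
    have "((\<lambda>\<epsilon>. J \<epsilon> * exp (pi * ((z - \<epsilon> * m) / \<epsilon>\<^sup>2)) / \<epsilon> / C) \<longlongrightarrow> 1) (at_right 0)"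
      using tendsto_divide[OF C(2) tendsto_const, of C] C(1) by simp
    moreover have "eventually (\<lambda>\<epsilon>. J \<epsilon> * exp (pi * ((z - \<epsilon> * m) / \<epsilon>\<^sup>2)) / \<epsilon> / C =
      f \<epsilon> (x, z) / (exp (- pi * z / \<epsilon>\<^sup>2) * exp (pi * m / \<epsilon>) * \<epsilon> powi (- 2) * (k * C))) (at_right 0)"
      using eventually_at_right_less[of "0::real"]
    proof eventually_elim
      case (elim \<epsilon>)
      define u where "u = exp (pi * ((z - \<epsilon> * m) / \<epsilon>\<^sup>2))"
      have u: "u > 0" by (simp add: u_def)
      \<comment> \<open>The two exponentials of the claim are exp (- pi a) with a = (z - \<epsilon>
        m) / \<epsilon>^2; together with \<epsilon> from the integral and \<epsilon>^(-3) from the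
        prefactor this gives \<epsilon>^(-2).\<close>
      have "- pi * z / \<epsilon>\<^sup>2 + pi * m / \<epsilon> = - (pi * ((z - \<epsilon> * m) / \<epsilon>\<^sup>2))"
        using elim by (simp add: field_simps power2_eq_square)
      then have e: "exp (- pi * z / \<epsilon>\<^sup>2) * exp (pi * m / \<epsilon>) = 1 / u"
        unfolding exp_add[symmetric] u_def by (simp only: exp_minus inverse_eq_divide)
      have p: "\<epsilon> powi (- 2) = 1 / \<epsilon>\<^sup>2" by (simp add: power_int_minus divide_inverse)
      show ?case
        unfolding fe[OF elim] e p u_def[symmetric] using elim k C(1) u by (simp add: field_simps power2_eq_square power3_eq_cube)
    qed
    ultimately show "((\<lambda>\<epsilon>. f \<epsilon> (x, z) / (exp (- pi * z / \<epsilon>\<^sup>2) * exp (pi * m / \<epsilon>) * \<epsilon> powi (- 2) * (k * C))) \<longlongrightarrow> 1) (at_right 0)"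
      by (rule Lim_transform_eventually)
  qed
  then show "\<exists>c0>0. (\<lambda>\<epsilon>. f \<epsilon> (x, z)) \<sim>[at_right 0]
          (\<lambda>\<epsilon>::real. exp (- pi * z / \<epsilon>\<^sup>2) * exp (pi * (z0 - y0 * x / 2) / \<epsilon>) * \<epsilon> powi (- 2) * c0)"
    using k C(1) unfolding m_def by (intro exI[of _ "k * C"]) auto
qed

end
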